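(* Let $\Gamma$ be a countably infinite finitely presented group, let $S$ be a finite generating set of $\Gamma$, and let $E$ be the set of edges of the Cayley graph $\mathrm{Cay}(\Gamma,S)$. Fix a finite presentation of $\Gamma$ with generating set $S$, and let $D\in\mathbb N$ be at least the length of each of its defining relations and such that the complex $\mathrm{Cay}^{(2)}(\Gamma,S)$ built with this $D$ is simply connected. If $\Delta_1$ has a spectral gap on $\ell^2_{0,c}(E)$, then either $\Gamma$ has exponential growth, or $\Gamma$ is virtually infinite cyclic.
   Context: Let $G=(V,E)$ be a countable oriented graph with uniformly bounded vertex degrees, and let $\tilde G$ be the graph obtained by forgetting orientations. For $D\in\mathbb N$, the complex $G^{(2)}$ is the oriented 2-dimensional complex obtained from $G$ by gluing a polygon along each cycle of $\tilde G$ of length $\le D$ (with an arbitrary orientation of each polygon); $F$ denotes the set of these polygons. For $G=\mathrm{Cay}(\Gamma,S)$ one has $V=\Gamma$, and the complex is denoted $\mathrm{Cay}^{(2)}(\Gamma,S)$. A 0-, 1- or 2-cochain is a real function on $V$, $E$ or $F$ respectively. The coboundary operators $d$ (from 0- to 1-cochains and from 1- to 2-cochains) and boundary operators $\partial$ (from 2- to 1-cochains and from 1- to 0-cochains) are the standard ones with respect to the chosen orientations of edges and faces; they are bounded on $\ell^2$ and $\partial$ is the $\ell^2$-adjoint of $d$. $\ell^2_{0,c}(E)$ is the closure in $\ell^2(E)$ of $\{f\colon E\to\mathbb R \mid \partial f=0,\ \mathrm{supp}\, f \text{ finite}\}$. The 1-Laplacian is $\Delta_1=\partial d+d\partial\colon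 \ell^2(E)\to\ell^2(E)$; it maps $\ell^2_{0,c}(E)$ to itself, where it equals $\partial d$. We say that $\Delta_1$ has a spectral gap on $\ell^2_{0,c}(E)$ if $\mathrm{spec}(\Delta_1|_{\ell^2_{0,c}(E)})\cap[0,\varepsilon)=\varnothing$ for some $\varepsilon>0$. Exponential growth means exponential growth of the cardinality of balls in the word metric. Virtually infinite cyclic means having a finite-index subgroup isomorphic to $\mathbb Z$. *)

theory Defs
  imports "HOL-Analysis.Analysis" "HOL-Algebra.Generated_Groups" "HOL-Algebra.Elementary_Groups"
begin

section \<open>Words, presentations, growth\<close>

text \<open>The letter \<open>(s, True)\<close> stands for the generator \<open>s\<close>, and \<open>(s, False)\<close> for its formal inverse.\<close>

type_synonym 'a word = "('a \<times> bool) list"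

definition words :: "'a set \<Rightarrow> 'a word set" where
  "words S = lists (S \<times> UNIV)"

definition word_value :: "('a, 'b) monoid_scheme \<Rightarrow> 'a word \<Rightarrow> 'a" where
  "word_value G w = foldr (\<lambda>(s, b) g. (if b then s else inv\<^bsub>G\<^esub> s) \<otimes>\<^bsub>G\<^esub> g) w \<one>\<^bsub>G\<^esub>"

inductive word_step :: "'a set \<Rightarrow> 'a word set \<Rightarrow> 'a word \<Rightarrow> 'a word \<Rightarrow> bool" for S R where
  cancel: "\<lbrakk>u \<in> words S; v \<in> words S; s \<in> S\<rbrakk>
    \<Longrightarrow> word_step S R (u @ [(s, b), (s, \<not> b)] @ v) (u @ v)"
| relator: "\<lbrakk>u \<in> words S; v \<in> words S; r \<in> R\<rbrakk> \<Longrightarrow> word_step S R (u @ r @ v) (u @ v)"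

text \<open>The group \<open>\<langle>S | R\<rangle>\<close> is the set of words modulo the congruence \<open>equivclp (word_step S R)\<close>.
  The last two conditions say that evaluation of words induces a well-defined bijection (hence
  an isomorphism) from \<open>\<langle>S | R\<rangle>\<close> onto \<open>G\<close>.\<close>

definition is_presentation :: "('a, 'b) monoid_scheme \<Rightarrow> 'a set \<Rightarrow> 'a word set \<Rightarrow> bool" where
  "is_presentation G S R \<longleftrightarrow>
     S \<subseteq> carrier G \<and> R \<subseteq> words S \<and>
     (\<forall>u \<in> words S. \<forall>v \<in> words S.
        word_value G u = word_value G v \<longleftrightarrow> equivclp (word_step S R) u v) \<and>
     word_value G ` words S = carrier G"

definition word_length :: "('a, 'b) monoid_scheme \<Rightarrow> 'a set \<Rightarrow> 'a \<Rightarrow> nat" where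
  "word_length G S g = (LEAST n. \<exists>w \<in> words S. length w = n \<and> word_value G w = g)"

definition word_dist :: "('a, 'b) monoid_scheme \<Rightarrow> 'a set \<Rightarrow> 'a \<Rightarrow> 'a \<Rightarrow> nat" where
  "word_dist G S g h = word_length G S (inv\<^bsub>G\<^esub> g \<otimes>\<^bsub>G\<^esub> h)"

definition word_ball :: "('a, 'b) monoid_scheme \<Rightarrow> 'a set \<Rightarrow> nat \<Rightarrow> 'a set" where
  "word_ball G S n = {g \<in> carrier G. word_dist G S \<one>\<^bsub>G\<^esub> g \<le> n}"

definition exponential_growth :: "('a, 'b) monoid_scheme \<Rightarrow> 'a set \<Rightarrow> bool" where
  "exponential_growth G S \<longleftrightarrow>
     (\<exists>c > 0. \<exists>a > 1. \<forall>n. c * a ^ n \<le> real (card (word_ball G S n)))"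

definition virtually_infinite_cyclic :: "('a, 'b) monoid_scheme \<Rightarrow> bool" where
  "virtually_infinite_cyclic G \<longleftrightarrow>
     (\<exists>H. subgroup H G \<and> finite (rcosets\<^bsub>G\<^esub> H) \<and> G\<lparr>carrier := H\<rparr> \<cong> integer_group)"


section \<open>Oriented graphs and their 2-complexes\<close>

text \<open>An oriented graph is a vertex set \<open>V\<close> with a set \<open>E \<subseteq> V \<times> V\<close>; the edge \<open>(u, v)\<close> goes
  from \<open>u\<close> to \<open>v\<close>. If both \<open>(u, v)\<close> and \<open>(v, u)\<close> lie in \<open>E\<close>, they remain two different
  (parallel) edges when the orientations are forgotten.\<close>

type_synonym 'a edge = "'a \<times> 'a"

definition cayley_edges :: "('a, 'b) monoid_scheme \<Rightarrow> 'a set \<Rightarrow> 'a edge set" where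
  "cayley_edges G S = {(g, g \<otimes>\<^bsub>G\<^esub> s) | g s. g \<in> carrier G \<and> s \<in> S}"

text \<open>A step \<open>(e, b)\<close> traverses \<open>e\<close> along its orientation if \<open>b\<close>, and against it otherwise.\<close>

type_synonym 'a step = "'a edge \<times> bool"

fun step_src :: "'a step \<Rightarrow> 'a" where
  "step_src ((u, v), b) = (if b then u else v)"

fun step_tgt :: "'a step \<Rightarrow> 'a" where
  "step_tgt ((u, v), b) = (if b then v else u)"

text \<open>Cycles of the unoriented graph, given with a starting point and a direction. No vertex and
  no edge is repeated (the latter matters only for length 2, where it excludes backtracking).
  Loops and pairs of parallel edges are cycles of length 1 and 2.\<close>

definition is_cycle :: "'a edge set \<Rightarrow> 'a step list \<Rightarrow> bool" where
  "is_cycle E c \<longleftrightarrow>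
     c \<noteq> [] \<and> fst ` set c \<subseteq> E \<and>
     (\<forall>i < length c. step_tgt (c ! i) = step_src (c ! (Suc i mod length c))) \<and>
     distinct (map step_src c) \<and> distinct (map fst c)"

definition reverse_walk :: "'a step list \<Rightarrow> 'a step list" where
  "reverse_walk c = rev (map (\<lambda>(e, b). (e, \<not> b)) c)"

definition same_cycle :: "'a step list \<Rightarrow> 'a step list \<Rightarrow> bool" where
  "same_cycle c c' \<longleftrightarrow> (\<exists>k. c' = rotate k c \<or> c' = rotate k (reverse_walk c))"

text \<open>\<open>F\<close> contains exactly one based and directed representative of each cycle of length at most
  \<open>D\<close>: these are the polygons, and the direction of the representative is the chosen orientation.
  (The starting point plays no role for the boundary operators.)\<close>

definition is_face_set :: "'a edge set \<Rightarrow> nat \<Rightarrow> 'a step list set \<Rightarrow> bool" where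
  "is_face_set E D F \<longleftrightarrow>
     F \<subseteq> {c. is_cycle E c \<and> length c \<le> D} \<and>
     (\<forall>c. is_cycle E c \<and> length c \<le> D \<longrightarrow> (\<exists>!c'. c' \<in> F \<and> same_cycle c c'))"

text \<open>The underlying topological space is the disjoint union of \<open>V\<close>, an open interval for each
  edge and an open unit disc for each face, with the weak topology for the characteristic maps
  from \<open>{0..1}\<close> and from the closed unit disc. A face with \<open>n\<close> sides is a disc whose boundary
  circle is divided into \<open>n\<close> equal arcs, the \<open>i\<close>-th of which runs along the \<open>i\<close>-th step.\<close>

datatype 'a point = VertexPt 'a | EdgePt "'a edge" real | FacePt "'a step list" complex

definition complex_points :: "'a set \<Rightarrow> 'a edge set \<Rightarrow> 'a step list set \<Rightarrow> 'a point set" where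
  "complex_points V E F =
     VertexPt ` V \<union> {EdgePt e t | e t. e \<in> E \<and> 0 < t \<and> t < 1} \<union>
     {FacePt c z | c z. c \<in> F \<and> cmod z < 1}"

definition edge_map :: "'a edge \<Rightarrow> real \<Rightarrow> 'a point" where
  "edge_map e t =
     (if t = 0 then VertexPt (fst e) else if t = 1 then VertexPt (snd e) else EdgePt e t)"

definition step_map :: "'a step \<Rightarrow> real \<Rightarrow> 'a point" where
  "step_map p t = edge_map (fst p) (if snd p then t else 1 - t)"

definition face_map :: "'a step list \<Rightarrow> complex \<Rightarrow> 'a point" where
  "face_map c z =
     (if cmod z < 1 then FacePt c z
      else let t = real (length c) * Arg2pi z / (2 * pi)
           in step_map (c ! nat \<lfloor>t\<rfloor>) (frac t))"

definition complex_open ::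
    "'a set \<Rightarrow> 'a edge set \<Rightarrow> 'a step list set \<Rightarrow> 'a point set \<Rightarrow> bool" where
  "complex_open V E F U \<longleftrightarrow>
     U \<subseteq> complex_points V E F \<and>
     (\<forall>e \<in> E. openin (top_of_set {0..1}) {t \<in> {0..1}. edge_map e t \<in> U}) \<and>
     (\<forall>c \<in> F. openin (top_of_set (cball 0 1)) {z \<in> cball 0 1. face_map c z \<in> U})"

definition complex_space ::
    "'a set \<Rightarrow> 'a edge set \<Rightarrow> 'a step list set \<Rightarrow> 'a point topology" where
  "complex_space V E F = topology (complex_open V E F)"

lemma istopology_complex_open: "istopology (complex_open V E F)"
proof -
  have inter: "{t \<in> A. f t \<in> U \<inter> U'} = {t \<in> A. f t \<in> U} \<inter> {t \<in> A. f t \<in> U'}"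
    for A :: "'b set" and f :: "'b \<Rightarrow> 'a point" and U U' by blast
  have union: "{t \<in> A. f t \<in> \<Union>\<U>} = \<Union>((\<lambda>U. {t \<in> A. f t \<in> U}) ` \<U>)"
    for A :: "'b set" and f :: "'b \<Rightarrow> 'a point" and \<U> by blast
  have "complex_open V E F (U \<inter> U')" if "complex_open V E F U" "complex_open V E F U'" for U U'
    using that unfolding complex_open_def by (simp only: inter openin_Int) blast
  moreover have "complex_open V E F (\<Union>\<U>)" if "\<forall>U\<in>\<U>. complex_open V E F U" for \<U>
    unfolding complex_open_def
  proof (intro conjI ballI)
    show "\<Union>\<U> \<subseteq> complex_points V E F" using that unfolding complex_open_def by blast
  next
    fix e assume "e \<in> E"
    then show "openin (top_of_set {0..1}) {t \<in> {0..1}. edge_map e t \<in> \<Union>\<U>}"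
      unfolding union using that unfolding complex_open_def by (intro openin_Union) blast
  next
    fix c assume "c \<in> F"
    then show "openin (top_of_set (cball 0 1)) {z \<in> cball 0 1. face_map c z \<in> \<Union>\<U>}"
      unfolding union using that unfolding complex_open_def by (intro openin_Union) blast
  qed
  ultimately show ?thesis unfolding istopology_def by blast
qed

lemma openin_complex_space: "openin (complex_space V E F) U \<longleftrightarrow> complex_open V E F U"
  by (simp add: complex_space_def topology_inverse' istopology_complex_open)

text \<open>The analogue of \<^const>\<open>simply_connected\<close> for abstract topologies.\<close>

definition simply_connected_space :: "'a topology \<Rightarrow> bool" where
  "simply_connected_space X \<longleftrightarrow>
     (\<forall>p q. pathin X p \<and> p 1 = p 0 \<and> pathin X q \<and> q 1 = q 0
        \<longrightarrow> homotopic_with (\<lambda>r. r 1 = r 0) (top_of_set {0..1}) X p q)"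


section \<open>Cochains\<close>

text \<open>Cochains are functions that vanish outside the relevant set of cells. All the sums below
  are over finite sets when vertex degrees are bounded.\<close>

definition coboundary0 :: "'a edge set \<Rightarrow> ('a \<Rightarrow> real) \<Rightarrow> 'a edge \<Rightarrow> real" where
  "coboundary0 E f e = (if e \<in> E then f (snd e) - f (fst e) else 0)"

definition boundary1 :: "'a set \<Rightarrow> 'a edge set \<Rightarrow> ('a edge \<Rightarrow> real) \<Rightarrow> 'a \<Rightarrow> real" where
  "boundary1 V E f v =
     (if v \<in> V then (\<Sum>e | e \<in> E \<and> snd e = v. f e) - (\<Sum>e | e \<in> E \<and> fst e = v. f e) else 0)"

definition incidence :: "'a step list \<Rightarrow> 'a edge \<Rightarrow> real" where
  "incidence c e = (if (e, True) \<in> set c then 1 else 0) - (if (e, False) \<in> set c then 1 else 0)"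

definition coboundary1 :: "'a step list set \<Rightarrow> ('a edge \<Rightarrow> real) \<Rightarrow> 'a step list \<Rightarrow> real" where
  "coboundary1 F f c = (if c \<in> F then (\<Sum>e \<in> fst ` set c. incidence c e * f e) else 0)"

definition boundary2 ::
    "'a edge set \<Rightarrow> 'a step list set \<Rightarrow> ('a step list \<Rightarrow> real) \<Rightarrow> 'a edge \<Rightarrow> real" where
  "boundary2 E F f e =
     (if e \<in> E then (\<Sum>c | c \<in> F \<and> e \<in> fst ` set c. incidence c e * f c) else 0)"

definition laplacian1 ::
    "'a set \<Rightarrow> 'a edge set \<Rightarrow> 'a step list set \<Rightarrow> ('a edge \<Rightarrow> real) \<Rightarrow> 'a edge \<Rightarrow> real" where
  "laplacian1 V E F f e =
     boundary2 E F (coboundary1 F f) e + coboundary0 E (boundary1 V E f) e"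


section \<open>Square summable functions and spectra\<close>

definition ell2 :: "'i set \<Rightarrow> ('i \<Rightarrow> real) set" where
  "ell2 I = {f. (\<forall>i. i \<notin> I \<longrightarrow> f i = 0) \<and> (\<lambda>i. (f i)\<^sup>2) summable_on I}"

definition ell2_norm :: "'i set \<Rightarrow> ('i \<Rightarrow> real) \<Rightarrow> real" where
  "ell2_norm I f = sqrt (\<Sum>\<^sub>\<infinity>i\<in>I. (f i)\<^sup>2)"

definition finite_cycles :: "'a set \<Rightarrow> 'a edge set \<Rightarrow> ('a edge \<Rightarrow> real) set" where
  "finite_cycles V E =
     {f. finite {e. f e \<noteq> 0} \<and> {e. f e \<noteq> 0} \<subseteq> E \<and> (\<forall>v \<in> V. boundary1 V E f v = 0)}"

definition ell2_0c :: "'a set \<Rightarrow> 'a edge set \<Rightarrow> ('a edge \<Rightarrow> real) set" where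
  "ell2_0c V E =
     {f \<in> ell2 E. \<forall>\<epsilon> > 0. \<exists>g \<in> finite_cycles V E. ell2_norm E (\<lambda>e. f e - g e) < \<epsilon>}"

text \<open>Real spectrum of the restriction of \<open>T\<close> to the closed subspace \<open>H\<close> of \<open>\<ell>\<^sup>2(I)\<close>: the real
  numbers \<open>x\<close> for which \<open>T - x\<close> has no bounded inverse on \<open>H\<close>. For a bounded self-adjoint
  operator, such as the Laplacian, this is the whole spectrum.\<close>

definition spectrum_on ::
    "'i set \<Rightarrow> ('i \<Rightarrow> real) set \<Rightarrow> (('i \<Rightarrow> real) \<Rightarrow> 'i \<Rightarrow> real) \<Rightarrow> real set" where
  "spectrum_on I H T =
     {x. \<not> (bij_betw (\<lambda>f i. T f i - x * f i) H H \<and>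
            (\<exists>C. \<forall>f \<in> H. ell2_norm I f \<le> C * ell2_norm I (\<lambda>i. T f i - x * f i)))}"

definition has_spectral_gap ::
    "'i set \<Rightarrow> ('i \<Rightarrow> real) set \<Rightarrow> (('i \<Rightarrow> real) \<Rightarrow> 'i \<Rightarrow> real) \<Rightarrow> bool" where
  "has_spectral_gap I H T \<longleftrightarrow> (\<exists>\<epsilon> > 0. spectrum_on I H T \<inter> {0..<\<epsilon>} = {})"

end

theory Submission
  imports Defs "HOL-Algebra.Multiplicative_Group" "HOL-Library.Transitive_Closure_Table"
begin

text \<open>
  Write \<open>T = \<partial>d\<close> for the part of \<open>\<Delta>\<^sub>1\<close> that comes from the faces. On a finitely supported cycle it is
  all of \<open>\<Delta>\<^sub>1\<close>, it is symmetric, and \<open>\<langle>T f, f\<rangle> = \<parallel>d f\<parallel>\<^sup>2\<close>. A spectral gap gives \<open>\<parallel>f\<parallel> \<le> C \<parallel>T f\<parallel>\<close> for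
  finite cycles \<open>f\<close>, and since \<open>T\<close> is bounded this makes the relaxation step \<open>f \<mapsto> f - s T f\<close>, for a
  small \<open>s > 0\<close>, shrink finite cycles by a constant factor below 1 (\<open>relax_contracts\<close>). A step
  enlarges supports by a bounded distance only. Relaxing the boundary of one face again and again
  therefore produces cycles that decay exponentially with the distance from that face, and the
  geometric series of all the steps fills every finite cycle in such a way that an edge of the
  cycle influences the filling at a distant face only by an exponentially small amount
  (\<open>local_filling\<close>).

  Suppose that the growth is not exponential. Then exponentially decaying weights are summable over
  the group. Let a geodesic from \<open>x\<close> to \<open>y\<close> pass through \<open>p\<close>, let another path from \<open>x\<close> to \<open>y\<close> avoid
  a large ball around \<open>p\<close>, and integrate the cochain \<open>a db\<close> around the loop formed by the two, where
  \<open>a\<close> is a cone of height \<open>2M\<close> over \<open>p\<close> and \<open>b\<close> is the distance from \<open>x\<close>. The geodesic contributes at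
  least \<open>M\<^sup>2\<close> and the other path nothing. But \<open>d(a db)\<close> is bounded and lives near \<open>p\<close>, so a local filling
  bounds the integral by a linear function of \<open>M\<close>, up to a tail that is small when the avoided ball is
  large. Hence the ball cannot be avoided: there is a radius \<open>n\<close> such that removing the ball of
  radius \<open>n\<close> about any point of any geodesic disconnects its ends (\<open>gap_bottleneck\<close>). This idea is
  Besicovitch's inequality, made local.

  The rest is coarse geometry of Cayley graphs with this bottleneck property
  (\<open>bottleneck_dichotomy\<close>). If some point is far from a long geodesic, then this point and the ends of
  the geodesic lie in three different components of the complement of a ball. Translating this
  configuration to the ends of its own legs, over and over, yields \<open>2\<^sup>k\<close> disjoint places at distance
  \<open>O(k)\<close>, and so exponential growth. Otherwise balls stay close to geodesics, and the growth is
  linear. By the pigeonhole principle some group element moves a half-space that is cut off from a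
  geodesic properly into itself; it has infinite order, and in a group of linear growth it generates
  a subgroup of finite index.
\<close>

section \<open>The word metric\<close>

locale word_metric = group G for G :: "('a, 'b) monoid_scheme" (structure) +
  fixes S :: "'a set"
  assumes finite_gens: "finite S"
    and gens_closed: "S \<subseteq> carrier G"
    and words_onto: "word_value G ` words S = carrier G"
begin

abbreviation d :: "'a \<Rightarrow> 'a \<Rightarrow> nat" where "d \<equiv> word_dist G S"

lemma letter_closed: "s \<in> S \<Longrightarrow> (if b then s else inv s) \<in> carrier G"
  using gens_closed by auto

lemma word_value_simps [simp]:
  "word_value G [] = \<one>"
  "word_value G ((s, b) # w) = (if b then s else inv s) \<otimes> word_value G w"
  by (auto simp: word_value_def)

lemma words_simps [simp]:
  "[] \<in> words S" "(s, b) # w \<in> words S \<longleftrightarrow> s \<in> S \<and> w \<in> words S"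
  "u @ v \<in> words S \<longleftrightarrow> u \<in> words S \<and> v \<in> words S"
  by (auto simp: words_def)

lemma word_value_closed [simp]: "w \<in> words S \<Longrightarrow> word_value G w \<in> carrier G"
proof (induction w)
  case (Cons a w)
  then show ?case using letter_closed by (cases a) (auto split: if_splits)
qed simp

lemma word_value_append:
  "u \<in> words S \<Longrightarrow> v \<in> words S \<Longrightarrow> word_value G (u @ v) = word_value G u \<otimes> word_value G v"
proof (induction u)
  case (Cons a u)
  obtain s b where a: "a = (s, b)" by fastforce
  have s: "s \<in> S" "u \<in> words S" using Cons a by auto
  have "word_value G (a # u @ v) = (if b then s else inv s) \<otimes> (word_value G u \<otimes> word_value G v)"
    using Cons s a by simp
  also have "\<dots> = (if b then s else inv s) \<otimes> word_value G u \<otimes> word_value G v"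
    by (rule m_assoc[symmetric]) (use s Cons.prems letter_closed[OF s(1), of b] in simp_all)
  finally show ?case by (simp add: a)
qed simp

lemma word_inverse:
  assumes "w \<in> words S"
  obtains w' where "w' \<in> words S" "length w' = length w" "word_value G w' = inv (word_value G w)"
  using assms
proof (induction w arbitrary: thesis)
  case Nil
  show ?case by (rule Nil.prems(1)[of "[]"]) auto
next
  case (Cons a w)
  obtain s b where a: "a = (s, b)" by fastforce
  have s: "s \<in> S" "w \<in> words S" using Cons a by auto
  then obtain w' where w': "w' \<in> words S" "length w' = length w"
    "word_value G w' = inv (word_value G w)" using Cons.IH by blast
  have 1: "(if \<not> b then s else inv s) = inv (if b then s else inv s)"
    using s gens_closed by auto
  show ?case
  proof (rule Cons.prems(1)[of "w' @ [(s, \<not> b)]"])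
    have "word_value G (w' @ [(s, \<not> b)]) = inv (word_value G w) \<otimes> inv (if b then s else inv s)"
      using w' s letter_closed[OF s(1), of "\<not> b"] 1 by (simp add: word_value_append del: if_not_P)
    also have "\<dots> = inv (word_value G (a # w))"
      using s letter_closed[OF s(1), of b] by (simp only: a word_value_simps inv_mult_group word_value_closed)
    finally show "word_value G (w' @ [(s, \<not> b)]) = inv (word_value G (a # w))" .
    show "w' @ [(s, \<not> b)] \<in> words S" using w'(1) s(1) by simp
    show "length (w' @ [(s, \<not> b)]) = length (a # w)" using w'(2) by simp
  qed
qed

lemma word_length_le: "w \<in> words S \<Longrightarrow> word_length G S (word_value G w) \<le> length w"
  unfolding word_length_def by (rule Least_le) (rule bexI[of _ w], simp_all)

lemma minimal_word:
  assumes "g \<in> carrier G"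
  obtains w where "w \<in> words S" "length w = word_length G S g" "word_value G w = g"
proof -
  obtain w where w: "w \<in> words S" "word_value G w = g"
    using assms unfolding words_onto[symmetric] by (auto elim: imageE)
  have "\<exists>w \<in> words S. length w = word_length G S g \<and> word_value G w = g"
    unfolding word_length_def by (rule LeastI[of _ "length w"]) (use w in auto)
  then show ?thesis using that by blast
qed

lemma word_length_mult:
  assumes "g \<in> carrier G" "h \<in> carrier G"
  shows "word_length G S (g \<otimes> h) \<le> word_length G S g + word_length G S h"
proof -
  obtain u where u: "u \<in> words S" "length u = word_length G S g" "word_value G u = g"
    using minimal_word[OF assms(1)] .
  obtain v where v: "v \<in> words S" "length v = word_length G S h" "word_value G v = h"
    using minimal_word[OF assms(2)] .
  show ?thesis using word_length_le[of "u @ v"] u v by (simp add: word_value_append)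
qed

lemma word_length_inv_le: "g \<in> carrier G \<Longrightarrow> word_length G S (inv g) \<le> word_length G S g"
  by (metis minimal_word word_inverse word_length_le)

lemma word_length_inv: "g \<in> carrier G \<Longrightarrow> word_length G S (inv g) = word_length G S g"
  using word_length_inv_le[of g] word_length_inv_le[of "inv g"] by simp

lemma word_length_one [simp]: "word_length G S \<one> = 0"
  using word_length_le[of "[]"] by simp

lemma word_length_eq_0: "g \<in> carrier G \<Longrightarrow> word_length G S g = 0 \<longleftrightarrow> g = \<one>"
  by (metis length_0_conv minimal_word word_length_one word_value_simps(1))

lemma mult_inv_cancel:
  assumes "x \<in> carrier G" "z \<in> carrier G"
  shows "inv x \<otimes> (x \<otimes> z) = z" "x \<otimes> (inv x \<otimes> z) = z"
  using assms by (simp_all add: m_assoc[symmetric])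

lemma dist_self [simp]: "x \<in> carrier G \<Longrightarrow> d x x = 0"
  by (simp add: word_dist_def)

lemma dist_eq_0: "x \<in> carrier G \<Longrightarrow> y \<in> carrier G \<Longrightarrow> d x y = 0 \<longleftrightarrow> x = y"
  unfolding word_dist_def using word_length_eq_0[of "inv x \<otimes> y"] mult_inv_cancel(2)[of x y]
  by auto

lemma dist_sym: "x \<in> carrier G \<Longrightarrow> y \<in> carrier G \<Longrightarrow> d x y = d y x"
  unfolding word_dist_def using word_length_inv[of "inv x \<otimes> y"] by (simp add: inv_mult_group)

lemma dist_triangle:
  assumes "x \<in> carrier G" "y \<in> carrier G" "z \<in> carrier G"
  shows "d x z \<le> d x y + d y z"
proof -
  have "inv x \<otimes> z = (inv x \<otimes> y) \<otimes> (inv y \<otimes> z)"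
    using assms by (simp add: m_assoc mult_inv_cancel)
  then show ?thesis unfolding word_dist_def using word_length_mult[of "inv x \<otimes> y" "inv y \<otimes> z"] assms
    by simp
qed

lemma dist_translate [simp]:
  assumes "g \<in> carrier G" "x \<in> carrier G" "y \<in> carrier G"
  shows "d (g \<otimes> x) (g \<otimes> y) = d x y"
proof -
  have "inv (g \<otimes> x) \<otimes> (g \<otimes> y) = inv x \<otimes> y"
    using assms by (simp add: inv_mult_group m_assoc mult_inv_cancel)
  then show ?thesis unfolding word_dist_def by simp
qed

lemma dist_gen:
  assumes "x \<in> carrier G" "s \<in> S" shows "d x (x \<otimes> s) \<le> 1"
proof -
  have "inv x \<otimes> (x \<otimes> s) = word_value G [(s, True)]"
    using assms gens_closed by (auto simp: m_assoc[symmetric])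
  then show ?thesis unfolding word_dist_def using word_length_le[of "[(s, True)]"] assms by simp
qed

lemma edge_dist:
  assumes "(u, v) \<in> cayley_edges G S"
  shows "u \<in> carrier G" "v \<in> carrier G" "d u v \<le> 1"
  using assms dist_gen gens_closed by (auto simp: cayley_edges_def)

lemma neighbours_edge:
  assumes "x \<in> carrier G" "y \<in> carrier G" "d x y \<le> 1" "x \<noteq> y"
  shows "(x, y) \<in> cayley_edges G S \<or> (y, x) \<in> cayley_edges G S"
proof -
  obtain w where w: "w \<in> words S" "length w = d x y" "word_value G w = inv x \<otimes> y"
    unfolding word_dist_def using minimal_word[of "inv x \<otimes> y"] assms by auto
  have "length w = 1" using w(2) assms dist_eq_0[of x y] by linarith
  then obtain s b where sb: "w = [(s, b)]"
    by (cases w) auto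
  then have s: "s \<in> S" "s \<in> carrier G" using w gens_closed by auto
  define t where "t = (if b then s else inv s)"
  have t: "t \<in> carrier G" using s by (simp add: t_def)
  have "t = inv x \<otimes> y" using w(3) t unfolding sb by (simp add: t_def)
  then have y: "y = x \<otimes> t" using mult_inv_cancel(2)[OF assms(1,2)] by simp
  show ?thesis
  proof (cases b)
    case True
    have "(x, x \<otimes> s) \<in> cayley_edges G S" using s(1) assms(1) unfolding cayley_edges_def by blast
    then show ?thesis using y True by (simp add: t_def)
  next
    case False
    have "y \<otimes> s = x" unfolding y t_def using False s assms(1) by (simp add: m_assoc)
    moreover have "(y, y \<otimes> s) \<in> cayley_edges G S"
      using s(1) assms(2) unfolding cayley_edges_def by blast
    ultimately show ?thesis by simp
  qed
qed

definition geodesic :: "(nat \<Rightarrow> 'a) \<Rightarrow> nat \<Rightarrow> bool" where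
  "geodesic \<gamma> n \<longleftrightarrow> (\<forall>i\<le>n. \<gamma> i \<in> carrier G) \<and> (\<forall>i j. i \<le> j \<and> j \<le> n \<longrightarrow> d (\<gamma> i) (\<gamma> j) = j - i)"

lemma geodesicD:
  assumes "geodesic \<gamma> n" "i \<le> j" "j \<le> n"
  shows "\<gamma> i \<in> carrier G" "\<gamma> j \<in> carrier G" "d (\<gamma> i) (\<gamma> j) = j - i" "d (\<gamma> j) (\<gamma> i) = j - i"
proof -
  show "\<gamma> i \<in> carrier G" "\<gamma> j \<in> carrier G" "d (\<gamma> i) (\<gamma> j) = j - i"
    using assms by (auto simp: geodesic_def)
  then show "d (\<gamma> j) (\<gamma> i) = j - i" using dist_sym by simp
qed

definition is_path :: "(nat \<Rightarrow> 'a) \<Rightarrow> nat \<Rightarrow> bool" where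
  "is_path \<gamma> n \<longleftrightarrow> (\<forall>i\<le>n. \<gamma> i \<in> carrier G) \<and> (\<forall>i<n. d (\<gamma> i) (\<gamma> (Suc i)) \<le> 1)"

lemma path_dist_le:
  assumes "is_path \<gamma> n" "i \<le> j" "j \<le> n"
  shows "d (\<gamma> i) (\<gamma> j) \<le> j - i"
  using assms(2,3)
proof (induction j rule: dec_induct)
  case base
  then show ?case using assms by (simp add: is_path_def)
next
  case (step j)
  have "d (\<gamma> i) (\<gamma> (Suc j)) \<le> d (\<gamma> i) (\<gamma> j) + d (\<gamma> j) (\<gamma> (Suc j))"
    using step assms by (intro dist_triangle) (auto simp: is_path_def)
  moreover have "d (\<gamma> j) (\<gamma> (Suc j)) \<le> 1" using step assms by (auto simp: is_path_def)
  ultimately show ?case using step by auto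
qed

text \<open>The length of the path leaves no slack in any of the triangle inequalities between its points.\<close>

lemma shortest_path_geodesic:
  assumes p: "is_path \<gamma> n" and n: "d (\<gamma> 0) (\<gamma> n) = n"
  shows "geodesic \<gamma> n"
  unfolding geodesic_def
proof (intro conjI allI impI)
  have c: "\<gamma> i \<in> carrier G" if "i \<le> n" for i using p that by (simp add: is_path_def)
  show "\<gamma> i \<in> carrier G" if "i \<le> n" for i using c that .
  fix i j assume ij: "i \<le> j \<and> j \<le> n"
  have "n \<le> d (\<gamma> 0) (\<gamma> i) + d (\<gamma> i) (\<gamma> n)" using dist_triangle[of "\<gamma> 0" "\<gamma> i" "\<gamma> n"] c ij n by simp
  moreover have "d (\<gamma> i) (\<gamma> n) \<le> d (\<gamma> i) (\<gamma> j) + d (\<gamma> j) (\<gamma> n)" using c ij by (intro dist_triangle) auto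
  moreover have "d (\<gamma> 0) (\<gamma> i) \<le> i" "d (\<gamma> j) (\<gamma> n) \<le> n - j" "d (\<gamma> i) (\<gamma> j) \<le> j - i"
    using path_dist_le[OF p, of 0 i] path_dist_le[OF p, of j n] path_dist_le[OF p, of i j] ij by auto
  ultimately show "d (\<gamma> i) (\<gamma> j) = j - i" using ij by linarith
qed

lemma obtain_geodesic:
  assumes x: "x \<in> carrier G" and y: "y \<in> carrier G"
  obtains \<gamma> where "geodesic \<gamma> (d x y)" "\<gamma> 0 = x" "\<gamma> (d x y) = y"
proof -
  define n where "n = d x y"
  obtain w where w: "w \<in> words S" "length w = n" "word_value G w = inv x \<otimes> y"
    unfolding n_def word_dist_def using minimal_word[of "inv x \<otimes> y"] x y by auto
  have ws: "take i w \<in> words S" for i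
    using w(1) words_simps(3)[of "take i w" "drop i w"] by simp
  define \<gamma> where "\<gamma> i = x \<otimes> word_value G (take i w)" for i
  have c: "\<gamma> i \<in> carrier G" for i unfolding \<gamma>_def using x ws by simp
  have ends: "\<gamma> 0 = x" "\<gamma> n = y" using x y w by (simp_all add: \<gamma>_def mult_inv_cancel)
  have "d (\<gamma> i) (\<gamma> (Suc i)) \<le> 1" if i: "i < n" for i
  proof -
    have take: "take (Suc i) w = take i w @ [w ! i]" using i w(2) by (simp add: take_Suc_conv_app_nth)
    then have wi: "[w ! i] \<in> words S" using ws[of "Suc i"] words_simps(3) by metis
    have "\<gamma> (Suc i) = \<gamma> i \<otimes> word_value G [w ! i]"
      unfolding \<gamma>_def take word_value_append[OF ws wi]
      by (rule m_assoc[symmetric, OF x word_value_closed[OF ws] word_value_closed[OF wi]])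
    then have "d (\<gamma> i) (\<gamma> (Suc i)) = word_length G S (word_value G [w ! i])"
      unfolding word_dist_def using mult_inv_cancel(1)[OF c word_value_closed[OF wi]] by simp
    then show ?thesis using word_length_le[OF wi] by simp
  qed
  then have "is_path \<gamma> n" using c by (simp add: is_path_def)
  then have "geodesic \<gamma> n" by (rule shortest_path_geodesic) (simp only: ends n_def[symmetric])
  then show ?thesis using that ends n_def by blast
qed

lemma geodesic_path: "geodesic \<gamma> n \<Longrightarrow> is_path \<gamma> n"
  by (auto simp: is_path_def geodesic_def)

text \<open>Two geodesics that meet at a point between \<open>x\<close> and \<open>y\<close> form a path of length \<open>d x y\<close>.\<close>

lemma geodesic_through:
  assumes c: "x \<in> carrier G" "p \<in> carrier G" "y \<in> carrier G" and btw: "d x p + d p y = d x y"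
  obtains \<gamma> where "geodesic \<gamma> (d x y)" "\<gamma> 0 = x" "\<gamma> (d x p) = p" "\<gamma> (d x y) = y"
proof -
  define j k where "j = d x p" and "k = d p y"
  obtain \<alpha> where a: "geodesic \<alpha> j" "\<alpha> 0 = x" "\<alpha> j = p"
    unfolding j_def using obtain_geodesic[OF c(1,2)] .
  obtain \<beta> where b: "geodesic \<beta> k" "\<beta> 0 = p" "\<beta> k = y"
    unfolding k_def using obtain_geodesic[OF c(2,3)] .
  define \<gamma> where "\<gamma> i = (if i \<le> j then \<alpha> i else \<beta> (i - j))" for i
  have ends: "\<gamma> 0 = x" "\<gamma> j = p" "\<gamma> (j + k) = y" using a b by (auto simp: \<gamma>_def)
  have "is_path \<gamma> (j + k)"
    unfolding is_path_def
  proof (intro conjI allI impI)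
    show "\<gamma> i \<in> carrier G" if "i \<le> j + k" for i
      using that geodesicD(2)[OF a(1), of 0 i] geodesicD(2)[OF b(1), of 0 "i - j"] by (auto simp: \<gamma>_def)
    fix i assume i: "i < j + k"
    consider "i < j" | "i = j" | "i > j" by linarith
    then show "d (\<gamma> i) (\<gamma> (Suc i)) \<le> 1"
    proof cases
      case 1
      then show ?thesis using geodesicD(3)[OF a(1), of i "Suc i"] by (simp add: \<gamma>_def)
    next
      case 2
      then show ?thesis using geodesicD(3)[OF b(1), of 0 1] i a(3) b(2) by (simp add: \<gamma>_def)
    next
      case 3
      then show ?thesis using geodesicD(3)[OF b(1), of "i - j" "Suc i - j"] i by (simp add: \<gamma>_def)
    qed
  qed
  then have "geodesic \<gamma> (j + k)"
    by (rule shortest_path_geodesic) (use ends btw in \<open>simp add: j_def k_def\<close>)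
  then show ?thesis using that[of \<gamma>] ends btw unfolding j_def k_def by metis
qed

section \<open>Balls and growth\<close>

definition ball :: "'a \<Rightarrow> nat \<Rightarrow> 'a set" where
  "ball x n = {y \<in> carrier G. d x y \<le> n}"

lemma ball_subset: "ball x n \<subseteq> carrier G" and in_ball: "y \<in> ball x n \<longleftrightarrow> y \<in> carrier G \<and> d x y \<le> n"
  by (auto simp: ball_def)

lemma word_ball_eq: "word_ball G S n = ball \<one> n"
  by (simp add: word_ball_def ball_def)

lemma ball_translate:
  assumes "g \<in> carrier G" "x \<in> carrier G"
  shows "ball (g \<otimes> x) n = (\<lambda>y. g \<otimes> y) ` ball x n"
proof -
  have "y \<in> (\<lambda>y. g \<otimes> y) ` ball x n" if "y \<in> ball (g \<otimes> x) n" for y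
  proof
    show "y = g \<otimes> (inv g \<otimes> y)" using that assms by (simp add: in_ball m_assoc[symmetric])
    then show "inv g \<otimes> y \<in> ball x n" using that assms dist_translate[of g x "inv g \<otimes> y"]
      by (simp add: in_ball)
  qed
  then show ?thesis using assms by (auto simp: in_ball)
qed

lemma finite_ball_one: "finite (ball \<one> n)"
proof -
  have "ball \<one> n \<subseteq> word_value G ` {w. set w \<subseteq> S \<times> UNIV \<and> length w \<le> n}"
  proof
    fix y assume y: "y \<in> ball \<one> n"
    then obtain w where "w \<in> words S" "length w = word_length G S y" "word_value G w = y"
      using minimal_word[of y] by (auto simp: in_ball)
    then show "y \<in> word_value G ` {w. set w \<subseteq> S \<times> UNIV \<and> length w \<le> n}"
      using y by (auto simp: in_ball word_dist_def words_def image_iff intro!: bexI[of _ w])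
  qed
  moreover have "finite {w. set w \<subseteq> S \<times> (UNIV :: bool set) \<and> length w \<le> n}"
    by (rule finite_lists_length_le) (simp add: finite_gens)
  ultimately show ?thesis using finite_subset by blast
qed

lemma ball_eq_image: "x \<in> carrier G \<Longrightarrow> ball x n = (\<lambda>y. x \<otimes> y) ` ball \<one> n"
  using ball_translate[of x \<one> n] by simp

lemma finite_ball [simp]: "x \<in> carrier G \<Longrightarrow> finite (ball x n)"
  unfolding ball_eq_image[of x n] by (rule finite_imageI[OF finite_ball_one])

definition growth :: "nat \<Rightarrow> nat" where "growth n = card (ball \<one> n)"

lemma card_ball: "x \<in> carrier G \<Longrightarrow> card (ball x n) = growth n"
  unfolding ball_eq_image[of x n] growth_def
  by (rule card_image) (auto simp: inj_on_def in_ball)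

lemma ball_mono: "m \<le> n \<Longrightarrow> ball x m \<subseteq> ball x n"
  by (auto simp: in_ball)

lemma growth_mono: "m \<le> n \<Longrightarrow> growth m \<le> growth n"
  unfolding growth_def by (intro card_mono ball_mono) (auto simp: finite_ball_one)

lemma growth_pos: "growth n \<ge> 1"
proof -
  have "\<one> \<in> ball \<one> n" by (simp add: in_ball)
  then show ?thesis using finite_ball_one[of n] 
    by (auto simp: growth_def Suc_le_eq card_gt_0_iff)
qed

lemma between_point:
  assumes "x \<in> carrier G" "y \<in> carrier G" "k \<le> d x y"
  obtains z where "z \<in> carrier G" "d x z = k" "d z y = d x y - k"
proof -
  define n where "n = d x y"
  obtain \<gamma> where g: "geodesic \<gamma> n" "\<gamma> 0 = x" "\<gamma> n = y"
    unfolding n_def using obtain_geodesic[OF assms(1,2)] .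
  show ?thesis
  proof (rule that[of "\<gamma> k"])
    show "\<gamma> k \<in> carrier G" "d x (\<gamma> k) = k"
      using geodesicD[OF g(1), of 0 k] assms(3) unfolding g(2) n_def by simp_all
    show "d (\<gamma> k) y = d x y - k"
      using geodesicD(3)[OF g(1), of k n] assms(3) unfolding g(3) unfolding n_def by blast
  qed
qed

lemma ball_add:
  assumes "z \<in> ball x (m + n)" "x \<in> carrier G"
  obtains y where "y \<in> ball x m" "z \<in> ball y n"
proof -
  have z: "z \<in> carrier G" "d x z \<le> m + n" using assms by (auto simp: in_ball)
  obtain y where "y \<in> carrier G" "d x y = min m (d x z)" "d y z = d x z - min m (d x z)"
    using between_point[OF assms(2) z(1), of "min m (d x z)"] by auto
  then show ?thesis using z that[of y] by (auto simp: in_ball)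
qed

lemma growth_submult: "growth (m + n) \<le> growth m * growth n"
proof -
  have "ball \<one> (m + n) \<subseteq> (\<Union>y\<in>ball \<one> m. ball y n)"
    using ball_add[of _ \<one> m n] by blast
  then have "growth (m + n) \<le> card (\<Union>y\<in>ball \<one> m. ball y n)"
    unfolding growth_def by (intro card_mono) (auto simp: finite_ball_one in_ball)
  also have "\<dots> \<le> (\<Sum>y\<in>ball \<one> m. card (ball y n))"
    by (intro card_UN_le finite_ball_one)
  also have "\<dots> = growth m * growth n"
    unfolding growth_def[of m] using card_ball[of _ n] ball_subset by (simp add: subset_iff)
  finally show ?thesis .
qed

lemma dist_unbounded:
  assumes "infinite (carrier G)" "x \<in> carrier G"
  obtains y where "y \<in> carrier G" "d x y = n"
proof -
  have "\<not> carrier G \<subseteq> ball x n" using assms finite_ball finite_subset by blast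
  then obtain z where z: "z \<in> carrier G" "d x z > n" by (meson in_ball not_le subsetI)
  then show ?thesis using between_point[OF assms(2) z(1), of n] that by (metis less_imp_le)
qed

section \<open>Path components and bottlenecks\<close>

text \<open>Two points are joined in \<open>B\<close> if they lie in the same component of the subgraph spanned by \<open>B\<close>. The
  condition on \<open>x\<close> is for the path without steps, which would otherwise not be confined to \<open>B\<close>.\<close>

definition joined :: "'a set \<Rightarrow> 'a \<Rightarrow> 'a \<Rightarrow> bool" where
  "joined B x y \<longleftrightarrow> x \<in> B \<and> (\<lambda>u v. u \<in> B \<and> v \<in> B \<and> d u v \<le> 1)\<^sup>*\<^sup>* x y"

lemma joined_refl: "x \<in> B \<Longrightarrow> joined B x x"
  by (simp add: joined_def)

lemma joined_step: "joined B x y \<Longrightarrow> z \<in> B \<Longrightarrow> d y z \<le> 1 \<Longrightarrow> joined B x z"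
  unfolding joined_def by (metis (mono_tags, lifting) rtranclp.simps)

lemma joined_trans: "joined B x y \<Longrightarrow> joined B y z \<Longrightarrow> joined B x z"
  unfolding joined_def by (meson rtranclp_trans)

lemma joined_induct [consumes 1, case_names refl step]:
  assumes "joined B x y" "P x"
    and "\<And>y z. joined B x y \<Longrightarrow> P y \<Longrightarrow> z \<in> B \<Longrightarrow> d y z \<le> 1 \<Longrightarrow> P z"
  shows "P y"
proof -
  have x: "x \<in> B" and r: "(\<lambda>u v. u \<in> B \<and> v \<in> B \<and> d u v \<le> 1)\<^sup>*\<^sup>* x y"
    using assms(1) by (auto simp: joined_def)
  have "joined B x y \<and> P y"
    using r
  proof (induction rule: rtranclp_induct)
    case base
    then show ?case using x assms(2) joined_refl by blast
  next
    case (step y z)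
    then show ?case using assms(3)[of y z] joined_step[of B x y z] by blast
  qed
  then show ?thesis by blast
qed

lemma joined_mem:
  assumes "joined B x y" shows "x \<in> B" "y \<in> B"
proof -
  show "x \<in> B" using assms by (simp add: joined_def)
  show "y \<in> B" using assms \<open>x \<in> B\<close> by (induction rule: joined_induct)
qed

lemma joined_sym:
  assumes "joined B x y" "B \<subseteq> carrier G" shows "joined B y x"
  using assms(1)
proof (induction rule: joined_induct)
  case refl
  then show ?case using joined_refl joined_mem assms(1) by blast
next
  case (step y z)
  have mem: "y \<in> B" "z \<in> B" "y \<in> carrier G" "z \<in> carrier G"
    using joined_mem(2)[OF \<open>joined B x y\<close>] \<open>z \<in> B\<close> assms(2) by auto
  then have "d z y \<le> 1" using \<open>d y z \<le> 1\<close> dist_sym[of y z] by simp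
  then have "joined B z y" using joined_step[OF joined_refl] mem by blast
  then show ?case using \<open>joined B y x\<close> joined_trans by blast
qed

text \<open>All the points on a path are joined to its starting point, so a path avoids a set as soon
  as no point joined to the starting point lies in it.\<close>

lemma joined_restrict:
  assumes "joined B x y" "\<And>z. joined B x z \<Longrightarrow> z \<in> B'"
  shows "joined B' x y"
  using assms(1)
proof (induction rule: joined_induct)
  case refl
  then show ?case using assms joined_refl joined_mem by blast
next
  case (step y z)
  then show ?case using assms joined_step by metis
qed

lemma joined_mono: "joined B x y \<Longrightarrow> B \<subseteq> B' \<Longrightarrow> joined B' x y"
  using joined_restrict joined_mem by (metis subsetD)

lemma joined_geodesic:
  assumes "geodesic \<gamma> n" "i \<le> j" "j \<le> n" "\<And>k. i \<le> k \<Longrightarrow> k \<le> j \<Longrightarrow> \<gamma> k \<in> B"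
  shows "joined B (\<gamma> i) (\<gamma> j)"
  using assms(2,3,4)
proof (induction j rule: dec_induct)
  case base
  then show ?case by (intro joined_refl) auto
next
  case (step j)
  have "joined B (\<gamma> i) (\<gamma> j)" using step by auto
  moreover have "d (\<gamma> j) (\<gamma> (Suc j)) \<le> 1"
    using geodesicD(3)[OF assms(1), of j "Suc j"] step by auto
  ultimately show ?case using step joined_step by auto
qed

lemma joined_between:
  assumes "x \<in> carrier G" "y \<in> carrier G"
    and "\<And>z. z \<in> carrier G \<Longrightarrow> d x z + d z y = d x y \<Longrightarrow> z \<in> B"
  shows "joined B x y"
proof -
  define n where "n = d x y"
  obtain \<gamma> where g: "geodesic \<gamma> n" "\<gamma> 0 = x" "\<gamma> n = y"
    unfolding n_def using obtain_geodesic[OF assms(1,2)] .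
  have "\<gamma> k \<in> B" if "k \<le> n" for k
  proof (rule assms(3))
    show "\<gamma> k \<in> carrier G" using geodesicD(2)[OF g(1), of 0 k] that by simp
    have "d (\<gamma> 0) (\<gamma> k) + d (\<gamma> k) (\<gamma> n) = n"
      using geodesicD(3)[OF g(1), of 0 k] geodesicD(3)[OF g(1), of k n] that by simp
    then show "d x (\<gamma> k) + d (\<gamma> k) y = d x y" unfolding g(2,3) unfolding n_def .
  qed
  then have "joined B (\<gamma> 0) (\<gamma> n)" by (intro joined_geodesic[OF g(1)]) auto
  then show ?thesis by (simp add: g)
qed

lemma joined_translate:
  assumes "joined B x y" "B \<subseteq> carrier G" "g \<in> carrier G"
  shows "joined ((\<lambda>z. g \<otimes> z) ` B) (g \<otimes> x) (g \<otimes> y)"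
  using assms(1)
proof (induction rule: joined_induct)
  case refl
  then show ?case using joined_mem[OF assms(1)] by (intro joined_refl) auto
next
  case (step y z)
  have "d (g \<otimes> y) (g \<otimes> z) \<le> 1" using step joined_mem[OF step(1)] assms by (simp add: subset_iff)
  then show ?case using step joined_step by blast
qed

abbreviation off :: "'a \<Rightarrow> nat \<Rightarrow> 'a set" where "off p n \<equiv> carrier G - ball p n"

lemma in_off: "z \<in> off p n \<longleftrightarrow> z \<in> carrier G \<and> n < d p z"
  by (auto simp: in_ball)

lemma off_sub: "off p n \<subseteq> carrier G" by blast

lemma joined_off_translate_imp:
  assumes "joined (off p n) x y" "g \<in> carrier G" "p \<in> carrier G"
  shows "joined (off (g \<otimes> p) n) (g \<otimes> x) (g \<otimes> y)"
proof (rule joined_mono[OF joined_translate[OF assms(1) off_sub assms(2)]])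
  show "(\<lambda>z. g \<otimes> z) ` off p n \<subseteq> off (g \<otimes> p) n"
    using assms by (auto simp: in_ball)
qed

lemma joined_off_translate:
  assumes "g \<in> carrier G" "p \<in> carrier G" "x \<in> carrier G" "y \<in> carrier G"
  shows "joined (off (g \<otimes> p) n) (g \<otimes> x) (g \<otimes> y) \<longleftrightarrow> joined (off p n) x y"
  using joined_off_translate_imp[of p n x y g] joined_off_translate_imp[of "g \<otimes> p" n "g \<otimes> x" "g \<otimes> y" "inv g"]
    assms by (auto simp: mult_inv_cancel)

text \<open>Manning's bottleneck property, which characterises the graphs that are quasi-isometric to trees; it
  is required here at all the points of a geodesic, and not only at the midpoint.\<close>

definition bottleneck :: "nat \<Rightarrow> bool" where
  "bottleneck n \<longleftrightarrow> (\<forall>x\<in>carrier G. \<forall>y\<in>carrier G. \<forall>p\<in>carrier G.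
     d x p + d p y = d x y \<longrightarrow> \<not> joined (off p n) x y)"

lemma bottleneck_geodesic:
  assumes "bottleneck n" "geodesic \<gamma> L" "i \<le> j" "j \<le> k" "k \<le> L"
  shows "\<not> joined (off (\<gamma> j) n) (\<gamma> i) (\<gamma> k)"
proof -
  have "d (\<gamma> i) (\<gamma> j) + d (\<gamma> j) (\<gamma> k) = d (\<gamma> i) (\<gamma> k)"
    using assms geodesicD(3)[OF assms(2)] by simp
  then show ?thesis
    using assms geodesicD(1,2)[OF assms(2)] unfolding bottleneck_def by (meson le_trans)
qed

text \<open>If \<open>p\<close> is a point of \<open>Z\<close> nearest to \<open>x\<close>, then a geodesic \<open>\<eta>\<close> from \<open>x\<close> to a point \<open>q\<close> of \<open>Z\<close> passes near
  \<open>p\<close>. For by the bottleneck property every point of \<open>\<eta>\<close> is within \<open>n\<close> of the path that goes straight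
  from \<open>x\<close> to \<open>p\<close> and then stays in \<open>Z\<close>. Where \<open>\<eta>\<close> changes over from the first part of this path to the
  second, the two parts have distance at most \<open>2n + 1\<close>, and since \<open>p\<close> is nearest to \<open>x\<close> this happens
  close to \<open>p\<close>. The ball that is a bottleneck for \<open>\<eta>\<close> at that place lies in \<open>ball p (4n + 1)\<close>.\<close>

lemma nearest_point_unjoined:
  assumes bn: "bottleneck n" and x: "x \<in> carrier G" and Z: "Z \<subseteq> carrier G" "joined Z p q"
    and near: "\<And>w. w \<in> Z \<Longrightarrow> d x p \<le> d x w"
  shows "\<not> joined (off p (4 * n + 1)) x q"
proof
  assume contra: "joined (off p (4 * n + 1)) x q"
  have pq: "p \<in> Z" "q \<in> Z" "p \<in> carrier G" "q \<in> carrier G" using joined_mem Z by blast+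
  define I where "I = {u \<in> carrier G. d x u + d u p = d x p}"
  have I: "I \<subseteq> carrier G" "x \<in> I" using x pq by (auto simp: I_def)
  have "joined I x p" by (rule joined_between) (use x pq in \<open>auto simp: I_def\<close>)
  then have path: "joined (I \<union> Z) x q"
    using Z(2) joined_mono[of I x p "I \<union> Z"] joined_mono[of Z p q "I \<union> Z"] joined_trans by blast
  define L where "L = d x q"
  obtain \<eta> where e: "geodesic \<eta> L" "\<eta> 0 = x" "\<eta> L = q"
    unfolding L_def using obtain_geodesic[OF x pq(4)] .
  have ec: "\<eta> i \<in> carrier G" if "i \<le> L" for i using geodesicD(2)[OF e(1), of 0 i] that by simp
  have sep: "\<not> joined (off (\<eta> i) n) x q" if "i \<le> L" for i
    using bottleneck_geodesic[OF bn e(1), of 0 i L] that unfolding e(2,3) by simp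
  \<comment> \<open>The path from \<open>x\<close> through \<open>p\<close> to \<open>q\<close> has to pass near every point of a geodesic from \<open>x\<close> to \<open>q\<close>.\<close>
  have hit: "\<exists>u \<in> I \<union> Z. d (\<eta> i) u \<le> n" if "i \<le> L" for i
  proof (rule ccontr)
    assume "\<not> ?thesis"
    then have "I \<union> Z \<subseteq> off (\<eta> i) n" using I Z by (auto simp: in_ball)
    then show False using sep[OF that] path joined_mono by blast
  qed
  obtain i u w where iuw: "i \<le> L" "u \<in> I" "w \<in> Z" "d (\<eta> i) u \<le> n" "d (\<eta> i) w \<le> n + 1"
  proof (cases "\<forall>i\<le>L. \<exists>u\<in>I. d (\<eta> i) u \<le> n")
    case True
    then obtain u where "u \<in> I" "d (\<eta> L) u \<le> n" by blast
    then show ?thesis using that[of L u q] pq e(3) by simp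
  next
    case False
    define j where "j = (LEAST j. j \<le> L \<and> \<not> (\<exists>u\<in>I. d (\<eta> j) u \<le> n))"
    have j: "j \<le> L" "\<not> (\<exists>u\<in>I. d (\<eta> j) u \<le> n)"
      using LeastI_ex[of "\<lambda>j. j \<le> L \<and> \<not> (\<exists>u\<in>I. d (\<eta> j) u \<le> n)"] False unfolding j_def by blast+
    have "j \<noteq> 0"
    proof
      assume "j = 0"
      then have "d (\<eta> j) x = 0" using e(2) x by simp
      then show False using j I(2) by auto
    qed
    then have j1: "j - 1 < j" by simp
    then obtain u where u: "u \<in> I" "d (\<eta> (j - 1)) u \<le> n"
      using not_less_Least[of "j - 1" "\<lambda>j. j \<le> L \<and> \<not> (\<exists>u\<in>I. d (\<eta> j) u \<le> n)"] j
      unfolding j_def[symmetric] by auto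
    obtain w where w: "w \<in> Z" "d (\<eta> j) w \<le> n" using hit[OF j(1)] j(2) by blast
    have "d (\<eta> (j - 1)) w \<le> d (\<eta> (j - 1)) (\<eta> j) + d (\<eta> j) w"
      using j j1 w Z by (intro dist_triangle ec) auto
    also have "d (\<eta> (j - 1)) (\<eta> j) = 1"
      using geodesicD(3)[OF e(1), of "j - 1" j] j j1 by simp
    finally show ?thesis using that[of "j - 1" u w] u w j by simp
  qed
  have c: "\<eta> i \<in> carrier G" "u \<in> carrier G" "w \<in> carrier G" using ec iuw I Z by blast+
  have "d u w \<le> d u (\<eta> i) + d (\<eta> i) w" using c by (intro dist_triangle)
  then have uw: "d u w \<le> 2 * n + 1" using iuw dist_sym[OF c(1,2)] by simp
  have "d x p \<le> d x u + d u w" using near[OF iuw(3)] dist_triangle[OF x c(2,3)] by linarith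
  then have up: "d u p \<le> 2 * n + 1" using iuw(2) uw by (simp add: I_def)
  have "ball (\<eta> i) n \<subseteq> ball p (4 * n + 1)"
  proof
    fix z assume z: "z \<in> ball (\<eta> i) n"
    then have zc: "z \<in> carrier G" by (simp add: in_ball)
    have "d p z \<le> d p u + d u z" using pq c zc by (intro dist_triangle)
    also have "d u z \<le> d u (\<eta> i) + d (\<eta> i) z" using c zc by (intro dist_triangle)
    finally show "z \<in> ball p (4 * n + 1)"
      using up iuw z zc dist_sym[OF c(1,2)] dist_sym[OF pq(3) c(2)] by (simp add: in_ball)
  qed
  then show False using contra sep[OF iuw(1)] joined_mono[OF contra, of "off (\<eta> i) n"] by blast
qed

section \<open>Three directions force exponential growth\<close>

text \<open>The points \<open>x\<close>, \<open>y\<close>, \<open>z\<close> are in three components of the complement of a ball about \<open>p\<close>. Their distance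
  from \<open>p\<close> exceeds \<open>2n\<close> in order that balls of radius \<open>n\<close> about them do not meet the one about \<open>p\<close>; the
  bound \<open>R\<close> makes the growth rate explicit.\<close>

definition tripod :: "nat \<Rightarrow> 'a \<Rightarrow> nat \<Rightarrow> 'a \<Rightarrow> 'a \<Rightarrow> 'a \<Rightarrow> bool" where
  "tripod n p R x y z \<longleftrightarrow> p \<in> carrier G \<and> {x, y, z} \<subseteq> carrier G \<and>
     (\<forall>u\<in>{x, y, z}. 2 * n < d p u \<and> d p u \<le> R) \<and>
     \<not> joined (off p n) x y \<and> \<not> joined (off p n) x z \<and> \<not> joined (off p n) y z"

lemma tripod_translate:
  assumes "tripod n p R x y z" "g \<in> carrier G"
  shows "tripod n (g \<otimes> p) R (g \<otimes> x) (g \<otimes> y) (g \<otimes> z)"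
  using assms by (auto simp: tripod_def joined_off_translate)

text \<open>The pieces cut off by two disjoint balls are nested: what the ball about \<open>x\<close> separates from \<open>v\<close> lies,
  as seen from \<open>v\<close>, on the side of \<open>x\<close>. A geodesic from \<open>a\<close> to \<open>x\<close> that entered the ball about \<open>v\<close> would give a
  path from \<open>a\<close> to \<open>v\<close> that does not come near \<open>x\<close>.\<close>

lemma joined_around:
  assumes c: "v \<in> carrier G" "x \<in> carrier G" "a \<in> carrier G"
    and far: "2 * n < d v x" and un: "\<not> joined (off x n) v a"
  shows "joined (off v n) x a"
proof (rule ccontr)
  assume contra: "\<not> ?thesis"
  define L where "L = d a x"
  obtain \<gamma> where g: "geodesic \<gamma> L" "\<gamma> 0 = a" "\<gamma> L = x"
    unfolding L_def using obtain_geodesic[OF c(3,2)] .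
  have gc: "\<gamma> i \<in> carrier G" if "i \<le> L" for i using geodesicD(2)[OF g(1), of 0 i] that by simp
  have "\<not> (\<forall>i\<le>L. \<gamma> i \<in> off v n)"
  proof
    assume "\<forall>i\<le>L. \<gamma> i \<in> off v n"
    then have "joined (off v n) (\<gamma> 0) (\<gamma> L)" by (intro joined_geodesic[OF g(1)]) auto
    then show False using contra joined_sym[OF _ off_sub] by (simp add: g)
  qed
  then obtain i where i: "i \<le> L" "\<gamma> i \<notin> off v n" by blast
  then have vi: "d v (\<gamma> i) \<le> n" using gc[of i] by (simp add: in_ball)
  have 1: "joined (off x n) v (\<gamma> i)"
  proof (rule joined_between[OF c(1) gc[OF i(1)]])
    fix u assume u: "u \<in> carrier G" "d v u + d u (\<gamma> i) = d v (\<gamma> i)"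
    have "d v x \<le> d v u + d u x" using c u by (intro dist_triangle)
    then show "u \<in> off x n" using u vi far dist_sym[OF u(1) c(2)] by (simp add: in_ball)
  qed
  have "d v x \<le> d v (\<gamma> i) + d (\<gamma> i) (\<gamma> L)" using dist_triangle[OF c(1) gc[OF i(1)] c(2)] by (simp add: g)
  then have Li: "L - i > n" using vi far geodesicD(3)[OF g(1) i(1)] by simp
  have "joined (off x n) (\<gamma> 0) (\<gamma> i)"
  proof (rule joined_geodesic[OF g(1) _ i(1)])
    fix k assume k: "0 \<le> k" "k \<le> i"
    then have "d (\<gamma> L) (\<gamma> k) > n" using Li geodesicD(4)[OF g(1), of k L] i by simp
    then show "\<gamma> k \<in> off x n" using gc[of k] k i by (simp add: in_ball g)
  qed simp
  then have "joined (off x n) (\<gamma> i) a" using joined_sym[OF _ off_sub] by (simp add: g)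
  then show False using 1 un joined_trans by blast
qed

text \<open>Binary branching. Two of the three legs at \<open>v\<close> lead away from \<open>w\<close>. The end of each of them is the
  centre of a tripod again, with \<open>v\<close> in the role of \<open>w\<close>, and the points found there by induction are
  kept apart by the ball about \<open>v\<close>.\<close>

lemma tripod_packing:
  assumes tri: "\<And>v. v \<in> carrier G \<Longrightarrow> \<exists>x y z. tripod n v R x y z"
  shows "v \<in> carrier G \<Longrightarrow> w \<in> carrier G \<Longrightarrow> 2 * n < d v w \<Longrightarrow>
    \<exists>A \<subseteq> ball v (k * R). finite A \<and> card A = 2 ^ k \<and> (\<forall>a\<in>A. \<not> joined (off v n) w a)"
proof (induction k arbitrary: v w)
  case 0
  have "\<not> joined (off v n) w v" using joined_mem(2)[of "off v n" w v] 0 by (auto simp: in_ball)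
  then show ?case using 0 by (intro exI[of _ "{v}"]) (auto simp: in_ball)
next
  case (Suc k)
  obtain x y z where t: "tripod n v R x y z" using tri[OF Suc.prems(1)] by blast
  \<comment> \<open>At most one of the three legs of the tripod is on the side of \<open>w\<close>.\<close>
  have "\<exists>x y. x \<in> carrier G \<and> y \<in> carrier G \<and> 2 * n < d v x \<and> d v x \<le> R \<and> 2 * n < d v y \<and> d v y \<le> R
    \<and> \<not> joined (off v n) x y \<and> \<not> joined (off v n) w x \<and> \<not> joined (off v n) w y"
    using t joined_trans joined_sym[OF _ off_sub] unfolding tripod_def by (smt (verit) insert_iff insert_subset)
  then obtain x y where xy: "x \<in> carrier G" "y \<in> carrier G" "2 * n < d v x" "d v x \<le> R"
    "2 * n < d v y" "d v y \<le> R" "\<not> joined (off v n) x y"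
    "\<not> joined (off v n) w x" "\<not> joined (off v n) w y" by blast
  have leg: "\<exists>A \<subseteq> ball v (Suc k * R). finite A \<and> card A = 2 ^ k \<and> (\<forall>a\<in>A. joined (off v n) x a)"
    if x: "x \<in> carrier G" "2 * n < d v x" "d v x \<le> R" for x
  proof -
    have "2 * n < d x v" using x dist_sym[OF x(1) Suc.prems(1)] by simp
    then obtain A where A: "A \<subseteq> ball x (k * R)" "finite A" "card A = 2 ^ k"
      "\<And>a. a \<in> A \<Longrightarrow> \<not> joined (off x n) v a"
      using Suc.IH[OF x(1) Suc.prems(1)] by blast
    have "a \<in> ball v (Suc k * R) \<and> joined (off v n) x a" if a: "a \<in> A" for a
    proof -
      have ac: "a \<in> carrier G" "d x a \<le> k * R" using A(1) a by (auto simp: in_ball)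
      have "d v a \<le> d v x + d x a" using x ac Suc.prems by (intro dist_triangle)
      then show ?thesis using ac x joined_around[OF Suc.prems(1) x(1) ac(1) x(2) A(4)[OF a]]
        by (simp add: in_ball)
    qed
    then show ?thesis using A by blast
  qed
  obtain A where A: "A \<subseteq> ball v (Suc k * R)" "finite A" "card A = 2 ^ k"
    "\<And>a. a \<in> A \<Longrightarrow> joined (off v n) x a" using leg[of x] xy by blast
  obtain B where B: "B \<subseteq> ball v (Suc k * R)" "finite B" "card B = 2 ^ k"
    "\<And>a. a \<in> B \<Longrightarrow> joined (off v n) y a" using leg[of y] xy by blast
  \<comment> \<open>A common point would join the two legs, and a point joined to \<open>w\<close> would join a leg to \<open>w\<close>.\<close>
  have disj: "A \<inter> B = {}"
    using A(4) B(4) xy(7) joined_trans joined_sym[OF _ off_sub] by blast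
  have "\<not> joined (off v n) w a" if "a \<in> A \<union> B" for a
    using that A(4) B(4) xy(8,9) joined_trans joined_sym[OF _ off_sub] by blast
  then show ?case using A B disj
    by (intro exI[of _ "A \<union> B"]) (auto simp: card_Un_disjoint)
qed

lemma exponential_growth_of_doubling:
  assumes "R > 0" and pk: "\<And>k. 2 ^ k \<le> growth (k * R)"
  shows "exponential_growth G S"
  unfolding exponential_growth_def
proof (intro exI conjI allI)
  show "root R 2 > 1" using assms by simp
  show "(0::real) < 1 / 2" by simp
  fix n
  have "n \<le> R * (n div R) + R"
    using mod_less_divisor[OF assms(1), of n] mult_div_mod_eq[of R n] by linarith
  then have "root R 2 ^ n \<le> root R 2 ^ (R * (n div R) + R)"
    by (rule power_increasing) (use assms in simp)
  also have "\<dots> = 2 ^ (n div R + 1)"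
    using assms by (simp add: power_add power_mult)
  finally have "1 / 2 * root R 2 ^ n \<le> 2 ^ (n div R)" by simp
  also have "\<dots> \<le> real (growth (n div R * R))" using pk[of "n div R"] by (metis of_nat_le_iff of_nat_numeral of_nat_power)
  also have "\<dots> \<le> real (card (word_ball G S n))"
    using growth_mono[of "n div R * R" n] by (simp add: word_ball_eq growth_def)
  finally show "1 / 2 * root R 2 ^ n \<le> real (card (word_ball G S n))" .
qed

lemma tripod_exponential_growth:
  assumes "infinite (carrier G)" and t: "tripod n p R x y z"
  shows "exponential_growth G S"
proof (rule exponential_growth_of_doubling)
  show "R > 0" using t by (auto simp: tripod_def)
  have p: "p \<in> carrier G" using t by (simp add: tripod_def)
  have tri: "\<exists>x y z. tripod n v R x y z" if "v \<in> carrier G" for v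
    using tripod_translate[OF t, of "v \<otimes> inv p"] that p by (auto simp: m_assoc)
  obtain w where "w \<in> carrier G" "d \<one> w = 2 * n + 1"
    using dist_unbounded[OF assms(1) one_closed] .
  then have "\<exists>A \<subseteq> ball \<one> (k * R). finite A \<and> card A = 2 ^ k \<and> (\<forall>a\<in>A. \<not> joined (off \<one> n) w a)" for k
    using tripod_packing[OF tri, of \<one> w k] by simp
  then show "2 ^ k \<le> growth (k * R)" for k
    unfolding growth_def by (metis card_mono finite_ball_one)
qed

section \<open>Linear growth and infinite cyclic subgroups of finite index\<close>

text \<open>A point that is far from its nearest point on a long geodesic forms a tripod with the ends of the
  geodesic. Without tripods, a ball about the midpoint of a geodesic is therefore covered by balls of
  a fixed radius \<open>M\<close> about the vertices of the geodesic within twice its radius.\<close>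

lemma linear_growth:
  assumes inf: "infinite (carrier G)" and bn: "bottleneck n"
    and nt: "\<And>p R x y z. \<not> tripod (4 * n + 1) p R x y z"
  shows "\<exists>M. \<forall>r. growth r \<le> (4 * r + 1) * M"
proof (intro exI allI)
  fix r
  define m where "m = 4 * n + 1"
  define M where "M = 2 * m + 1"
  \<comment> \<open>A point nearest to a point of the ball of radius \<open>r\<close> about the midpoint is within \<open>2r\<close> of the midpoint,
    and so at distance at least \<open>M > 2m\<close> from both ends.\<close>
  define L where "L = 2 * r + M"
  obtain y where y: "y \<in> carrier G" "d \<one> y = 2 * L" using dist_unbounded[OF inf one_closed] .
  obtain \<gamma> where g: "geodesic \<gamma> (2 * L)"
    using obtain_geodesic[OF one_closed y(1)] unfolding y(2) by blast
  have gc: "\<gamma> i \<in> carrier G" if "i \<le> 2 * L" for i using geodesicD(2)[OF g(1), of 0 i] that by simp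
  have "ball (\<gamma> L) r \<subseteq> (\<Union>i\<in>{L - 2 * r..L + 2 * r}. ball (\<gamma> i) M)"
  proof
    fix x assume "x \<in> ball (\<gamma> L) r"
    then have x: "x \<in> carrier G" "d (\<gamma> L) x \<le> r" by (auto simp: in_ball)
    obtain i where i: "i \<le> 2 * L" and min: "\<And>j. j \<le> 2 * L \<Longrightarrow> d x (\<gamma> i) \<le> d x (\<gamma> j)"
      using ex_has_least_nat[of "\<lambda>i. i \<le> 2 * L" 0 "\<lambda>i. d x (\<gamma> i)"] by auto
    have "d x (\<gamma> L) \<le> r" using x dist_sym[OF x(1) gc[of L]] by simp
    then have "d x (\<gamma> i) \<le> r" using min[of L] by simp
    then have Li: "d (\<gamma> L) (\<gamma> i) \<le> 2 * r"
      using dist_triangle[OF gc[of L] x(1) gc[OF i]] x by simp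
    have i2: "L - 2 * r \<le> i" "i \<le> L + 2 * r"
      using Li geodesicD(3)[OF g, of L i] geodesicD(4)[OF g, of i L] i by (cases "i \<le> L"; simp)+
    have "d (\<gamma> i) x \<le> M"
    proof (rule ccontr)
      assume "\<not> ?thesis"
      then have xi: "2 * m < d (\<gamma> i) x" by (simp add: M_def)
      have ends: "2 * m < d (\<gamma> i) (\<gamma> 0)" "2 * m < d (\<gamma> i) (\<gamma> (2 * L))"
        using i2 i geodesicD(4)[OF g, of 0 i] geodesicD(3)[OF g, of i "2 * L"]
        by (simp_all add: L_def M_def)
      have 1: "\<not> joined (off (\<gamma> i) m) x (\<gamma> (2 * L))"
        unfolding m_def
      proof (rule nearest_point_unjoined[OF bn x(1), of "\<gamma> ` {i..2 * L}"])
        show "joined (\<gamma> ` {i..2 * L}) (\<gamma> i) (\<gamma> (2 * L))" by (rule joined_geodesic[OF g i]) auto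
      qed (use gc min in auto)
      have sub: "\<gamma> ` {0..i} \<subseteq> carrier G" using gc i by auto
      have "joined (\<gamma> ` {0..i}) (\<gamma> 0) (\<gamma> i)" by (rule joined_geodesic[OF g _ i]) auto
      then have "joined (\<gamma> ` {0..i}) (\<gamma> i) (\<gamma> 0)" by (rule joined_sym[OF _ sub])
      then have 2: "\<not> joined (off (\<gamma> i) m) x (\<gamma> 0)"
        unfolding m_def by (rule nearest_point_unjoined[OF bn x(1) sub]) (use min i in auto)
      have "\<not> joined (off (\<gamma> i) n) (\<gamma> 0) (\<gamma> (2 * L))"
        using bottleneck_geodesic[OF bn g, of 0 i "2 * L"] i by simp
      then have 3: "\<not> joined (off (\<gamma> i) m) (\<gamma> 0) (\<gamma> (2 * L))"
        using joined_mono[of "off (\<gamma> i) m" _ _ "off (\<gamma> i) n"] ball_mono[of n m "\<gamma> i"] by (auto simp: m_def)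
      have "tripod m (\<gamma> i) (max (d (\<gamma> i) x) (max (d (\<gamma> i) (\<gamma> 0)) (d (\<gamma> i) (\<gamma> (2 * L))))) x (\<gamma> 0) (\<gamma> (2 * L))"
        unfolding tripod_def using 1 2 3 xi ends x gc[OF i] gc[of 0] gc[of "2 * L"] by auto
      then show False using nt by (simp add: m_def)
    qed
    then show "x \<in> (\<Union>i\<in>{L - 2 * r..L + 2 * r}. ball (\<gamma> i) M)" using i2 x(1) by (auto simp: in_ball)
  qed
  then have "card (ball (\<gamma> L) r) \<le> card (\<Union>i\<in>{L - 2 * r..L + 2 * r}. ball (\<gamma> i) M)"
    by (rule card_mono[rotated]) (use gc in \<open>auto simp: L_def\<close>)
  also have "\<dots> \<le> (\<Sum>i\<in>{L - 2 * r..L + 2 * r}. card (ball (\<gamma> i) M))" by (rule card_UN_le) simp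
  also have "\<dots> = (\<Sum>i\<in>{L - 2 * r..L + 2 * r}. growth M)"
    by (rule sum.cong[OF refl]) (use gc in \<open>auto intro!: card_ball simp: L_def\<close>)
  also have "\<dots> = (4 * r + 1) * growth M" by (simp add: L_def)
  finally show "growth r \<le> (4 * r + 1) * growth (2 * (4 * n + 1) + 1)"
    using card_ball[OF gc[of L], of r] by (simp add: M_def m_def)
qed

lemma dist_one_quotient:
  "x \<in> carrier G \<Longrightarrow> y \<in> carrier G \<Longrightarrow> d \<one> (inv x \<otimes> y) = d x y"
  using dist_translate[of "inv x" x y] by simp

text \<open>The balls about \<open>\<gamma> i\<close> and \<open>\<gamma> j\<close> cut off half-spaces \<open>A\<close> and \<open>B \<subset> A\<close> that contain the later part of
  the geodesic. The element \<open>t = \<gamma> j (\<gamma> i)\<^sup>-\<^sup>1\<close> moves the first ball to the second, and by the equation it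
  also respects the sides of the balls, so that \<open>t A \<subseteq> B\<close>. All the positive powers of \<open>t\<close> then map \<open>A\<close> into
  \<open>B\<close>, whereas \<open>\<gamma> j\<close> belongs to \<open>A\<close> but not to \<open>B\<close>.\<close>

lemma halfspace_translation:
  assumes bn: "bottleneck n" and g: "geodesic \<gamma> L"
    and ij: "i + 2 * (n + 1) \<le> j" "j + (n + 1) \<le> L"
    and eq: "inv (\<gamma> i) \<otimes> \<gamma> (i + (n + 1)) = inv (\<gamma> j) \<otimes> \<gamma> (j + (n + 1))"
    and k: "k > 0"
  shows "(\<gamma> j \<otimes> inv (\<gamma> i)) [^] (k::nat) \<noteq> \<one>"
proof
  define x x' y y' t where "x = \<gamma> i" and "x' = \<gamma> (i + (n + 1))" and "y = \<gamma> j"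
    and "y' = \<gamma> (j + (n + 1))" and "t = y \<otimes> inv x"
  define A B where "A = {z. joined (off x n) x' z}" and "B = {z. joined (off y n) y' z}"
  have gc: "\<gamma> i \<in> carrier G" if "i \<le> L" for i using geodesicD(2)[OF g, of 0 i] that by simp
  have c: "x \<in> carrier G" "x' \<in> carrier G" "y \<in> carrier G" "y' \<in> carrier G" "t \<in> carrier G"
    using gc ij by (auto simp: x_def x'_def y_def y'_def t_def)
  have AB: "A \<subseteq> carrier G" using joined_mem by (fastforce simp: A_def)
  have tx: "t \<otimes> x = y" using c by (simp add: t_def m_assoc)
  have "t \<otimes> x' = y \<otimes> (inv x \<otimes> x')" using c by (simp add: t_def m_assoc)
  also have "inv x \<otimes> x' = inv y \<otimes> y'" using eq unfolding x_def x'_def y_def y'_def .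
  also have "y \<otimes> (inv y \<otimes> y') = y'" using c by (simp add: mult_inv_cancel)
  finally have tx': "t \<otimes> x' = y'" .
  have tA: "t \<otimes> z \<in> B" if "z \<in> A" for z
    using that joined_off_translate_imp[of x n x' z t] c by (simp add: A_def B_def tx tx')
  have ray: "joined (off x n) x' (\<gamma> m)" if "i + (n + 1) \<le> m" "m \<le> L" for m
    unfolding x'_def
  proof (rule joined_geodesic[OF g that])
    fix k assume "i + (n + 1) \<le> k" "k \<le> m"
    then show "\<gamma> k \<in> off x n" using geodesicD(3)[OF g, of i k] gc[of k] that by (simp add: in_ball x_def)
  qed
  have BA: "B \<subseteq> A"
  proof
    fix z assume "z \<in> B"
    then have z: "joined (off y n) y' z" by (simp add: B_def)
    have "joined (off x n) y' z"
    proof (rule joined_restrict[OF z])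
      fix w assume w: "joined (off y n) y' w"
      then have wc: "w \<in> carrier G" using joined_mem by blast
      show "w \<in> off x n"
      proof (rule ccontr)
        assume "w \<notin> off x n"
        then have xw: "d x w \<le> n" using wc by (simp add: in_ball)
        have "joined (off y n) w x"
        proof (rule joined_between[OF wc c(1)])
          fix u assume u: "u \<in> carrier G" "d w u + d u x = d w x"
          have "d x y \<le> d x u + d u y" using c u by (intro dist_triangle)
          moreover have "d x y = j - i" using geodesicD(3)[OF g, of i j] ij by (simp add: x_def y_def)
          ultimately show "u \<in> off y n"
            using u xw ij dist_sym[OF u(1) c(1)] dist_sym[OF u(1) c(3)] dist_sym[OF wc c(1)]
            by (simp add: in_ball)
        qed
        then have "joined (off y n) x y'" using w joined_trans joined_sym[OF _ off_sub] by blast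
        then show False using bottleneck_geodesic[OF bn g, of i j "j + (n + 1)"] ij
          by (simp add: x_def y_def y'_def)
      qed
    qed
    moreover have "joined (off x n) x' y'" using ray[of "j + (n + 1)"] ij by (simp add: y'_def)
    ultimately show "z \<in> A" using joined_trans by (simp add: A_def)
  qed
  have pow: "z \<in> A \<Longrightarrow> t [^] Suc m \<otimes> z \<in> B" for m z
  proof (induction m arbitrary: z)
    case 0
    then show ?case using tA c by simp
  next
    case (Suc m)
    have "t [^] Suc (Suc m) \<otimes> z = t [^] Suc m \<otimes> (t \<otimes> z)"
      using c Suc.prems AB by (simp add: m_assoc subset_iff)
    then show ?case using Suc.IH[of "t \<otimes> z"] tA[OF Suc.prems] Suc.prems(1) BA by auto
  qed
  assume "(\<gamma> j \<otimes> inv (\<gamma> i)) [^] k = \<one>"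
  then have "t [^] Suc (k - 1) = \<one>" using k by (simp add: t_def x_def y_def)
  moreover have "y \<in> A" using ray[of j] ij by (simp add: A_def y_def)
  ultimately have "y \<in> B" using pow[of y "k - 1"] c by simp
  then show False using joined_mem(2)[of "off y n" y' y] c by (simp add: B_def in_ball)
qed

text \<open>The half-space at a vertex of a geodesic is determined, up to translation, by an element of the
  finite ball of radius \<open>n + 1\<close>. Among sufficiently many vertices two have the same element.\<close>

lemma infinite_order_element:
  assumes inf: "infinite (carrier G)" and bn: "bottleneck n"
  obtains t where "t \<in> carrier G" "\<And>k::nat. k > 0 \<Longrightarrow> t [^] k \<noteq> \<one>"
proof -
  define N where "N = growth (n + 1)"
  \<comment> \<open>Cuts at this spacing are disjoint, and each lies beyond the vertex that marks the side of the
    preceding one.\<close>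
  define a where "a k = k * (2 * (n + 1))" for k
  define L where "L = (N + 1) * (2 * (n + 1))"
  obtain q where q: "q \<in> carrier G" "d \<one> q = L" using dist_unbounded[OF inf one_closed] .
  obtain \<gamma> where g: "geodesic \<gamma> L"
    using obtain_geodesic[OF one_closed q(1)] unfolding q(2) by blast
  have gc: "\<gamma> i \<in> carrier G" if "i \<le> L" for i using geodesicD(2)[OF g, of 0 i] that by simp
  have aL: "a k + (n + 1) \<le> L" if "k \<le> N" for k
  proof -
    have "a k \<le> N * (2 * (n + 1))" unfolding a_def using that by (rule mult_le_mono1)
    then show ?thesis by (simp add: L_def)
  qed
  define f where "f k = inv (\<gamma> (a k)) \<otimes> \<gamma> (a k + (n + 1))" for k
  have "f ` {..N} \<subseteq> ball \<one> (n + 1)"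
  proof
    fix z assume "z \<in> f ` {..N}"
    then obtain k where k: "k \<le> N" "z = f k" by auto
    have c: "\<gamma> (a k) \<in> carrier G" "\<gamma> (a k + (n + 1)) \<in> carrier G" using gc aL[OF k(1)] by auto
    then show "z \<in> ball \<one> (n + 1)"
      using dist_one_quotient[OF c] geodesicD(3)[OF g, of "a k" "a k + (n + 1)"] aL[OF k(1)]
      by (simp add: k f_def in_ball)
  qed
  then have "card (f ` {..N}) \<le> N" unfolding N_def growth_def by (rule card_mono[OF finite_ball_one])
  then have "\<not> inj_on f {..N}" using pigeonhole[of f "{..N}"] by simp
  then obtain k l where kl: "k < l" "l \<le> N" "f k = f l"
    unfolding inj_on_def by (metis atMost_iff linorder_neqE_nat)
  have "a k + 2 * (n + 1) = a (Suc k)" by (simp add: a_def)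
  also have "\<dots> \<le> a l" unfolding a_def using kl(1) by (intro mult_le_mono1) simp
  finally have kl': "a k + 2 * (n + 1) \<le> a l" .
  show ?thesis
  proof (rule that)
    show "\<gamma> (a l) \<otimes> inv (\<gamma> (a k)) \<in> carrier G" using gc aL[of k] aL[of l] kl by auto
    show "(\<gamma> (a l) \<otimes> inv (\<gamma> (a k))) [^] m \<noteq> \<one>" if "m > 0" for m :: nat
      using halfspace_translation[OF bn g kl' aL[OF kl(2)] _ that] kl(3) by (simp add: f_def)
  qed
qed

text \<open>As long as there are further cosets, every increase of the radius finds a new one: if the balls of
  radius \<open>n\<close> and \<open>n + 1\<close> meet the same cosets, then so does every larger ball.\<close>

lemma coset_count:
  assumes H: "subgroup H G" and inf: "infinite (rcosets H)"
  shows "n < card ((\<lambda>h. H #> h) ` ball \<one> n)"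
proof (induction n)
  case 0
  have "\<one> \<in> ball \<one> 0" by (simp add: in_ball)
  then have "(\<lambda>h. H #> h) ` ball \<one> 0 \<noteq> {}" by blast
  then show ?case using finite_ball_one[of 0] by (simp add: card_gt_0_iff)
next
  case (Suc n)
  define Z where "Z n = (\<lambda>h. H #> h) ` ball \<one> n" for n
  have Hc: "H \<subseteq> carrier G" using H by (rule subgroup.subset)
  have "Z n \<noteq> Z (Suc n)"
  proof
    assume stable: "Z n = Z (Suc n)"
    have "Z (n + m) \<subseteq> Z n" for m
    proof (induction m)
      case (Suc m)
      show ?case
      proof
        fix C assume "C \<in> Z (n + Suc m)"
        then obtain h where h: "h \<in> ball \<one> (n + m + 1)" "C = H #> h" by (auto simp: Z_def)
        obtain y where y: "y \<in> ball \<one> (n + m)" "h \<in> ball y 1" using ball_add[OF h(1)] by auto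
        then have "H #> y \<in> Z n" using Suc by (auto simp: Z_def)
        then obtain y' where y': "y' \<in> ball \<one> n" "H #> y = H #> y'" by (auto simp: Z_def)
        have c: "y \<in> carrier G" "y' \<in> carrier G" "h \<in> carrier G" using y y' by (auto simp: in_ball)
        define u where "u = inv y \<otimes> h"
        have u: "u \<in> carrier G" "h = y \<otimes> u" "d \<one> u \<le> 1"
          using c y(2) dist_one_quotient[OF c(1,3)] by (auto simp: u_def mult_inv_cancel in_ball)
        have "C = H #> (y' \<otimes> u)"
          using h(2) u c y'(2) Hc by (metis coset_mult_assoc)
        moreover have "d \<one> (y' \<otimes> u) \<le> d \<one> y' + d y' (y' \<otimes> u)" using c u by (intro dist_triangle) auto
        then have "y' \<otimes> u \<in> ball \<one> (Suc n)"
          using u c y'(1) dist_translate[of y' \<one> u] by (simp add: in_ball)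
        ultimately have "C \<in> Z (Suc n)" unfolding Z_def by (metis imageI)
        then show "C \<in> Z n" unfolding stable .
      qed
    qed simp
    moreover have "C \<in> Z (n + m)" if "h \<in> carrier G" "C = H #> h" "m = d \<one> h" for C h m
      using that by (auto simp: Z_def in_ball)
    ultimately have "rcosets H \<subseteq> Z n" unfolding RCOSETS_def by blast
    then show False using inf finite_ball_one[of n] by (auto simp: Z_def dest: finite_subset)
  qed
  moreover have "Z n \<subseteq> Z (Suc n)" unfolding Z_def by (intro image_mono ball_mono) simp
  ultimately have "card (Z n) < card (Z (Suc n))"
    using finite_ball_one[of "Suc n"] by (intro psubset_card_mono) (auto simp: Z_def)
  then show ?case using Suc by (simp add: Z_def)
qed

lemma dist_one_pow: "t \<in> carrier G \<Longrightarrow> d \<one> (t [^] (k::nat)) \<le> k * d \<one> t"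
proof (induction k)
  case (Suc k)
  have "d \<one> (t [^] Suc k) \<le> d \<one> (t [^] k) + d (t [^] k) (t [^] Suc k)"
    using Suc by (intro dist_triangle) auto
  also have "d (t [^] k) (t [^] Suc k) = d \<one> t"
    using dist_translate[of "t [^] k" \<one> t] Suc by simp
  finally show ?case using Suc by simp
qed simp

text \<open>If the powers of \<open>t\<close> had infinite index, the products of \<open>t\<^sup>k\<close>, \<open>k \<le> n\<close>, with representatives from
  \<open>n + 1\<close> cosets would be quadratically many elements of a ball whose radius is linear in \<open>n\<close>.\<close>

lemma linear_growth_virtually_cyclic:
  assumes t: "t \<in> carrier G" "\<And>k::nat. k > 0 \<Longrightarrow> t [^] k \<noteq> \<one>"
    and lin: "\<And>r. growth r \<le> (4 * r + 1) * M"
  shows "virtually_infinite_cyclic G"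
proof -
  define H where "H = range (\<lambda>k::int. t [^] k)"
  have H: "subgroup H G"
  proof (rule subgroupI)
    show "H \<subseteq> carrier G" "H \<noteq> {}" using t by (auto simp: H_def)
    show "inv a \<in> H" if "a \<in> H" for a
      using that t by (auto simp: H_def int_pow_neg[symmetric])
    show "a \<otimes> b \<in> H" if "a \<in> H" "b \<in> H" for a b
      using that t by (auto simp: H_def int_pow_mult[symmetric])
  qed
  have ord: "ord t = 0" using t ord_eq_0[of t] by auto
  have inj: "t [^] k = t [^] l \<longleftrightarrow> k = l" for k l :: int
    using int_pow_eq[OF t(1), of k l] ord by auto
  have "(\<lambda>k::int. t [^] k) \<in> iso integer_group (G\<lparr>carrier := H\<rparr>)"
    unfolding iso_def hom_def bij_betw_def inj_on_def
    using t by (auto simp: H_def inj int_pow_mult)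
  then have "integer_group \<cong> G\<lparr>carrier := H\<rparr>" by (auto simp: is_iso_def)
  then have iso: "G\<lparr>carrier := H\<rparr> \<cong> integer_group" by (rule group.iso_sym[OF group_integer_group])
  have "finite (rcosets H)"
  proof (rule ccontr)
    assume inf: "infinite (rcosets H)"
    define \<tau> where "\<tau> = d \<one> t"
    \<comment> \<open>Large enough for \<open>(n + 1)\<^sup>2\<close> to exceed the bound on the growth at radius \<open>n \<tau> + n\<close>.\<close>
    define n where "n = 4 * (1 + \<tau>) * M + M"
    define Z where "Z = (\<lambda>h. H #> h) ` ball \<one> n"
    have "\<forall>C\<in>Z. \<exists>h. h \<in> ball \<one> n \<and> H #> h = C" by (auto simp: Z_def)
    then obtain rep where rep: "\<And>C. C \<in> Z \<Longrightarrow> rep C \<in> ball \<one> n \<and> H #> rep C = C" by metis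
    define f where "f = (\<lambda>(k::nat, C). t [^] k \<otimes> rep C)"
    have coset: "H #> f (k, C) = C" if "C \<in> Z" for k C
    proof -
      have r: "rep C \<in> carrier G" using rep[OF that] by (simp add: in_ball)
      have "t [^] k = t [^] int k" by (simp add: int_pow_int)
      then have tk: "t [^] k \<in> H" by (auto simp: H_def)
      have "H #> f (k, C) = (H #> t [^] k) #> rep C"
        using t r subgroup.subset[OF H] by (simp add: f_def coset_mult_assoc)
      also have "H #> t [^] k = H" using t H tk by (intro coset_join2) auto
      finally show ?thesis using rep[OF that] by simp
    qed
    have "inj_on f ({..n} \<times> Z)"
    proof (rule inj_onI)
      fix p q assume pq: "p \<in> {..n} \<times> Z" "q \<in> {..n} \<times> Z" "f p = f q"
      obtain k C l C' where e: "p = (k, C)" "q = (l, C')" by fastforce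
      have "C = C'" using coset[of C k] coset[of C' l] pq e by simp
      moreover have "rep C \<in> carrier G" using rep pq e by (simp add: in_ball)
      ultimately have "t [^] k = t [^] l" using pq(3) t by (simp add: e f_def)
      then have "t [^] int k = t [^] int l" by (simp add: int_pow_int)
      then show "p = q" using inj \<open>C = C'\<close> e by simp
    qed
    then have "card ({..n} \<times> Z) \<le> card (ball \<one> (n * \<tau> + n))"
    proof (rule card_inj_on_le[OF _ _ finite_ball_one])
      show "f ` ({..n} \<times> Z) \<subseteq> ball \<one> (n * \<tau> + n)"
      proof (clarify)
        fix k C assume k: "k \<le> n" and C: "C \<in> Z"
        have r: "rep C \<in> carrier G" "d \<one> (rep C) \<le> n" using rep[OF C] by (auto simp: in_ball)
        have "d \<one> (t [^] k \<otimes> rep C) \<le> d \<one> (t [^] k) + d (t [^] k) (t [^] k \<otimes> rep C)"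
          using t r by (intro dist_triangle) auto
        also have "d (t [^] k) (t [^] k \<otimes> rep C) = d \<one> (rep C)"
          using dist_translate[of "t [^] k" \<one> "rep C"] t r by simp
        also have "d \<one> (t [^] k) \<le> n * \<tau>"
          using dist_one_pow[OF t(1), of k] k unfolding \<tau>_def by (meson le_trans mult_le_mono1)
        finally show "f (k, C) \<in> ball \<one> (n * \<tau> + n)" using r t by (simp add: f_def in_ball)
      qed
    qed
    also have "\<dots> \<le> (4 * (n * \<tau> + n) + 1) * M" using lin[of "n * \<tau> + n"] unfolding growth_def .
    also have "\<dots> \<le> (n + 1) * n" by (simp add: n_def algebra_simps)
    finally have "(n + 1) * card Z \<le> (n + 1) * n" by (simp add: card_cartesian_product)
    then have "card Z \<le> n" by (metis mult_le_cancel1 add_gr_0 zero_less_one)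
    then show False using coset_count[OF H inf, of n] by (simp add: Z_def)
  qed
  then show ?thesis using H iso unfolding virtually_infinite_cyclic_def by blast
qed

theorem bottleneck_dichotomy:
  assumes inf: "infinite (carrier G)" and bn: "bottleneck n"
  shows "exponential_growth G S \<or> virtually_infinite_cyclic G"
proof (cases "\<exists>p R x y z. tripod (4 * n + 1) p R x y z")
  case True
  then show ?thesis using tripod_exponential_growth[OF inf] by blast
next
  case False
  then obtain M where "\<And>r. growth r \<le> (4 * r + 1) * M" using linear_growth[OF inf bn] by blast
  moreover obtain t where "t \<in> carrier G" "\<And>k::nat. k > 0 \<Longrightarrow> t [^] k \<noteq> \<one>"
    by (rule infinite_order_element[OF inf bn]) blast
  ultimately show ?thesis using linear_growth_virtually_cyclic by blast
qed

section \<open>Summability of exponential weights\<close>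

text \<open>Growth is submultiplicative. A single radius \<open>n\<close> at which it is below \<open>a\<^sup>n\<close> bounds it at all the radii
  up to a constant factor.\<close>

lemma growth_bound_of_subexponential:
  assumes sub: "\<not> exponential_growth G S" and a: "(a::real) > 1"
  obtains C where "\<And>n. real (growth n) \<le> C * a ^ n"
proof -
  have "\<exists>n. \<not> 1 * a ^ n \<le> real (card (word_ball G S n))"
    using sub a unfolding exponential_growth_def by (meson zero_less_one)
  then obtain n0 where n0: "real (growth n0) < a ^ n0"
    by (auto simp: word_ball_eq growth_def not_le)
  have pos: "n0 > 0" using n0 growth_pos[of 0] by (cases n0) auto
  have mult: "real (growth (k * n0)) \<le> a ^ (k * n0)" for k
  proof (induction k)
    case 0
    have "ball \<one> 0 = {\<one>}" by (auto simp: in_ball dist_eq_0)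
    then show ?case by (simp add: growth_def)
  next
    case (Suc k)
    have "real (growth (Suc k * n0)) \<le> real (growth n0) * real (growth (k * n0))"
      using growth_submult[of n0 "k * n0"] by (simp flip: of_nat_mult)
    also have "\<dots> \<le> a ^ n0 * a ^ (k * n0)" using Suc n0 a by (intro mult_mono) auto
    finally show ?case by (simp add: power_add)
  qed
  have "real (growth n) \<le> real (growth n0) * a ^ n" for n
  proof -
    have "growth n \<le> growth (n mod n0) * growth (n div n0 * n0)"
      using growth_submult[of "n mod n0" "n div n0 * n0"] by simp
    also have "\<dots> \<le> growth n0 * growth (n div n0 * n0)"
      using pos by (intro mult_le_mono1 growth_mono) (simp add: less_imp_le)
    finally have "real (growth n) \<le> real (growth n0) * real (growth (n div n0 * n0))"
      by (simp flip: of_nat_mult)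
    also have "\<dots> \<le> real (growth n0) * a ^ (n div n0 * n0)" by (intro mult_left_mono mult) simp
    also have "\<dots> \<le> real (growth n0) * a ^ n"
      using a by (intro mult_left_mono power_increasing) auto
    finally show ?thesis .
  qed
  then show ?thesis using that by blast
qed

text \<open>With the growth rate \<open>1 / \<surd>r\<close> the spheres contribute at most a geometric series in \<open>\<surd>r\<close>.\<close>

lemma exponential_weight_sum_bounded:
  assumes sub: "\<not> exponential_growth G S" and r: "0 < r" "(r::real) < 1"
  obtains K where "K \<ge> 0"
    "\<And>p A. p \<in> carrier G \<Longrightarrow> finite A \<Longrightarrow> A \<subseteq> carrier G \<Longrightarrow> (\<Sum>v\<in>A. r ^ d p v) \<le> K"
proof -
  have sr: "0 < sqrt r" "sqrt r < 1" using r by auto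
  then have "1 / sqrt r > 1" by simp
  then obtain C where C: "\<And>n. real (growth n) \<le> C * (1 / sqrt r) ^ n"
    using growth_bound_of_subexponential[OF sub] by blast
  have C0: "C \<ge> 0" using C[of 0] growth_pos[of 0] by simp
  have level: "real (growth n) * r ^ n \<le> C * sqrt r ^ n" for n
  proof -
    have "real (growth n) * r ^ n \<le> C * (1 / sqrt r) ^ n * r ^ n"
      using C r by (intro mult_right_mono) auto
    also have "\<dots> = C * (1 / sqrt r * r) ^ n" by (simp add: power_mult_distrib power_divide)
    also have "1 / sqrt r * r = sqrt r" using r by (simp add: real_div_sqrt)
    finally show ?thesis .
  qed
  show ?thesis
  proof (rule that)
    show "0 \<le> C / (1 - sqrt r)" using C0 sr by simp
    fix p A assume p: "p \<in> carrier G" and A: "finite A" "A \<subseteq> carrier G"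
    define N where "N = Suc (Max (insert 0 (d p ` A)))"
    have "(\<Sum>v\<in>A. r ^ d p v) = (\<Sum>n\<in>d p ` A. \<Sum>v | v \<in> A \<and> d p v = n. r ^ d p v)"
      by (rule sum.image_gen[OF A(1)])
    also have "\<dots> \<le> (\<Sum>n\<in>d p ` A. C * sqrt r ^ n)"
    proof (rule sum_mono)
      fix n
      have "card {v \<in> A. d p v = n} \<le> card (ball p n)"
        using A by (intro card_mono finite_ball p) (auto simp: in_ball)
      then have "real (card {v \<in> A. d p v = n}) * r ^ n \<le> real (growth n) * r ^ n"
        using r card_ball[OF p] by (intro mult_right_mono) auto
      then show "(\<Sum>v | v \<in> A \<and> d p v = n. r ^ d p v) \<le> C * sqrt r ^ n"
        using level[of n] by simp
    qed
    also have "\<dots> \<le> (\<Sum>n<N. C * sqrt r ^ n)"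
      using A C0 sr by (intro sum_mono2) (auto simp: N_def less_Suc_eq_le)
    also have "\<dots> \<le> C / (1 - sqrt r)"
    proof -
      have "(\<Sum>n<N. sqrt r ^ n) = (1 - sqrt r ^ N) / (1 - sqrt r)"
        using sr by (simp add: sum_gp_strict)
      also have "\<dots> \<le> 1 / (1 - sqrt r)" using sr by (intro divide_right_mono) auto
      finally have "C * (\<Sum>n<N. sqrt r ^ n) \<le> C * (1 / (1 - sqrt r))" using C0 by (intro mult_left_mono)
      then show ?thesis by (simp add: sum_distrib_left)
    qed
    finally show "(\<Sum>v\<in>A. r ^ d p v) \<le> C / (1 - sqrt r)" .
  qed
qed

end

section \<open>Finitely supported functions\<close>

text \<open>The inner product of a finitely supported function with an arbitrary one.\<close>

definition pairing :: "('i \<Rightarrow> real) \<Rightarrow> ('i \<Rightarrow> real) \<Rightarrow> real" where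
  "pairing f \<phi> = (\<Sum>i | f i \<noteq> 0. f i * \<phi> i)"

abbreviation supp :: "('i \<Rightarrow> real) \<Rightarrow> 'i set" where "supp f \<equiv> {i. f i \<noteq> 0}"

abbreviation sqnorm :: "('i \<Rightarrow> real) \<Rightarrow> real" where "sqnorm f \<equiv> pairing f f"

lemma pairing_eq_sum: "finite A \<Longrightarrow> supp f \<subseteq> A \<Longrightarrow> pairing f \<phi> = (\<Sum>i\<in>A. f i * \<phi> i)"
  unfolding pairing_def by (rule sum.mono_neutral_left) auto

lemma pairing_commute:
  assumes "finite (supp f)" "finite (supp g)" shows "pairing f g = pairing g f"
  using pairing_eq_sum[of "supp f \<union> supp g" f g] pairing_eq_sum[of "supp f \<union> supp g" g f] assms
  by (simp add: mult.commute)

lemma pairing_diff_left: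
  assumes "finite (supp f)" "finite (supp g)"
  shows "pairing (\<lambda>i. f i - s * g i) \<phi> = pairing f \<phi> - s * pairing g \<phi>"
proof -
  let ?A = "supp f \<union> supp g"
  have "pairing (\<lambda>i. f i - s * g i) \<phi> = (\<Sum>i\<in>?A. (f i - s * g i) * \<phi> i)"
    by (rule pairing_eq_sum) (use assms in auto)
  also have "\<dots> = (\<Sum>i\<in>?A. f i * \<phi> i) - s * (\<Sum>i\<in>?A. g i * \<phi> i)"
    by (simp add: sum_subtractf sum_distrib_left algebra_simps)
  finally show ?thesis using pairing_eq_sum[of ?A] assms by simp
qed

lemma pairing_diff_right: "pairing f (\<lambda>i. \<phi> i - s * \<psi> i) = pairing f \<phi> - s * pairing f \<psi>"
  by (simp add: pairing_def sum_subtractf sum_distrib_left algebra_simps)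

lemma pairing_sum_left:
  assumes "finite C" "\<And>c. c \<in> C \<Longrightarrow> finite (supp (g c))"
  shows "pairing (\<lambda>i. \<Sum>c\<in>C. a c * g c i) \<phi> = (\<Sum>c\<in>C. a c * pairing (g c) \<phi>)"
proof -
  let ?A = "\<Union>c\<in>C. supp (g c)"
  have fin: "finite ?A" using assms by auto
  have "pairing (\<lambda>i. \<Sum>c\<in>C. a c * g c i) \<phi> = (\<Sum>i\<in>?A. (\<Sum>c\<in>C. a c * g c i) * \<phi> i)"
  proof (rule pairing_eq_sum[OF fin])
    show "supp (\<lambda>i. \<Sum>c\<in>C. a c * g c i) \<subseteq> ?A"
    proof (rule subsetI, rule ccontr)
      fix i assume "i \<in> supp (\<lambda>i. \<Sum>c\<in>C. a c * g c i)" "i \<notin> ?A"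
      then show False by simp
    qed
  qed
  also have "\<dots> = (\<Sum>c\<in>C. \<Sum>i\<in>?A. a c * (g c i * \<phi> i))"
    unfolding sum_distrib_right by (subst sum.swap) (simp add: mult.assoc)
  also have "\<dots> = (\<Sum>c\<in>C. a c * pairing (g c) \<phi>)"
  proof (rule sum.cong[OF refl])
    fix c assume "c \<in> C"
    then have "pairing (g c) \<phi> = (\<Sum>i\<in>?A. g c i * \<phi> i)" by (intro pairing_eq_sum[OF fin]) blast
    then show "(\<Sum>i\<in>?A. a c * (g c i * \<phi> i)) = a c * pairing (g c) \<phi>" by (simp add: sum_distrib_left)
  qed
  finally show ?thesis .
qed

lemma sqnorm_nonneg: "sqnorm f \<ge> 0"
  by (simp add: pairing_def sum_nonneg)

lemma square_le_sqnorm: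
  assumes "finite (supp f)" shows "(f i)\<^sup>2 \<le> sqnorm f"
proof (cases "f i = 0")
  case False
  then show ?thesis using member_le_sum[of i "supp f" "\<lambda>i. f i * f i"] assms
    by (simp add: pairing_def power2_eq_square)
qed (simp add: sqnorm_nonneg)

lemma pairing_Cauchy_Schwarz:
  assumes "finite (supp f)" "finite (supp g)"
  shows "\<bar>pairing f g\<bar> \<le> sqrt (sqnorm f) * sqrt (sqnorm g)"
proof -
  let ?A = "supp f \<union> supp g"
  have fin: "finite ?A" using assms by auto
  have "(pairing f g)\<^sup>2 \<le> sqnorm f * sqnorm g"
    using Cauchy_Schwarz_ineq_sum[of f g ?A] pairing_eq_sum[OF fin, of f] pairing_eq_sum[OF fin, of g]
    by (simp add: power2_eq_square)
  then show ?thesis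
    by (metis real_sqrt_abs real_sqrt_le_iff real_sqrt_mult)
qed

lemma ell2_norm_finite_support:
  assumes "finite (supp f)" "supp f \<subseteq> I"
  shows "ell2_norm I f = sqrt (sqnorm f)" "(\<lambda>i. (f i)\<^sup>2) summable_on I"
proof -
  have "(\<Sum>\<^sub>\<infinity>i\<in>I. (f i)\<^sup>2) = (\<Sum>\<^sub>\<infinity>i\<in>supp f. (f i)\<^sup>2)"
    by (rule infsum_cong_neutral) (use assms in auto)
  then show "ell2_norm I f = sqrt (sqnorm f)"
    using assms by (simp add: ell2_norm_def pairing_def power2_eq_square)
  have "(\<lambda>i. (f i)\<^sup>2) summable_on supp f" using assms by simp
  then show "(\<lambda>i. (f i)\<^sup>2) summable_on I"
    by (rule summable_on_cong_neutral[THEN iffD1, rotated -1]) (use assms in auto)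
qed

section \<open>Cycles and faces of a Cayley complex\<close>

locale cayley_complex = word_metric +
  fixes D :: nat and F :: "'a step list set"
  assumes face_set: "is_face_set (cayley_edges G S) D F"
begin

abbreviation E :: "'a edge set" where "E \<equiv> cayley_edges G S"

abbreviation base :: "'a step list \<Rightarrow> 'a" where "base c \<equiv> step_src (c ! 0)"

text \<open>The coboundary of \<open>h\<close>, not cut off outside the edge set.\<close>

definition grad :: "('a \<Rightarrow> real) \<Rightarrow> 'a edge \<Rightarrow> real" where
  "grad h e = h (snd e) - h (fst e)"

definition sgn_step :: "'a step \<Rightarrow> real" where
  "sgn_step p = (if snd p then 1 else - 1)"

lemma sgn_step_grad: "sgn_step p * grad h (fst p) = h (step_tgt p) - h (step_src p)"
  by (cases p rule: step_src.cases) (simp add: sgn_step_def grad_def)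

lemma face_cycle: "c \<in> F \<Longrightarrow> is_cycle E c" and face_length: "c \<in> F \<Longrightarrow> length c \<le> D"
  using face_set by (auto simp: is_face_set_def)

lemma face_edges: "c \<in> F \<Longrightarrow> fst ` set c \<subseteq> E" and face_nonempty: "c \<in> F \<Longrightarrow> c \<noteq> []"
  using face_cycle by (auto simp: is_cycle_def)

lemma step_ends:
  assumes "fst p \<in> E"
  shows "step_src p \<in> carrier G" "step_tgt p \<in> carrier G" "d (step_src p) (step_tgt p) \<le> 1"
    "fst (fst p) \<in> {step_src p, step_tgt p}" "snd (fst p) \<in> {step_src p, step_tgt p}"
proof -
  obtain u v b where p: "p = ((u, v), b)" by (metis surj_pair)
  have uv: "u \<in> carrier G" "v \<in> carrier G" "d u v \<le> 1" using assms edge_dist p by auto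
  then show "step_src p \<in> carrier G" "step_tgt p \<in> carrier G" "d (step_src p) (step_tgt p) \<le> 1"
    "fst (fst p) \<in> {step_src p, step_tgt p}" "snd (fst p) \<in> {step_src p, step_tgt p}"
    using p dist_sym[OF uv(1,2)] by auto
qed

lemma face_dist:
  assumes c: "c \<in> F" and i: "i < length c"
  shows "d (base c) (step_src (c ! i)) \<le> i"
  using i
proof (induction i)
  case 0
  have "fst (c ! 0) \<in> E" using face_edges[OF c] 0 by auto
  then show ?case using step_ends(1) by simp
next
  case (Suc i)
  have e: "fst (c ! 0) \<in> E" "fst (c ! i) \<in> E" "fst (c ! Suc i) \<in> E"
    using face_edges[OF c] Suc.prems by (auto intro!: imageI nth_mem subsetD[OF face_edges[OF c]])
  have tgt: "step_tgt (c ! i) = step_src (c ! Suc i)"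
    using face_cycle[OF c] Suc.prems by (auto simp: is_cycle_def)
  have "d (base c) (step_src (c ! Suc i)) \<le> d (base c) (step_src (c ! i)) + d (step_src (c ! i)) (step_src (c ! Suc i))"
    using step_ends(1)[OF e(1)] step_ends(1)[OF e(2)] step_ends(1)[OF e(3)] by (rule dist_triangle)
  then show ?case using Suc step_ends(3)[OF e(2)] tgt by simp
qed

lemma base_closed: "c \<in> F \<Longrightarrow> base c \<in> carrier G"
  using face_edges[of c] face_nonempty[of c] by (intro step_ends(1)) auto

lemma face_vertex_dist:
  assumes c: "c \<in> F" and p: "p \<in> set c"
  shows "d (base c) (step_src p) \<le> D" "d (base c) (step_tgt p) \<le> D" "d (base c) (fst (fst p)) \<le> D"
proof -
  obtain i where i: "i < length c" "p = c ! i" using p by (metis in_set_conv_nth)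
  show 1: "d (base c) (step_src p) \<le> D" using face_dist[OF c i(1)] i face_length[OF c] by simp
  have "step_tgt p = step_src (c ! (Suc i mod length c))" using face_cycle[OF c] i by (auto simp: is_cycle_def)
  moreover have "Suc i mod length c < length c" using i(1) by (intro mod_less_divisor) linarith
  ultimately show 2: "d (base c) (step_tgt p) \<le> D"
    using face_dist[OF c, of "Suc i mod length c"] face_length[OF c] by simp
  have "fst p \<in> E" using face_edges[OF c] p by auto
  then show "d (base c) (fst (fst p)) \<le> D" using 1 2 step_ends(4)[of p] by auto
qed

lemma supp_incidence: "supp (incidence c) \<subseteq> fst ` set c"
  by (force simp: incidence_def split: if_splits)

lemma abs_incidence_le: "\<bar>incidence c e\<bar> \<le> 1"
  by (simp add: incidence_def)

lemma finite_supp_incidence: "finite (supp (incidence c))"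
  by (rule finite_subset[OF supp_incidence]) simp

lemma pairing_incidence:
  assumes "is_cycle A c"
  shows "pairing (incidence c) \<phi> = (\<Sum>i<length c. sgn_step (c ! i) * \<phi> (fst (c ! i)))"
proof -
  have dist: "distinct c" "inj_on fst (set c)"
    using assms by (auto simp: is_cycle_def distinct_map)
  have inc: "incidence c (fst p) = sgn_step p" if "p \<in> set c" for p
  proof -
    have "(fst p, \<not> snd p) \<notin> set c"
      using dist(2) that by (metis fst_conv inj_onD snd_conv)
    then show ?thesis using that by (cases p; cases "snd p") (auto simp: incidence_def sgn_step_def)
  qed
  have "pairing (incidence c) \<phi> = (\<Sum>e\<in>fst ` set c. incidence c e * \<phi> e)"
    by (rule pairing_eq_sum) (use supp_incidence in auto)
  also have "\<dots> = (\<Sum>p\<in>set c. sgn_step p * \<phi> (fst p))"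
    by (subst sum.reindex[OF dist(2)]) (simp add: inc)
  also have "\<dots> = (\<Sum>i<length c. sgn_step (c ! i) * \<phi> (fst (c ! i)))"
    by (rule sum.reindex_bij_betw[OF bij_betw_nth[OF dist(1) refl refl], symmetric])
  finally show ?thesis .
qed

lemma sum_around_cycle:
  assumes "is_cycle A c"
  shows "(\<Sum>i<length c. h (step_tgt (c ! i)) - h (step_src (c ! i))) = (0 :: real)"
proof -
  let ?n = "length c"
  have n: "?n > 0" using assms by (simp add: is_cycle_def)
  have "(\<Sum>i<?n. h (step_tgt (c ! i))) = (\<Sum>i<?n. h (step_src (c ! (Suc i mod ?n))))"
    using assms by (intro sum.cong) (auto simp: is_cycle_def)
  also have "\<dots> = (\<Sum>i<?n. h (step_src (c ! i)))"
  proof (rule sum.reindex_bij_witness[of _ "\<lambda>i. (i + ?n - 1) mod ?n" "\<lambda>i. Suc i mod ?n"])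
    fix i assume "i \<in> {..<?n}"
    then have i: "i < ?n" by simp
    show "(Suc i mod ?n + ?n - 1) mod ?n = i" using i by (cases "Suc i = ?n") auto
    show "Suc i mod ?n \<in> {..<?n}" using n by simp
    show "Suc ((i + ?n - 1) mod ?n) mod ?n = i" using i n by (simp add: mod_Suc_eq)
    show "(i + ?n - 1) mod ?n \<in> {..<?n}" using n by simp
  qed simp
  finally show ?thesis by (simp add: sum_subtractf)
qed

lemma coboundary1_eq_pairing: "c \<in> F \<Longrightarrow> coboundary1 F \<phi> c = pairing (incidence c) \<phi>"
  unfolding coboundary1_def using pairing_eq_sum[OF _ supp_incidence[of c]] by simp

lemma finite_edges_from: "finite {e \<in> E. fst e = v}" and finite_edges_to: "finite {e \<in> E. snd e = v}"
proof -
  have "{e \<in> E. fst e = v} \<subseteq> (\<lambda>s. (v, v \<otimes> s)) ` S" by (auto simp: cayley_edges_def)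
  then show "finite {e \<in> E. fst e = v}" using finite_gens finite_surj by blast
  have "{e \<in> E. snd e = v} \<subseteq> (\<lambda>s. (v \<otimes> inv s, v)) ` S"
  proof
    fix e assume "e \<in> {e \<in> E. snd e = v}"
    then obtain g s where gs: "g \<in> carrier G" "s \<in> S" "e = (g, g \<otimes> s)" "g \<otimes> s = v"
      by (auto simp: cayley_edges_def)
    then have "s \<in> carrier G" using gens_closed by auto
    then have "g = v \<otimes> inv s" using gs(1) gs(4)[symmetric] by (simp add: m_assoc)
    then show "e \<in> (\<lambda>s. (v \<otimes> inv s, v)) ` S" using gs by auto
  qed
  then show "finite {e \<in> E. snd e = v}" using finite_gens finite_surj by blast
qed

text \<open>Testing against gradients of point masses turns \<open>\<partial>f = 0\<close> into a statement about telescoping sums.\<close>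

lemma boundary1_eq_pairing:
  assumes f: "finite (supp f)" "supp f \<subseteq> E" and v: "v \<in> carrier G"
  shows "boundary1 (carrier G) E f v = pairing f (grad (\<lambda>u. if u = v then 1 else 0))"
proof -
  have "(\<Sum>e | e \<in> E \<and> snd e = v. f e) = (\<Sum>e\<in>supp f. f e * (if snd e = v then 1 else 0))"
    by (rule sum.mono_neutral_cong) (use f finite_edges_to in auto)
  moreover have "(\<Sum>e | e \<in> E \<and> fst e = v. f e) = (\<Sum>e\<in>supp f. f e * (if fst e = v then 1 else 0))"
    by (rule sum.mono_neutral_cong) (use f finite_edges_from in auto)
  ultimately show ?thesis
    using v by (simp add: boundary1_def pairing_def grad_def sum_subtractf right_diff_distrib)
qed

abbreviation cycles :: "('a edge \<Rightarrow> real) set" where "cycles \<equiv> finite_cycles (carrier G) E"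

lemma cycles_iff:
  "f \<in> cycles \<longleftrightarrow> finite (supp f) \<and> supp f \<subseteq> E \<and>
     (\<forall>v\<in>carrier G. pairing f (grad (\<lambda>u. if u = v then 1 else 0)) = 0)"
  unfolding finite_cycles_def using boundary1_eq_pairing by auto

lemma cyclesD: "f \<in> cycles \<Longrightarrow> finite (supp f)" "f \<in> cycles \<Longrightarrow> supp f \<subseteq> E"
  by (auto simp: cycles_iff)

lemma cycles_diff:
  assumes "f \<in> cycles" "g \<in> cycles" shows "(\<lambda>e. f e - s * g e) \<in> cycles"
proof -
  have "supp (\<lambda>e. f e - s * g e) \<subseteq> supp f \<union> supp g" by auto
  moreover have "finite (supp f \<union> supp g)" "supp f \<union> supp g \<subseteq> E" using assms by (auto simp: cycles_iff)
  ultimately have "finite (supp (\<lambda>e. f e - s * g e))" "supp (\<lambda>e. f e - s * g e) \<subseteq> E"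
    using finite_subset by blast+
  then show ?thesis using assms by (simp add: cycles_iff pairing_diff_left)
qed

lemma cycles_sum:
  assumes "finite C" "\<And>c. c \<in> C \<Longrightarrow> g c \<in> cycles"
  shows "(\<lambda>e. \<Sum>c\<in>C. a c * g c e) \<in> cycles"
proof -
  have "supp (\<lambda>e. \<Sum>c\<in>C. a c * g c e) \<subseteq> (\<Union>c\<in>C. supp (g c))"
  proof (rule subsetI, rule ccontr)
    fix e assume "e \<in> supp (\<lambda>e. \<Sum>c\<in>C. a c * g c e)" "e \<notin> (\<Union>c\<in>C. supp (g c))"
    then show False by simp
  qed
  moreover have "finite (\<Union>c\<in>C. supp (g c))" "(\<Union>c\<in>C. supp (g c)) \<subseteq> E"
    using assms by (auto simp: cycles_iff)
  ultimately have "finite (supp (\<lambda>e. \<Sum>c\<in>C. a c * g c e))" "supp (\<lambda>e. \<Sum>c\<in>C. a c * g c e) \<subseteq> E"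
    using finite_subset by blast+
  moreover have "pairing (\<lambda>e. \<Sum>c\<in>C. a c * g c e) \<phi> = (\<Sum>c\<in>C. a c * pairing (g c) \<phi>)" for \<phi>
    using assms by (intro pairing_sum_left) (auto simp: cycles_iff)
  ultimately show ?thesis using assms by (simp add: cycles_iff)
qed

lemma incidence_cycle:
  assumes c: "c \<in> F" shows "incidence c \<in> cycles"
proof -
  have "pairing (incidence c) (grad h) = 0" for h
    unfolding pairing_incidence[OF face_cycle[OF c]] sgn_step_grad
    by (rule sum_around_cycle[OF face_cycle[OF c]])
  then show ?thesis unfolding cycles_iff
    using finite_supp_incidence supp_incidence[of c] face_edges[OF c] by blast
qed

definition faces_near :: "'a \<Rightarrow> 'a step list set" where
  "faces_near v = {c \<in> F. d v (base c) \<le> D}"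

text \<open>A face near \<open>v\<close> is a list of at most \<open>D\<close> directed edges, and these start within distance \<open>2D\<close> of \<open>v\<close>.\<close>

definition face_bound :: nat where
  "face_bound = (\<Sum>i\<le>D. (2 * (growth (2 * D) * card S)) ^ i)"

lemma faces_near_bound:
  assumes v: "v \<in> carrier G"
  shows "finite (faces_near v)" "card (faces_near v) \<le> face_bound"
proof -
  define X where "X = (\<lambda>(u, s). (u, u \<otimes> s)) ` (ball v (2 * D) \<times> S)"
  have X: "finite X" using finite_gens v by (simp add: X_def)
  have "card X \<le> growth (2 * D) * card S"
    unfolding X_def using card_image_le[of "ball v (2 * D) \<times> S"] finite_gens v
    by (simp add: card_cartesian_product card_ball)
  then have cX: "card (X \<times> (UNIV :: bool set)) \<le> 2 * (growth (2 * D) * card S)"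
    by (simp add: card_cartesian_product)
  have sub: "faces_near v \<subseteq> {c. set c \<subseteq> X \<times> UNIV \<and> length c \<le> D}"
  proof
    fix c assume "c \<in> faces_near v"
    then have c: "c \<in> F" "d v (base c) \<le> D" by (auto simp: faces_near_def)
    have "fst p \<in> X" if p: "p \<in> set c" for p
    proof -
      obtain u s where us: "fst p = (u, u \<otimes> s)" "u \<in> carrier G" "s \<in> S"
        using face_edges[OF c(1)] p by (force simp: cayley_edges_def)
      have "d v u \<le> d v (base c) + d (base c) u" using base_closed[OF c(1)] v us by (intro dist_triangle)
      then have "u \<in> ball v (2 * D)" using c(2) face_vertex_dist(3)[OF c(1) p] us by (simp add: in_ball)
      then show ?thesis unfolding X_def us(1) using us(3) by force
    qed
    then show "c \<in> {c. set c \<subseteq> X \<times> UNIV \<and> length c \<le> D}" using face_length[OF c(1)] by force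
  qed
  have fin: "finite {c. set c \<subseteq> X \<times> (UNIV :: bool set) \<and> length c \<le> D}"
    using X by (intro finite_lists_length_le) simp
  then show "finite (faces_near v)" using sub finite_subset by blast
  have "card (faces_near v) \<le> card {c. set c \<subseteq> X \<times> (UNIV :: bool set) \<and> length c \<le> D}"
    by (rule card_mono[OF fin sub])
  also have "\<dots> = (\<Sum>i\<le>D. card (X \<times> (UNIV :: bool set)) ^ i)"
    using X by (intro card_lists_length_le) simp
  also have "\<dots> \<le> face_bound" unfolding face_bound_def using cX by (intro sum_mono power_mono) auto
  finally show "card (faces_near v) \<le> face_bound" .
qed

lemma faces_through:
  assumes "c \<in> F" "e \<in> fst ` set c"
  shows "c \<in> faces_near (fst e)"
proof -
  obtain p where p: "p \<in> set c" "e = fst p" using assms by auto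
  have "fst e \<in> carrier G" using face_edges[OF assms(1)] assms(2) edge_dist[of "fst e" "snd e"] by auto
  then show ?thesis using assms face_vertex_dist(3)[OF assms(1) p(1)] p dist_sym[OF base_closed[OF assms(1)]]
    by (simp add: faces_near_def)
qed

lemma edge_src: "e \<in> E \<Longrightarrow> fst e \<in> carrier G"
  using edge_dist[of "fst e" "snd e"] by simp

lemma coboundary1_finite:
  assumes f: "finite (supp f)" "supp f \<subseteq> E"
  shows "finite (supp (coboundary1 F f))" "supp (coboundary1 F f) \<subseteq> F"
proof -
  show "supp (coboundary1 F f) \<subseteq> F" by (auto simp: coboundary1_def)
  have "supp (coboundary1 F f) \<subseteq> (\<Union>e\<in>supp f. faces_near (fst e))"
  proof
    fix c assume "c \<in> supp (coboundary1 F f)"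
    then have c: "c \<in> F" "(\<Sum>e \<in> fst ` set c. incidence c e * f e) \<noteq> 0"
      by (auto simp: coboundary1_def split: if_splits)
    then obtain e where "e \<in> fst ` set c" "f e \<noteq> 0"
      by (metis (no_types, lifting) mult_zero_right sum.not_neutral_contains_not_neutral)
    then show "c \<in> (\<Union>e\<in>supp f. faces_near (fst e))" using faces_through[OF c(1)] by blast
  qed
  moreover have "finite (\<Union>e\<in>supp f. faces_near (fst e))"
    using f faces_near_bound(1) edge_src by blast
  ultimately show "finite (supp (coboundary1 F f))" by (rule finite_subset)
qed

lemma boundary2_expand:
  assumes "finite C" "supp g \<subseteq> C" "C \<subseteq> F"
  shows "boundary2 E F g = (\<lambda>e. \<Sum>c\<in>C. g c * incidence c e)"
proof
  fix e
  show "boundary2 E F g e = (\<Sum>c\<in>C. g c * incidence c e)"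
  proof (cases "e \<in> E")
    case True
    have fin: "finite {c \<in> F. e \<in> fst ` set c}"
      by (rule finite_subset[OF _ faces_near_bound(1)[OF edge_src[OF True]]]) (use faces_through in blast)
    have out: "incidence c e = 0" if "e \<notin> fst ` set c" for c using that supp_incidence[of c] by blast
    have "(\<Sum>c | c \<in> F \<and> e \<in> fst ` set c. incidence c e * g c) = (\<Sum>c\<in>C. g c * incidence c e)"
      by (rule sum.mono_neutral_cong) (use assms fin out in \<open>auto simp: mult.commute\<close>)
    then show ?thesis using True by (simp add: boundary2_def)
  next
    case False
    then have "incidence c e = 0" if "c \<in> C" for c
      using that assms(3) face_edges[of c] supp_incidence[of c] by blast
    then show ?thesis using False by (simp add: boundary2_def)
  qed
qed

lemma boundary2_cycle:
  assumes "finite (supp g)" "supp g \<subseteq> F" shows "boundary2 E F g \<in> cycles"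
  unfolding boundary2_expand[OF assms(1) order_refl assms(2)]
  using assms incidence_cycle by (intro cycles_sum) auto

lemma boundary2_adjoint:
  assumes "finite (supp g)" "supp g \<subseteq> F"
  shows "pairing (boundary2 E F g) \<phi> = pairing g (coboundary1 F \<phi>)"
proof -
  have "pairing (boundary2 E F g) \<phi> = (\<Sum>c\<in>supp g. g c * pairing (incidence c) \<phi>)"
    unfolding boundary2_expand[OF assms(1) order_refl assms(2)]
    using assms finite_supp_incidence by (intro pairing_sum_left) auto
  also have "\<dots> = pairing g (coboundary1 F \<phi>)"
    unfolding pairing_def[of g] using assms coboundary1_eq_pairing by (intro sum.cong) auto
  finally show ?thesis .
qed

text \<open>The Cauchy-Schwarz inequality over the boundedly many faces at an edge, followed by counting each
  face once for each of its at most \<open>D\<close> edges.\<close>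

lemma boundary2_bounded:
  assumes g: "finite (supp g)" "supp g \<subseteq> F"
  shows "sqnorm (boundary2 E F g) \<le> real (face_bound * D) * sqnorm g"
proof -
  let ?C = "supp g"
  define A where "A = (\<Union>c\<in>?C. fst ` set c)"
  have A: "finite A" "A \<subseteq> E" using g face_edges by (auto simp: A_def)
  define m where "m c e = (if e \<in> fst ` set c then (g c)\<^sup>2 else 0)" for c :: "'a step list" and e
  have exp: "boundary2 E F g = (\<lambda>e. \<Sum>c\<in>?C. g c * incidence c e)"
    by (rule boundary2_expand[OF g(1) order_refl g(2)])
  have "supp (boundary2 E F g) \<subseteq> A"
  proof (rule subsetI, rule ccontr)
    fix e assume e: "e \<in> supp (boundary2 E F g)" "e \<notin> A"
    then have "incidence c e = 0" if "c \<in> ?C" for c using that supp_incidence[of c] by (auto simp: A_def)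
    then show False using e(1) by (simp add: exp)
  qed
  then have "sqnorm (boundary2 E F g) = (\<Sum>e\<in>A. (\<Sum>c\<in>?C. g c * incidence c e)\<^sup>2)"
    using pairing_eq_sum[OF A(1)] by (simp add: exp power2_eq_square)
  also have "\<dots> \<le> (\<Sum>e\<in>A. real face_bound * (\<Sum>c\<in>?C. m c e))"
  proof (rule sum_mono)
    fix e assume e: "e \<in> A"
    define Ce where "Ce = {c \<in> ?C. e \<in> fst ` set c}"
    have Ce: "Ce \<subseteq> ?C" "Ce \<subseteq> faces_near (fst e)"
    proof -
      show "Ce \<subseteq> ?C" by (auto simp: Ce_def)
      show "Ce \<subseteq> faces_near (fst e)"
      proof
        fix c assume "c \<in> Ce"
        then have "c \<in> F" "e \<in> fst ` set c" using g(2) by (auto simp: Ce_def)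
        then show "c \<in> faces_near (fst e)" by (rule faces_through)
      qed
    qed
    have src: "fst e \<in> carrier G" using e A edge_src by blast
    have "(\<Sum>c\<in>?C. g c * incidence c e) = (\<Sum>c\<in>Ce. g c * incidence c e)"
    proof (rule sum.mono_neutral_right[OF g(1) Ce(1)])
      show "\<forall>c\<in>?C - Ce. g c * incidence c e = 0" using supp_incidence by (auto simp: Ce_def)
    qed
    then have "(\<Sum>c\<in>?C. g c * incidence c e)\<^sup>2 \<le> (\<Sum>c\<in>Ce. (g c)\<^sup>2) * (\<Sum>c\<in>Ce. (incidence c e)\<^sup>2)"
      using Cauchy_Schwarz_ineq_sum[of g "\<lambda>c. incidence c e" Ce] by simp
    also have "\<dots> \<le> (\<Sum>c\<in>Ce. (g c)\<^sup>2) * real face_bound"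
    proof (rule mult_left_mono)
      have "(\<Sum>c\<in>Ce. (incidence c e)\<^sup>2) \<le> (\<Sum>c\<in>Ce. 1)"
        using abs_incidence_le by (intro sum_mono) (simp add: abs_square_le_1)
      also have "\<dots> \<le> real face_bound"
        using card_mono[OF faces_near_bound(1)[OF src] Ce(2)] faces_near_bound(2)[OF src] by simp
      finally show "(\<Sum>c\<in>Ce. (incidence c e)\<^sup>2) \<le> real face_bound" .
    qed (simp add: sum_nonneg)
    also have "(\<Sum>c\<in>Ce. (g c)\<^sup>2) = (\<Sum>c\<in>?C. m c e)"
      by (rule sum.mono_neutral_cong_left) (use g in \<open>auto simp: Ce_def m_def\<close>)
    finally show "(\<Sum>c\<in>?C. g c * incidence c e)\<^sup>2 \<le> real face_bound * (\<Sum>c\<in>?C. m c e)"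
      by (simp add: mult.commute)
  qed
  also have "\<dots> = real face_bound * (\<Sum>c\<in>?C. \<Sum>e\<in>A. m c e)"
    by (simp add: sum_distrib_left[symmetric] sum.swap[of _ A])
  also have "\<dots> \<le> real face_bound * (\<Sum>c\<in>?C. real D * (g c)\<^sup>2)"
  proof (intro mult_left_mono sum_mono)
    fix c assume c: "c \<in> ?C"
    have "(\<Sum>e\<in>A. m c e) = (\<Sum>e\<in>fst ` set c. (g c)\<^sup>2)"
      by (rule sum.mono_neutral_cong_right) (use A c in \<open>auto simp: m_def A_def\<close>)
    also have "\<dots> = real (card (fst ` set c)) * (g c)\<^sup>2" by simp
    also have "card (fst ` set c) \<le> D"
      using card_image_le[of "set c" fst] card_length[of c] face_length[of c] c g(2) by force
    finally show "(\<Sum>e\<in>A. m c e) \<le> real D * (g c)\<^sup>2" by (simp add: mult_right_mono)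
  qed simp
  also have "\<dots> = real (face_bound * D) * sqnorm g"
    by (simp add: pairing_def sum_distrib_left power2_eq_square mult.assoc)
  finally show ?thesis .
qed

section \<open>Relaxation and local fillings\<close>

definition face_laplacian :: "('a edge \<Rightarrow> real) \<Rightarrow> 'a edge \<Rightarrow> real" where
  "face_laplacian f = boundary2 E F (coboundary1 F f)"

lemma face_laplacian_cycle: "f \<in> cycles \<Longrightarrow> face_laplacian f \<in> cycles"
  unfolding face_laplacian_def using coboundary1_finite cyclesD by (intro boundary2_cycle) blast+

lemma pairing_face_laplacian:
  "f \<in> cycles \<Longrightarrow> pairing (face_laplacian f) \<phi> = pairing (coboundary1 F f) (coboundary1 F \<phi>)"
  unfolding face_laplacian_def using coboundary1_finite cyclesD by (intro boundary2_adjoint) blast+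

lemma laplacian1_cycle:
  assumes "f \<in> cycles" shows "laplacian1 (carrier G) E F f = face_laplacian f"
proof
  fix e
  have "boundary1 (carrier G) E f v = 0" for v
    using assms by (cases "v \<in> carrier G") (auto simp: finite_cycles_def boundary1_def)
  then show "laplacian1 (carrier G) E F f e = face_laplacian f e"
    by (simp add: laplacian1_def face_laplacian_def coboundary0_def)
qed

lemma cycles_subset_ell2_0c: "cycles \<subseteq> ell2_0c (carrier G) E"
proof
  fix f assume f: "f \<in> cycles"
  have "f \<in> ell2 E"
    unfolding ell2_def using cyclesD[OF f] ell2_norm_finite_support(2)[of f E] by auto
  moreover have "ell2_norm E (\<lambda>e. f e - f e) = 0" by (simp add: ell2_norm_def)
  ultimately show "f \<in> ell2_0c (carrier G) E" unfolding ell2_0c_def using f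
    by (auto intro!: bexI[of _ f])
qed

text \<open>As 0 lies outside the spectrum, \<open>\<Delta>\<^sub>1\<close> is bounded below on \<open>\<ell>\<^sup>2\<^sub>0\<^sub>,\<^sub>c(E)\<close>, which contains the finite cycles.\<close>

lemma gap_on_cycles:
  assumes "has_spectral_gap E (ell2_0c (carrier G) E) (laplacian1 (carrier G) E F)"
  obtains C where "C \<ge> 0" "\<And>f. f \<in> cycles \<Longrightarrow> sqnorm f \<le> C * sqnorm (face_laplacian f)"
proof -
  let ?H = "ell2_0c (carrier G) E" and ?L = "laplacian1 (carrier G) E F"
  obtain \<epsilon> :: real where "\<epsilon> > 0" "spectrum_on E ?H ?L \<inter> {0..<\<epsilon>} = {}"
    using assms unfolding has_spectral_gap_def by blast
  then have "0 \<notin> spectrum_on E ?H ?L" by auto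
  then obtain C where C: "\<And>f. f \<in> ?H \<Longrightarrow> ell2_norm E f \<le> C * ell2_norm E (?L f)"
    unfolding spectrum_on_def by auto
  show ?thesis
  proof (rule that)
    show "C\<^sup>2 \<ge> 0" by simp
    fix f assume f: "f \<in> cycles"
    have "sqrt (sqnorm f) \<le> C * sqrt (sqnorm (face_laplacian f))"
      using C[of f] f cycles_subset_ell2_0c ell2_norm_finite_support(1)[OF cyclesD[OF f]]
        ell2_norm_finite_support(1)[OF cyclesD[OF face_laplacian_cycle[OF f]]] laplacian1_cycle[OF f]
      by auto
    then have "(sqrt (sqnorm f))\<^sup>2 \<le> (C * sqrt (sqnorm (face_laplacian f)))\<^sup>2"
      by (rule power_mono) (simp add: sqnorm_nonneg)
    then show "sqnorm f \<le> C\<^sup>2 * sqnorm (face_laplacian f)"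
      by (simp add: power_mult_distrib sqnorm_nonneg)
  qed
qed

text \<open>A gradient descent step for the quadratic form \<open>\<parallel>d f\<parallel>\<^sup>2\<close>.\<close>

definition relax :: "real \<Rightarrow> ('a edge \<Rightarrow> real) \<Rightarrow> 'a edge \<Rightarrow> real" where
  "relax s f = (\<lambda>e. f e - s * face_laplacian f e)"

lemma relax_cycle: "f \<in> cycles \<Longrightarrow> relax s f \<in> cycles"
  unfolding relax_def using face_laplacian_cycle by (intro cycles_diff)

lemma relax_funpow_cycle: "f \<in> cycles \<Longrightarrow> (relax s ^^ k) f \<in> cycles"
  by (induction k) (auto intro: relax_cycle)

lemma pairing_relax:
  "f \<in> cycles \<Longrightarrow> pairing (relax s f) \<phi> = pairing f \<phi> - s * pairing (face_laplacian f) \<phi>"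
  unfolding relax_def using cyclesD face_laplacian_cycle by (intro pairing_diff_left) blast+

text \<open>If \<open>\<parallel>\<partial>g\<parallel>\<^sup>2 \<le> B \<parallel>g\<parallel>\<^sup>2\<close>, then the choice \<open>s = 1 / B\<close> yields \<open>\<parallel>f - s \<partial>d f\<parallel>\<^sup>2 \<le> \<parallel>f\<parallel>\<^sup>2 - \<parallel>d f\<parallel>\<^sup>2 / B\<close>, and
  the gap bounds \<open>\<parallel>d f\<parallel>\<^sup>2 \<ge> \<parallel>\<partial>d f\<parallel>\<^sup>2 / B\<close> from below by a multiple of \<open>\<parallel>f\<parallel>\<^sup>2\<close>. The enlarged constants
  \<open>B\<close> and \<open>\<kappa>\<close> keep the resulting factor strictly positive.\<close>

lemma relax_contracts:
  assumes "has_spectral_gap E (ell2_0c (carrier G) E) (laplacian1 (carrier G) E F)"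
  obtains s \<theta> where "0 < s" "0 < \<theta>" "\<theta> < 1" "\<And>f. f \<in> cycles \<Longrightarrow> sqnorm (relax s f) \<le> \<theta> * sqnorm f"
proof -
  obtain C where C: "C \<ge> 0" "\<And>f. f \<in> cycles \<Longrightarrow> sqnorm f \<le> C * sqnorm (face_laplacian f)"
    by (rule gap_on_cycles[OF assms]) blast
  define B where "B = real (face_bound * D) + 1"
  define \<kappa> where "\<kappa> = C + 2"
  have B: "B \<ge> 1" and \<kappa>: "\<kappa> \<ge> 2" using C by (auto simp: B_def \<kappa>_def)
  have BB: "B\<^sup>2 * \<kappa> \<ge> 2"
    using mult_mono[of 1 "B\<^sup>2" 2 \<kappa>] B \<kappa> by (simp add: one_le_power)
  show ?thesis
  proof (rule that)
    show "0 < 1 / B" using B by simp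
    show "0 < 1 - 1 / (B\<^sup>2 * \<kappa>)" "1 - 1 / (B\<^sup>2 * \<kappa>) < 1" using BB by (auto simp: divide_simps)
    fix f assume f: "f \<in> cycles"
    define e where "e = sqnorm (coboundary1 F f)"
    let ?T = "face_laplacian f"
    have T: "?T \<in> cycles" using f by (rule face_laplacian_cycle)
    have e: "pairing ?T f = e" unfolding e_def by (rule pairing_face_laplacian[OF f])
    have "sqnorm ?T \<le> real (face_bound * D) * e"
      unfolding face_laplacian_def e_def using coboundary1_finite cyclesD[OF f] by (intro boundary2_bounded) blast+
    also have "\<dots> \<le> B * e" unfolding B_def e_def by (intro mult_right_mono sqnorm_nonneg) simp
    finally have Te: "sqnorm ?T \<le> B * e" .
    have "sqnorm f \<le> C * sqnorm ?T" using C f by blast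
    also have "\<dots> \<le> \<kappa> * (B * e)" using Te C \<kappa> sqnorm_nonneg[of ?T] by (intro mult_mono) (auto simp: \<kappa>_def)
    finally have fe: "sqnorm f / (B * \<kappa>) \<le> e" using B \<kappa> by (simp add: field_simps)
    have "sqnorm (relax (1 / B) f) = pairing f (relax (1 / B) f) - 1 / B * pairing ?T (relax (1 / B) f)"
      by (rule pairing_relax[OF f])
    also have "\<dots> = sqnorm f - 1 / B * pairing f ?T - 1 / B * (pairing ?T f - 1 / B * sqnorm ?T)"
      unfolding relax_def pairing_diff_right by simp
    also have "pairing f ?T = e" using pairing_commute cyclesD(1)[OF f] cyclesD(1)[OF T] e by metis
    also have "sqnorm f - 1 / B * e - 1 / B * (pairing ?T f - 1 / B * sqnorm ?T) \<le> sqnorm f - 1 / B * e"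
    proof -
      have "1 / B * sqnorm ?T \<le> e" using Te B by (simp add: divide_le_eq mult.commute)
      then have "0 \<le> 1 / B * (pairing ?T f - 1 / B * sqnorm ?T)" using e B by (intro mult_nonneg_nonneg) auto
      then show ?thesis by linarith
    qed
    also have "\<dots> \<le> sqnorm f - 1 / B * (sqnorm f / (B * \<kappa>))"
      using fe B by (intro diff_left_mono mult_left_mono) auto
    also have "\<dots> = (1 - 1 / (B\<^sup>2 * \<kappa>)) * sqnorm f" by (simp add: algebra_simps power2_eq_square)
    finally show "sqnorm (relax (1 / B) f) \<le> (1 - 1 / (B\<^sup>2 * \<kappa>)) * sqnorm f" .
  qed
qed

lemma relax_funpow_sqnorm:
  assumes "\<theta> \<ge> 0" "\<And>f. f \<in> cycles \<Longrightarrow> sqnorm (relax s f) \<le> \<theta> * sqnorm f" and f: "f \<in> cycles"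
  shows "sqnorm ((relax s ^^ k) f) \<le> \<theta> ^ k * sqnorm f"
proof (induction k)
  case (Suc k)
  have "sqnorm (relax s ((relax s ^^ k) f)) \<le> \<theta> * sqnorm ((relax s ^^ k) f)"
    by (intro assms(2) relax_funpow_cycle f)
  also have "\<dots> \<le> \<theta> * (\<theta> ^ k * sqnorm f)" using Suc assms(1) by (intro mult_left_mono)
  finally show ?case by (simp add: mult.assoc)
qed simp

lemma relax_funpow_symmetric:
  assumes "f \<in> cycles" "g \<in> cycles"
  shows "pairing ((relax s ^^ k) f) g = pairing f ((relax s ^^ k) g)"
  using assms(2)
proof (induction k arbitrary: g)
  case (Suc k)
  have sym: "pairing (relax s u) v = pairing u (relax s v)" if "u \<in> cycles" "v \<in> cycles" for u v
  proof -
    have "pairing (face_laplacian u) v = pairing u (face_laplacian v)"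
      using pairing_face_laplacian[OF that(1), of v] pairing_face_laplacian[OF that(2), of u]
        pairing_commute[of "coboundary1 F u" "coboundary1 F v"] pairing_commute[of u "face_laplacian v"]
        coboundary1_finite(1)[OF cyclesD[OF that(1)]] coboundary1_finite(1)[OF cyclesD[OF that(2)]]
        cyclesD(1)[OF that(1)] cyclesD(1)[OF face_laplacian_cycle[OF that(2)]] by simp
    then show ?thesis using that by (simp add: pairing_relax) (simp add: relax_def pairing_diff_right)
  qed
  have "pairing ((relax s ^^ Suc k) f) g = pairing ((relax s ^^ k) f) (relax s g)"
    using sym relax_funpow_cycle[OF assms(1)] Suc.prems by simp
  also have "\<dots> = pairing f ((relax s ^^ k) (relax s g))" using Suc relax_cycle by blast
  finally show ?case by (simp add: funpow_swap1)
qed simp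

lemma face_laplacian_propagates:
  assumes f: "finite (supp f)" "supp f \<subseteq> E" and e: "face_laplacian f e \<noteq> 0"
  shows "e \<in> E \<and> (\<exists>e'\<in>supp f. d (fst e) (fst e') \<le> 2 * D)"
proof -
  have eE: "e \<in> E" using e by (auto simp: face_laplacian_def boundary2_def split: if_splits)
  obtain c where c: "c \<in> F" "e \<in> fst ` set c" "coboundary1 F f c \<noteq> 0"
  proof -
    have "(\<Sum>c | c \<in> F \<and> e \<in> fst ` set c. incidence c e * coboundary1 F f c) \<noteq> 0"
      using e eE by (simp add: face_laplacian_def boundary2_def)
    then obtain c where "c \<in> {c \<in> F. e \<in> fst ` set c}" "incidence c e * coboundary1 F f c \<noteq> 0"
      by (rule sum.not_neutral_contains_not_neutral)
    then show ?thesis using that[of c] by (metis (no_types, lifting) mem_Collect_eq mult_zero_right)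
  qed
  obtain e' where e': "e' \<in> fst ` set c" "f e' \<noteq> 0"
  proof -
    have "(\<Sum>e\<in>fst ` set c. incidence c e * f e) \<noteq> 0" using c by (simp add: coboundary1_def)
    then obtain e' where "e' \<in> fst ` set c" "incidence c e' * f e' \<noteq> 0"
      by (rule sum.not_neutral_contains_not_neutral)
    then show ?thesis using that[of e'] by simp
  qed
  have "d (fst e) (base c) \<le> D" "d (fst e') (base c) \<le> D"
    using faces_through[OF c(1,2)] faces_through[OF c(1) e'(1)] by (auto simp: faces_near_def)
  moreover have v: "fst e \<in> carrier G" "fst e' \<in> carrier G" using eE e' f edge_src by auto
  ultimately have "d (fst e) (fst e') \<le> 2 * D"
    using dist_triangle[OF v(1) base_closed[OF c(1)] v(2)] dist_sym[OF v(2) base_closed[OF c(1)]] by simp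
  then show ?thesis using eE e' by blast
qed

text \<open>A relaxation step changes a function only on edges that share a face with its support.\<close>

lemma relax_propagates:
  assumes c: "c \<in> F" and e: "(relax s ^^ k) (incidence c) e \<noteq> 0"
  shows "d (base c) (fst e) \<le> (2 * D + 1) * (k + 1)"
proof -
  have "d (base c) (fst e) \<le> D + 2 * D * k"
    using e
  proof (induction k arbitrary: e)
    case 0
    then have "e \<in> fst ` set c" using supp_incidence[of c] by auto
    then show ?case using face_vertex_dist(3)[OF c] by auto
  next
    case (Suc k)
    let ?f = "(relax s ^^ k) (incidence c)"
    have f: "?f \<in> cycles" using c by (intro relax_funpow_cycle incidence_cycle)
    have "?f e \<noteq> 0 \<or> face_laplacian ?f e \<noteq> 0" using Suc.prems relax_def[of s ?f] by auto
    then show ?case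
    proof
      assume "?f e \<noteq> 0"
      then show ?thesis using Suc.IH[of e] by simp
    next
      assume "face_laplacian ?f e \<noteq> 0"
      then obtain e' where e': "e \<in> E" "?f e' \<noteq> 0" "d (fst e) (fst e') \<le> 2 * D"
        using face_laplacian_propagates[OF cyclesD[OF f]] by blast
      then have "e' \<in> E" using cyclesD(2)[OF f] by blast
      then have v: "fst e \<in> carrier G" "fst e' \<in> carrier G" using e' edge_src by auto
      show ?thesis
        using dist_triangle[OF base_closed[OF c] v(2,1)] Suc.IH[OF e'(2)] e'(3) dist_sym[OF v] by simp
    qed
  qed
  also have "\<dots> \<le> (2 * D + 1) * (k + 1)" by (simp add: algebra_simps)
  finally show ?thesis .
qed

text \<open>Symmetry allows the relaxation steps to be moved from \<open>f\<close> to the boundaries of single faces. The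
  coefficient at \<open>c\<close> of the filling of \<open>f\<close> is thus the pairing of \<open>f\<close> with the relaxed boundaries of
  \<open>c\<close>, whose decay does not depend on \<open>f\<close>.\<close>

lemma pairing_relax_telescope:
  assumes f: "f \<in> cycles" and fin: "finite (supp (coboundary1 F \<phi>))"
  shows "pairing f \<phi> = pairing ((relax s ^^ K) f) \<phi> +
    s * (\<Sum>k<K. \<Sum>c\<in>supp (coboundary1 F \<phi>). coboundary1 F \<phi> c * pairing f ((relax s ^^ k) (incidence c)))"
proof (induction K)
  case (Suc K)
  let ?f = "(relax s ^^ K) f" and ?\<Phi> = "supp (coboundary1 F \<phi>)"
  have fK: "?f \<in> cycles" using f by (rule relax_funpow_cycle)
  have "pairing (face_laplacian ?f) \<phi> = pairing (coboundary1 F \<phi>) (coboundary1 F ?f)"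
    unfolding pairing_face_laplacian[OF fK] using coboundary1_finite(1)[OF cyclesD[OF fK]] fin by (rule pairing_commute)
  also have "\<dots> = (\<Sum>c\<in>?\<Phi>. coboundary1 F \<phi> c * pairing f ((relax s ^^ K) (incidence c)))"
    unfolding pairing_def[of "coboundary1 F \<phi>"]
  proof (rule sum.cong[OF refl])
    fix c assume "c \<in> ?\<Phi>"
    then have c: "c \<in> F" by (auto simp: coboundary1_def split: if_splits)
    have "coboundary1 F ?f c = pairing (incidence c) ?f" by (rule coboundary1_eq_pairing[OF c])
    also have "\<dots> = pairing ?f (incidence c)"
      using finite_supp_incidence cyclesD(1)[OF fK] by (intro pairing_commute)
    also have "\<dots> = pairing f ((relax s ^^ K) (incidence c))"
      by (rule relax_funpow_symmetric[OF f incidence_cycle[OF c]])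
    finally show "coboundary1 F \<phi> c * coboundary1 F ?f c = coboundary1 F \<phi> c * pairing f ((relax s ^^ K) (incidence c))"
      by simp
  qed
  finally show ?case using Suc pairing_relax[OF fK, of s \<phi>] by (simp add: algebra_simps)
qed simp

lemma sqnorm_incidence_le:
  assumes c: "c \<in> F" shows "sqnorm (incidence c) \<le> real D"
proof -
  have "sqnorm (incidence c) = (\<Sum>e\<in>fst ` set c. incidence c e * incidence c e)"
    by (rule pairing_eq_sum[OF _ supp_incidence]) simp
  also have "\<dots> \<le> (\<Sum>e\<in>fst ` set c. 1)"
    by (intro sum_mono) (simp add: incidence_def)
  also have "\<dots> \<le> real D"
    using card_image_le[of "set c" fst] card_length[of c] face_length[OF c] by simp
  finally show ?thesis .
qed

text \<open>The limit of the telescoping identity for infinitely many relaxation steps. An edge \<open>e\<close> enters the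
  coefficient at the face \<open>c\<close> only after a number of steps proportional to the distance between the
  two, and by then the relaxed boundary of \<open>c\<close> has become exponentially small.\<close>

lemma local_filling:
  assumes gap: "has_spectral_gap E (ell2_0c (carrier G) E) (laplacian1 (carrier G) E F)"
  obtains C r :: real where "C \<ge> 0" "0 < r" "r < 1"
    "\<And>f \<phi>. f \<in> cycles \<Longrightarrow> finite (supp \<phi>) \<Longrightarrow> supp \<phi> \<subseteq> E \<Longrightarrow>
      \<bar>pairing f \<phi>\<bar> \<le> C * (\<Sum>e\<in>supp f. \<bar>f e\<bar> *
        (\<Sum>c\<in>supp (coboundary1 F \<phi>). \<bar>coboundary1 F \<phi> c\<bar> * r ^ d (base c) (fst e)))"
proof -
  obtain s \<theta> where s: "0 < s" and \<theta>: "0 < \<theta>" "\<theta> < 1"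
    and contr: "\<And>f. f \<in> cycles \<Longrightarrow> sqnorm (relax s f) \<le> \<theta> * sqnorm f"
    using relax_contracts[OF gap] by blast
  define h where "h = sqrt (sqrt \<theta>)"
  define L where "L = 2 * D + 1"
  define r where "r = root L h"
  have h: "0 < h" "h < 1" "h * h = sqrt \<theta>" using \<theta> by (auto simp: h_def)
  have L: "L > 0" by (simp add: L_def)
  then have r: "0 < r" "r < 1" "r ^ L = h" using h unfolding r_def by simp_all
  \<comment> \<open>The exponential decay of the norm is shared equally between the number \<open>k\<close> of relaxation steps
    and the distance, which is at most \<open>L * (k + 1)\<close>.\<close>
  have decay: "\<bar>(relax s ^^ k) (incidence c) e\<bar> \<le> sqrt D / h * (h ^ k * r ^ d (base c) (fst e))"
    if c: "c \<in> F" for k c e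
  proof (cases "(relax s ^^ k) (incidence c) e = 0")
    case True
    then show ?thesis using h r by simp
  next
    case False
    let ?u = "(relax s ^^ k) (incidence c)"
    have u: "?u \<in> cycles" using c by (intro relax_funpow_cycle incidence_cycle)
    have "d (base c) (fst e) \<le> L * (k + 1)" using relax_propagates[OF c False] by (simp add: L_def)
    then have "r ^ (L * (k + 1)) \<le> r ^ d (base c) (fst e)" using r by (intro power_decreasing) auto
    then have hr: "h ^ k * h \<le> r ^ d (base c) (fst e)"
      unfolding power_mult r(3) power_add power_one_right .
    have "(?u e)\<^sup>2 \<le> sqnorm ?u" using cyclesD(1)[OF u] by (rule square_le_sqnorm)
    also have "\<dots> \<le> \<theta> ^ k * sqnorm (incidence c)"
      using \<theta> contr incidence_cycle[OF c] by (intro relax_funpow_sqnorm) auto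
    also have "\<dots> \<le> \<theta> ^ k * real D" using sqnorm_incidence_le[OF c] \<theta> by (intro mult_left_mono) auto
    finally have "sqrt ((?u e)\<^sup>2) \<le> sqrt (\<theta> ^ k * real D)" by (rule real_sqrt_le_mono)
    then have "\<bar>?u e\<bar> \<le> sqrt \<theta> ^ k * sqrt D" 
      unfolding real_sqrt_abs unfolding real_sqrt_mult real_sqrt_power .
    also have "\<dots> = sqrt D / h * (h ^ k * (h ^ k * h))"
      using h by (simp add: h(3)[symmetric] power_mult_distrib)
    also have "\<dots> \<le> sqrt D / h * (h ^ k * r ^ d (base c) (fst e))"
      using hr h by (intro mult_left_mono) auto
    finally show ?thesis .
  qed
  define C where "C = s * (sqrt D / h) * (1 / (1 - h))"
  show ?thesis
  proof (rule that)
    show "C \<ge> 0" using s h by (simp add: C_def)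
    show "0 < r" "r < 1" by (fact r)+
    fix f \<phi> assume f: "f \<in> cycles" and \<phi>: "finite (supp \<phi>)" "supp \<phi> \<subseteq> E"
    let ?\<psi> = "coboundary1 F \<phi>"
    have \<psi>: "finite (supp ?\<psi>)" "supp ?\<psi> \<subseteq> F" using coboundary1_finite[OF \<phi>] by auto
    define W where "W = (\<Sum>e\<in>supp f. \<bar>f e\<bar> * (\<Sum>c\<in>supp ?\<psi>. \<bar>?\<psi> c\<bar> * r ^ d (base c) (fst e)))"
    have W0: "W \<ge> 0" unfolding W_def using r by (intro sum_nonneg mult_nonneg_nonneg) auto
    have level: "\<bar>\<Sum>c\<in>supp ?\<psi>. ?\<psi> c * pairing f ((relax s ^^ k) (incidence c))\<bar> \<le> sqrt D / h * h ^ k * W" for k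
    proof -
      have "\<bar>\<Sum>c\<in>supp ?\<psi>. ?\<psi> c * pairing f ((relax s ^^ k) (incidence c))\<bar>
        \<le> (\<Sum>c\<in>supp ?\<psi>. \<bar>?\<psi> c\<bar> * \<bar>pairing f ((relax s ^^ k) (incidence c))\<bar>)"
        by (rule order_trans[OF sum_abs]) (simp add: abs_mult)
      also have "\<dots> \<le> (\<Sum>c\<in>supp ?\<psi>. \<bar>?\<psi> c\<bar> *
          (\<Sum>e\<in>supp f. \<bar>f e\<bar> * (sqrt D / h * (h ^ k * r ^ d (base c) (fst e)))))"
      proof (intro sum_mono mult_left_mono)
        fix c assume "c \<in> supp ?\<psi>"
        then have c: "c \<in> F" using \<psi> by blast
        have "\<bar>pairing f ((relax s ^^ k) (incidence c))\<bar> \<le> (\<Sum>e\<in>supp f. \<bar>f e\<bar> * \<bar>(relax s ^^ k) (incidence c) e\<bar>)"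
          unfolding pairing_def by (rule order_trans[OF sum_abs]) (simp add: abs_mult)
        also have "\<dots> \<le> (\<Sum>e\<in>supp f. \<bar>f e\<bar> * (sqrt D / h * (h ^ k * r ^ d (base c) (fst e))))"
          using decay[OF c] by (intro sum_mono mult_left_mono) auto
        finally show "\<bar>pairing f ((relax s ^^ k) (incidence c))\<bar> \<le>
          (\<Sum>e\<in>supp f. \<bar>f e\<bar> * (sqrt D / h * (h ^ k * r ^ d (base c) (fst e))))" .
      qed simp
      also have "\<dots> = sqrt D / h * h ^ k * W"
        unfolding W_def sum_distrib_left by (subst sum.swap) (simp add: ac_simps)
      finally show ?thesis .
    qed
    have finite_K: "\<bar>pairing f \<phi>\<bar> \<le> sqrt \<theta> ^ K * (sqrt (sqnorm f) * sqrt (sqnorm \<phi>)) + C * W" for K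
    proof -
      let ?u = "(relax s ^^ K) f"
      have u: "?u \<in> cycles" using f by (rule relax_funpow_cycle)
      have "\<bar>pairing ?u \<phi>\<bar> \<le> sqrt (sqnorm ?u) * sqrt (sqnorm \<phi>)"
        by (rule pairing_Cauchy_Schwarz[OF cyclesD(1)[OF u] \<phi>(1)])
      also have "\<dots> \<le> sqrt (\<theta> ^ K * sqnorm f) * sqrt (sqnorm \<phi>)"
        using relax_funpow_sqnorm[OF _ contr f, of K] \<theta> by (intro mult_right_mono real_sqrt_le_mono) (auto simp: sqnorm_nonneg)
      finally have 1: "\<bar>pairing ?u \<phi>\<bar> \<le> sqrt \<theta> ^ K * (sqrt (sqnorm f) * sqrt (sqnorm \<phi>))"
        by (simp add: real_sqrt_mult real_sqrt_power)
      define \<Sigma> where "\<Sigma> = (\<Sum>k<K. \<Sum>c\<in>supp ?\<psi>. ?\<psi> c * pairing f ((relax s ^^ k) (incidence c)))"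
      have "\<bar>\<Sigma>\<bar> \<le> (\<Sum>k<K. sqrt D / h * h ^ k * W)"
        unfolding \<Sigma>_def by (rule order_trans[OF sum_abs sum_mono]) (rule level)
      also have "\<dots> = sqrt D / h * W * (\<Sum>k<K. h ^ k)" 
        unfolding sum_distrib_left by (rule sum.cong) simp_all
      also have "\<dots> \<le> sqrt D / h * W * (1 / (1 - h))"
      proof (rule mult_left_mono)
        have "(\<Sum>k<K. h ^ k) = (1 - h ^ K) / (1 - h)" using h by (simp add: sum_gp_strict)
        also have "\<dots> \<le> 1 / (1 - h)" using h by (intro divide_right_mono) auto
        finally show "(\<Sum>k<K. h ^ k) \<le> 1 / (1 - h)" .
      qed (use W0 h in simp)
      finally have "s * \<bar>\<Sigma>\<bar> \<le> s * (sqrt D / h * W * (1 / (1 - h)))" using s by (intro mult_left_mono) auto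
      then have 2: "\<bar>s * \<Sigma>\<bar> \<le> C * W" using s by (simp add: C_def abs_mult ac_simps)
      have "pairing f \<phi> = pairing ?u \<phi> + s * \<Sigma>"
        unfolding \<Sigma>_def by (rule pairing_relax_telescope[OF f \<psi>(1)])
      then show ?thesis using 1 2 by linarith
    qed
    have "(\<lambda>K. sqrt \<theta> ^ K * (sqrt (sqnorm f) * sqrt (sqnorm \<phi>)) + C * W) \<longlonglongrightarrow> 0 * (sqrt (sqnorm f) * sqrt (sqnorm \<phi>)) + C * W"
      using \<theta> by (intro tendsto_intros LIMSEQ_realpow_zero) auto
    then have "\<bar>pairing f \<phi>\<bar> \<le> 0 * (sqrt (sqnorm f) * sqrt (sqnorm \<phi>)) + C * W"
      by (rule LIMSEQ_le_const) (use finite_K in blast)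
    then show "\<bar>pairing f \<phi>\<bar> \<le> C * (\<Sum>e\<in>supp f. \<bar>f e\<bar> * (\<Sum>c\<in>supp ?\<psi>. \<bar>?\<psi> c\<bar> * r ^ d (base c) (fst e)))"
      by (simp add: W_def)
  qed
qed

section \<open>Integration along paths\<close>

text \<open>The signed edge that leads from \<open>x\<close> to a neighbour \<open>y\<close>. If there are parallel edges, the one that is
  oriented from \<open>x\<close> to \<open>y\<close> is chosen; a step that stays in place gives 0.\<close>

definition seg :: "'a \<Rightarrow> 'a \<Rightarrow> 'a edge \<Rightarrow> real" where
  "seg x y e = (if x = y then 0 else if (x, y) \<in> E then (if e = (x, y) then 1 else 0)
     else if e = (y, x) then - 1 else 0)"

lemma seg_step:
  assumes "x \<in> carrier G" "y \<in> carrier G" "d x y \<le> 1" "x \<noteq> y"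
  obtains p where "fst p \<in> E" "step_src p = x" "step_tgt p = y"
    "seg x y = (\<lambda>e. if e = fst p then sgn_step p else 0)"
proof (cases "(x, y) \<in> E")
  case True
  then show ?thesis using assms that[of "((x, y), True)"] by (simp add: seg_def sgn_step_def fun_eq_iff)
next
  case False
  then have "(y, x) \<in> E" using neighbours_edge[OF assms] by blast
  then show ?thesis using False assms that[of "((y, x), False)"] by (simp add: seg_def sgn_step_def fun_eq_iff)
qed

lemma pairing_single: "pairing (\<lambda>i. if i = j then a else 0) \<phi> = a * \<phi> j"
  by (subst pairing_eq_sum[of "{j}"]) auto

lemma seg_support:
  assumes "x \<in> carrier G" "y \<in> carrier G" "d x y \<le> 1"
  shows "finite (supp (seg x y))" "supp (seg x y) \<subseteq> E"
proof -
  have "supp (seg x y) \<subseteq> (if x = y then {} else E) \<and> finite (supp (seg x y))"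
  proof (cases "x = y")
    case True
    then show ?thesis by (simp add: seg_def)
  next
    case False
    then obtain p where "fst p \<in> E" "seg x y = (\<lambda>e. if e = fst p then sgn_step p else 0)"
      using seg_step[OF assms] by blast
    then have "supp (seg x y) \<subseteq> {fst p}" "fst p \<in> E" by auto
    then show ?thesis using False finite_subset by auto
  qed
  then show "finite (supp (seg x y))" "supp (seg x y) \<subseteq> E" by (auto split: if_splits)
qed

text \<open>The cochain \<open>a db\<close>. The mean value of \<open>a\<close> makes the integral over a step change its sign when the step
  is reversed, whatever the orientation of the edge.\<close>

definition stieltjes :: "('a \<Rightarrow> real) \<Rightarrow> ('a \<Rightarrow> real) \<Rightarrow> 'a edge \<Rightarrow> real" where
  "stieltjes a b e = (if e \<in> E then (a (fst e) + a (snd e)) / 2 * (b (snd e) - b (fst e)) else 0)"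

lemma sgn_step_stieltjes:
  "fst p \<in> E \<Longrightarrow> sgn_step p * stieltjes a b (fst p) =
     (a (step_src p) + a (step_tgt p)) / 2 * (b (step_tgt p) - b (step_src p))"
  by (cases p rule: step_src.cases) (auto simp: stieltjes_def sgn_step_def field_simps)

lemma pairing_seg:
  assumes "x \<in> carrier G" "y \<in> carrier G" "d x y \<le> 1"
  shows "pairing (seg x y) (grad h) = h y - h x"
    "pairing (seg x y) (stieltjes a b) = (a x + a y) / 2 * (b y - b x)"
proof -
  have "pairing (seg x y) (grad h) = h y - h x \<and>
    pairing (seg x y) (stieltjes a b) = (a x + a y) / 2 * (b y - b x)"
  proof (cases "x = y")
    case True
    then show ?thesis by (simp add: seg_def[abs_def] pairing_def)
  next
    case False
    then obtain p where "fst p \<in> E" "step_src p = x" "step_tgt p = y"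
      "seg x y = (\<lambda>e. if e = fst p then sgn_step p else 0)" using seg_step[OF assms] by blast
    then show ?thesis by (simp add: pairing_single sgn_step_grad sgn_step_stieltjes)
  qed
  then show "pairing (seg x y) (grad h) = h y - h x"
    "pairing (seg x y) (stieltjes a b) = (a x + a y) / 2 * (b y - b x)" by auto
qed

definition path_chain :: "(nat \<Rightarrow> 'a) \<Rightarrow> nat \<Rightarrow> 'a edge \<Rightarrow> real" where
  "path_chain \<gamma> n = (\<lambda>e. \<Sum>i<n. 1 * seg (\<gamma> i) (\<gamma> (Suc i)) e)"

lemma pairing_path_chain:
  assumes "is_path \<gamma> n"
  shows "pairing (path_chain \<gamma> n) \<phi> = (\<Sum>i<n. pairing (seg (\<gamma> i) (\<gamma> (Suc i))) \<phi>)"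
proof -
  have "finite (supp (seg (\<gamma> i) (\<gamma> (Suc i))))" if "i \<in> {..<n}" for i
    using that assms by (intro seg_support(1)) (simp_all add: is_path_def)
  then show ?thesis unfolding path_chain_def by (subst pairing_sum_left) simp_all
qed

lemma path_chain_support:
  assumes "is_path \<gamma> n"
  shows "finite (supp (path_chain \<gamma> n))" "supp (path_chain \<gamma> n) \<subseteq> E"
proof -
  have sub: "supp (path_chain \<gamma> n) \<subseteq> (\<Union>i<n. supp (seg (\<gamma> i) (\<gamma> (Suc i))))"
  proof (rule subsetI, rule ccontr)
    fix e assume "e \<in> supp (path_chain \<gamma> n)" "e \<notin> (\<Union>i<n. supp (seg (\<gamma> i) (\<gamma> (Suc i))))"
    then show False by (simp add: path_chain_def)
  qed
  have s: "finite (supp (seg (\<gamma> i) (\<gamma> (Suc i))))" "supp (seg (\<gamma> i) (\<gamma> (Suc i))) \<subseteq> E" if "i < n" for i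
    using that assms by (intro seg_support; simp add: is_path_def)+
  show "finite (supp (path_chain \<gamma> n))" by (rule finite_subset[OF sub]) (use s in auto)
  show "supp (path_chain \<gamma> n) \<subseteq> E" using sub s by blast
qed

lemma path_difference_cycle:
  assumes \<gamma>: "is_path \<gamma> n" and \<delta>: "is_path \<delta> m" and ends: "\<gamma> 0 = \<delta> 0" "\<gamma> n = \<delta> m"
  shows "(\<lambda>e. path_chain \<gamma> n e - 1 * path_chain \<delta> m e) \<in> cycles"
proof -
  let ?f = "\<lambda>e. path_chain \<gamma> n e - 1 * path_chain \<delta> m e"
  have bd: "pairing (path_chain \<gamma> n) (grad h) = h (\<gamma> n) - h (\<gamma> 0)" if "is_path \<gamma> n" for \<gamma> n h
  proof -
    have "pairing (path_chain \<gamma> n) (grad h) = (\<Sum>i<n. h (\<gamma> (Suc i)) - h (\<gamma> i))"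
      unfolding pairing_path_chain[OF that]
      by (intro sum.cong pairing_seg) (use that in \<open>auto simp: is_path_def\<close>)
    then show ?thesis using sum_lessThan_telescope[of "\<lambda>i. h (\<gamma> i)" n] by simp
  qed
  have sub: "supp ?f \<subseteq> supp (path_chain \<gamma> n) \<union> supp (path_chain \<delta> m)" by auto
  have "finite (supp ?f)"
    by (rule finite_subset[OF sub]) (use path_chain_support(1)[OF \<gamma>] path_chain_support(1)[OF \<delta>] in simp)
  moreover have "supp ?f \<subseteq> E"
    using sub path_chain_support(2)[OF \<gamma>] path_chain_support(2)[OF \<delta>] by blast
  moreover have "pairing ?f (grad h) = 0" for h
    unfolding pairing_diff_left[OF path_chain_support(1)[OF \<gamma>] path_chain_support(1)[OF \<delta>]]
      bd[OF \<gamma>] bd[OF \<delta>] ends by simp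
  ultimately show ?thesis unfolding cycles_iff by blast
qed

text \<open>Each step of the path is a single edge, so it is charged for the weight of that edge only.\<close>

lemma path_chain_weight:
  assumes \<gamma>: "is_path \<gamma> n" and A: "finite A" "A \<subseteq> E"
    and w: "\<And>e. e \<in> E \<Longrightarrow> 0 \<le> w e" "\<And>i e. i < n \<Longrightarrow> e \<in> E \<Longrightarrow> fst e \<in> {\<gamma> i, \<gamma> (Suc i)} \<Longrightarrow> w e \<le> \<beta> i"
    and \<beta>: "\<And>i. i < n \<Longrightarrow> 0 \<le> \<beta> i"
  shows "(\<Sum>e\<in>A. \<bar>path_chain \<gamma> n e\<bar> * w e) \<le> (\<Sum>i<n. \<beta> i)"
proof -
  have "(\<Sum>e\<in>A. \<bar>path_chain \<gamma> n e\<bar> * w e) \<le> (\<Sum>e\<in>A. (\<Sum>i<n. \<bar>seg (\<gamma> i) (\<gamma> (Suc i)) e\<bar>) * w e)"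
    unfolding path_chain_def using w(1) A by (intro sum_mono mult_right_mono) (auto intro: order_trans[OF sum_abs])
  also have "\<dots> = (\<Sum>i<n. \<Sum>e\<in>A. \<bar>seg (\<gamma> i) (\<gamma> (Suc i)) e\<bar> * w e)"
    unfolding sum_distrib_right by (rule sum.swap)
  also have "\<dots> \<le> (\<Sum>i<n. \<beta> i)"
  proof (rule sum_mono)
    fix i assume "i \<in> {..<n}"
    then have i: "i < n" by simp
    have c: "\<gamma> i \<in> carrier G" "\<gamma> (Suc i) \<in> carrier G" "d (\<gamma> i) (\<gamma> (Suc i)) \<le> 1"
      using \<gamma> i by (auto simp: is_path_def)
    show "(\<Sum>e\<in>A. \<bar>seg (\<gamma> i) (\<gamma> (Suc i)) e\<bar> * w e) \<le> \<beta> i"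
    proof (cases "\<gamma> i = \<gamma> (Suc i)")
      case True
      then show ?thesis using \<beta>[OF i] by (simp add: seg_def)
    next
      case False
      then obtain p where p: "fst p \<in> E" "step_src p = \<gamma> i" "step_tgt p = \<gamma> (Suc i)"
        "seg (\<gamma> i) (\<gamma> (Suc i)) = (\<lambda>e. if e = fst p then sgn_step p else 0)" using seg_step[OF c] by blast
      have "(\<Sum>e\<in>A. \<bar>seg (\<gamma> i) (\<gamma> (Suc i)) e\<bar> * w e) = (\<Sum>e\<in>A. if e = fst p then w e else 0)"
        unfolding p(4) by (rule sum.cong) (auto simp: sgn_step_def)
      also have "\<dots> \<le> w (fst p)" using A(1) w(1)[OF p(1)] by simp
      also have "\<dots> \<le> \<beta> i" using w(2)[OF i p(1)] step_ends(4)[OF p(1)] p(2,3) by simp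
      finally show ?thesis .
    qed
  qed
  finally show ?thesis .
qed

text \<open>The discrete form of the fact that \<open>da \<and> db\<close> is bounded if \<open>a\<close> and \<open>b\<close> are Lipschitz.\<close>

lemma coboundary1_stieltjes_le:
  assumes c: "c \<in> F"
    and a: "\<And>u v. u \<in> carrier G \<Longrightarrow> v \<in> carrier G \<Longrightarrow> \<bar>a u - a v\<bar> \<le> real (d u v)"
    and b: "\<And>u v. u \<in> carrier G \<Longrightarrow> v \<in> carrier G \<Longrightarrow> \<bar>b u - b v\<bar> \<le> real (d u v)"
  shows "\<bar>coboundary1 F (stieltjes a b) c\<bar> \<le> (real D)\<^sup>2"
proof -
  let ?s = "\<lambda>i. step_src (c ! i)" and ?t = "\<lambda>i. step_tgt (c ! i)"
  have e: "fst (c ! i) \<in> E" if "i < length c" for i using face_edges[OF c] that by auto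
  have "coboundary1 F (stieltjes a b) c = (\<Sum>i<length c. (a (?s i) + a (?t i)) / 2 * (b (?t i) - b (?s i)))"
    unfolding coboundary1_eq_pairing[OF c] pairing_incidence[OF face_cycle[OF c]]
    by (intro sum.cong) (auto simp: sgn_step_stieltjes e)
  \<comment> \<open>Since \<open>b\<close> has no total variation around the cycle, a constant may be subtracted from \<open>a\<close>.\<close>
  also have "\<dots> = (\<Sum>i<length c. ((a (?s i) + a (?t i)) / 2 - a (base c)) * (b (?t i) - b (?s i)))"
    using sum_around_cycle[OF face_cycle[OF c], of b]
    by (simp add: left_diff_distrib sum_subtractf sum_distrib_left[symmetric])
  also have "\<bar>\<dots>\<bar> \<le> (\<Sum>i<length c. real D * 1)"
  proof (rule order_trans[OF sum_abs], rule sum_mono, unfold abs_mult, rule mult_mono)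
    fix i assume "i \<in> {..<length c}"
    then have i: "i < length c" by simp
    have v: "?s i \<in> carrier G" "?t i \<in> carrier G" "d (?s i) (?t i) \<le> 1" "base c \<in> carrier G"
      using step_ends(1-3)[OF e[OF i]] base_closed[OF c] by auto
    have "d (base c) (?s i) \<le> D" "d (base c) (?t i) \<le> D"
      using face_vertex_dist(1,2)[OF c nth_mem[OF i]] by auto
    then have "\<bar>a (base c) - a (?s i)\<bar> \<le> real D" "\<bar>a (base c) - a (?t i)\<bar> \<le> real D"
      using a[OF v(4,1)] a[OF v(4,2)] by linarith+
    moreover have "\<bar>(x + y) / 2 - z\<bar> \<le> k" if "\<bar>z - x\<bar> \<le> k" "\<bar>z - y\<bar> \<le> k" for x y z k :: real
      using that by (auto simp: abs_le_iff field_simps)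
    ultimately show "\<bar>(a (?s i) + a (?t i)) / 2 - a (base c)\<bar> \<le> real D" by blast
    show "\<bar>b (?t i) - b (?s i)\<bar> \<le> 1" using b[OF v(1,2)] v(3) by linarith
  qed auto
  also have "\<dots> \<le> (real D)\<^sup>2"
    using face_length[OF c] by (simp add: power2_eq_square mult_right_mono)
  finally show ?thesis .
qed

section \<open>A spectral gap forces bottlenecks\<close>

definition bump :: "nat \<Rightarrow> 'a \<Rightarrow> 'a \<Rightarrow> real" where
  "bump N p v = max 0 (real N - real (d p v))"

lemma dist_real_Lipschitz:
  assumes "p \<in> carrier G" "u \<in> carrier G" "v \<in> carrier G"
  shows "\<bar>real (d p u) - real (d p v)\<bar> \<le> real (d u v)"
  using dist_triangle[OF assms] dist_triangle[OF assms(1,3,2)] dist_sym[OF assms(2,3)] by linarith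

lemma bump_Lipschitz:
  "p \<in> carrier G \<Longrightarrow> u \<in> carrier G \<Longrightarrow> v \<in> carrier G \<Longrightarrow> \<bar>bump N p u - bump N p v\<bar> \<le> real (d u v)"
  using dist_real_Lipschitz[of p u v] unfolding bump_def by linarith

lemma bump_stieltjes_support:
  assumes p: "p \<in> carrier G"
  shows "finite (supp (stieltjes (bump N p) b))" "supp (stieltjes (bump N p) b) \<subseteq> E"
proof -
  show "supp (stieltjes (bump N p) b) \<subseteq> E" by (auto simp: stieltjes_def split: if_splits)
  have "supp (stieltjes (bump N p) b) \<subseteq> ball p N \<times> ball p N \<union> (\<Union>v\<in>ball p N. {e \<in> E. fst e = v} \<union> {e \<in> E. snd e = v})"
  proof
    fix e assume "e \<in> supp (stieltjes (bump N p) b)"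
    then have e: "e \<in> E" "bump N p (fst e) \<noteq> 0 \<or> bump N p (snd e) \<noteq> 0"
      by (auto simp: stieltjes_def split: if_splits)
    have "fst e \<in> carrier G" "snd e \<in> carrier G" using edge_dist[of "fst e" "snd e"] e by auto
    then have "fst e \<in> ball p N \<or> snd e \<in> ball p N" using e(2) by (auto simp: bump_def in_ball)
    then show "e \<in> ball p N \<times> ball p N \<union> (\<Union>v\<in>ball p N. {e \<in> E. fst e = v} \<union> {e \<in> E. snd e = v})"
      using e(1) by blast
  qed
  then show "finite (supp (stieltjes (bump N p) b))"
    by (rule finite_subset) (use p finite_edges_from finite_edges_to in auto)
qed

lemma coboundary1_bump_near:
  assumes c: "c \<in> F" "coboundary1 F (stieltjes (bump N p) b) c \<noteq> 0" and p: "p \<in> carrier G"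
  shows "d p (base c) \<le> N + D"
proof (rule ccontr)
  assume far: "\<not> ?thesis"
  have zero: "bump N p v = 0" if v: "v \<in> carrier G" "d (base c) v \<le> D" for v
  proof -
    have "d p (base c) \<le> d p v + d v (base c)" using p v base_closed[OF c(1)] by (intro dist_triangle)
    then have "N \<le> d p v" using far v dist_sym[OF v(1) base_closed[OF c(1)]] by simp
    then show ?thesis by (simp add: bump_def)
  qed
  have "sgn_step (c ! i) * stieltjes (bump N p) b (fst (c ! i)) = 0" if "i < length c" for i
  proof -
    have e: "fst (c ! i) \<in> E" using face_edges[OF c(1)] that by auto
    then show ?thesis
      using zero step_ends(1,2)[OF e] face_vertex_dist(1,2)[OF c(1) nth_mem[OF that]]
      by (simp add: sgn_step_stieltjes)
  qed
  then have "(\<Sum>i<length c. sgn_step (c ! i) * stieltjes (bump N p) b (fst (c ! i))) = 0"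
    by (intro sum.neutral) simp
  then show False
    using c(2) unfolding coboundary1_eq_pairing[OF c(1)] pairing_incidence[OF face_cycle[OF c(1)]] by simp
qed

text \<open>Only faces within \<open>N + D\<close> of \<open>p\<close> contribute. Writing \<open>r = \<rho>\<^sup>2\<close>, one factor \<open>\<rho>\<close> accounts for the distance of
  \<open>e\<close> from this region, and the other one makes the sum over the faces converge. The subtraction is
  truncated: inside the region the bound is the constant \<open>K\<close>.\<close>

lemma bump_weight:
  assumes sub: "\<not> exponential_growth G S" and r: "0 < r" "(r :: real) < 1"
  obtains K \<rho> :: real where "K \<ge> 0" "0 < \<rho>" "\<rho> < 1"
    "\<And>N p b e. p \<in> carrier G \<Longrightarrow> e \<in> E \<Longrightarrow>
      (\<And>u v. u \<in> carrier G \<Longrightarrow> v \<in> carrier G \<Longrightarrow> \<bar>b u - b v\<bar> \<le> real (d u v)) \<Longrightarrow>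
      (\<Sum>c\<in>supp (coboundary1 F (stieltjes (bump N p) b)).
        \<bar>coboundary1 F (stieltjes (bump N p) b) c\<bar> * r ^ d (base c) (fst e)) \<le> K * \<rho> ^ (d p (fst e) - (N + D))"
proof -
  define \<rho> where "\<rho> = sqrt r"
  have \<rho>: "0 < \<rho>" "\<rho> < 1" "r = \<rho> * \<rho>" using r by (auto simp: \<rho>_def)
  obtain K where K: "K \<ge> 0"
    "\<And>p A. p \<in> carrier G \<Longrightarrow> finite A \<Longrightarrow> A \<subseteq> carrier G \<Longrightarrow> (\<Sum>v\<in>A. \<rho> ^ d p v) \<le> K"
    using exponential_weight_sum_bounded[OF sub \<rho>(1,2)] by blast
  show ?thesis
  proof (rule that)
    show "(real D)\<^sup>2 * (real face_bound * K) \<ge> 0" using K by simp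
    show "0 < \<rho>" "\<rho> < 1" by (fact \<rho>)+
    fix N p e and b :: "'a \<Rightarrow> real"
    assume p: "p \<in> carrier G" and e: "e \<in> E"
      and b: "\<And>u v. u \<in> carrier G \<Longrightarrow> v \<in> carrier G \<Longrightarrow> \<bar>b u - b v\<bar> \<le> real (d u v)"
    let ?\<psi> = "coboundary1 F (stieltjes (bump N p) b)"
    have \<Phi>: "finite (supp ?\<psi>)" "supp ?\<psi> \<subseteq> F"
      using coboundary1_finite[OF bump_stieltjes_support[OF p]] by auto
    have u: "fst e \<in> carrier G" using e by (rule edge_src)
    let ?\<sigma> = "\<rho> ^ (d p (fst e) - (N + D))"
    have "(\<Sum>c\<in>supp ?\<psi>. \<bar>?\<psi> c\<bar> * r ^ d (base c) (fst e)) \<le> (\<Sum>c\<in>supp ?\<psi>. (real D)\<^sup>2 * (?\<sigma> * \<rho> ^ d (fst e) (base c)))"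
    proof (intro sum_mono mult_mono)
      fix c assume c': "c \<in> supp ?\<psi>"
      then have c: "c \<in> F" "?\<psi> c \<noteq> 0" using \<Phi> by auto
      show "\<bar>?\<psi> c\<bar> \<le> (real D)\<^sup>2" by (intro coboundary1_stieltjes_le c bump_Lipschitz p b)
      have "d p (fst e) \<le> d p (base c) + d (base c) (fst e)" using p u base_closed[OF c(1)] by (intro dist_triangle)
      then have "d p (fst e) - (N + D) \<le> d (base c) (fst e)" using coboundary1_bump_near[OF c p] by simp
      then have "\<rho> ^ d (base c) (fst e) \<le> ?\<sigma>" using \<rho> by (intro power_decreasing) auto
      then have "\<rho> ^ d (base c) (fst e) * \<rho> ^ d (base c) (fst e) \<le> ?\<sigma> * \<rho> ^ d (base c) (fst e)"
        using \<rho> by (intro mult_right_mono) auto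
      then show "r ^ d (base c) (fst e) \<le> ?\<sigma> * \<rho> ^ d (fst e) (base c)"
        using dist_sym[OF u base_closed[OF c(1)]] by (simp add: \<rho>(3) power_mult_distrib)
    qed (use r in auto)
    also have "\<dots> = (real D)\<^sup>2 * (?\<sigma> * (\<Sum>c\<in>supp ?\<psi>. \<rho> ^ d (fst e) (base c)))"
      by (simp add: sum_distrib_left)
    also have "\<dots> \<le> (real D)\<^sup>2 * (?\<sigma> * (real face_bound * K))"
    proof (intro mult_left_mono)
      have bc: "base ` supp ?\<psi> \<subseteq> carrier G" using \<Phi> base_closed by blast
      have "(\<Sum>c\<in>supp ?\<psi>. \<rho> ^ d (fst e) (base c))
        = (\<Sum>v\<in>base ` supp ?\<psi>. \<Sum>c | c \<in> supp ?\<psi> \<and> base c = v. \<rho> ^ d (fst e) (base c))"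
        by (rule sum.image_gen[OF \<Phi>(1)])
      also have "\<dots> \<le> (\<Sum>v\<in>base ` supp ?\<psi>. real face_bound * \<rho> ^ d (fst e) v)"
      proof (rule sum_mono)
        fix v assume "v \<in> base ` supp ?\<psi>"
        then have v: "v \<in> carrier G" using bc by blast
        have "{c \<in> supp ?\<psi>. base c = v} \<subseteq> faces_near v" using \<Phi>(2) v by (auto simp: faces_near_def)
        then have "card {c \<in> supp ?\<psi>. base c = v} \<le> face_bound"
          using faces_near_bound[OF v] card_mono le_trans by blast
        then have "real (card {c \<in> supp ?\<psi>. base c = v}) * \<rho> ^ d (fst e) v \<le> real face_bound * \<rho> ^ d (fst e) v"
          using \<rho> by (intro mult_right_mono) auto
        then show "(\<Sum>c | c \<in> supp ?\<psi> \<and> base c = v. \<rho> ^ d (fst e) (base c)) \<le> real face_bound * \<rho> ^ d (fst e) v"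
          by simp
      qed
      also have "\<dots> = real face_bound * (\<Sum>v\<in>base ` supp ?\<psi>. \<rho> ^ d (fst e) v)" by (simp add: sum_distrib_left)
      also have "\<dots> \<le> real face_bound * K" using K(2)[OF u _ bc] \<Phi>(1) by (intro mult_left_mono) auto
      finally show "(\<Sum>c\<in>supp ?\<psi>. \<rho> ^ d (fst e) (base c)) \<le> real face_bound * K" .
    qed (use \<rho> in auto)
    finally show "(\<Sum>c\<in>supp ?\<psi>. \<bar>?\<psi> c\<bar> * r ^ d (base c) (fst e)) \<le> (real D)\<^sup>2 * (real face_bound * K) * ?\<sigma>"
      by (simp only: ac_simps)
  qed
qed

lemma truncated_geometric_sum:
  assumes "0 < \<rho>" "(\<rho> :: real) < 1"
  shows "(\<Sum>k<M. \<rho> ^ (k - N)) \<le> real N + 1 / (1 - \<rho>)"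
proof -
  have "(\<Sum>k<M. \<rho> ^ (k - N)) \<le> (\<Sum>k<N + M. \<rho> ^ (k - N))"
    using assms by (intro sum_mono2) auto
  also have "\<dots> = (\<Sum>k<N. \<rho> ^ (k - N)) + (\<Sum>k<M. \<rho> ^ k)"
    by (induction M) auto
  also have "(\<Sum>k<M. \<rho> ^ k) \<le> 1 / (1 - \<rho>)"
  proof -
    have "(\<Sum>k<M. \<rho> ^ k) = (1 - \<rho> ^ M) / (1 - \<rho>)" using assms by (simp add: sum_gp_strict)
    also have "\<dots> \<le> 1 / (1 - \<rho>)" using assms by (intro divide_right_mono) auto
    finally show ?thesis .
  qed
  finally show ?thesis by simp
qed

text \<open>A geodesic through \<open>\<gamma> j\<close> has at most two vertices at a given distance from \<open>\<gamma> j\<close>. This is why the bound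
  grows only linearly with \<open>N\<close>, in contrast to a sum over the ball of radius \<open>N\<close>.\<close>

lemma geodesic_weight_sum:
  assumes g: "geodesic \<gamma> n" and j: "j \<le> n" and \<rho>: "0 < \<rho>" "(\<rho> :: real) < 1"
  shows "(\<Sum>i<n. \<rho> ^ (d (\<gamma> j) (\<gamma> i) - N)) \<le> 2 * (real N + 1 / (1 - \<rho>))"
proof -
  have "(\<Sum>i<n. \<rho> ^ (d (\<gamma> j) (\<gamma> i) - N)) = (\<Sum>i<j. \<rho> ^ (d (\<gamma> j) (\<gamma> i) - N)) + (\<Sum>i=j..<n. \<rho> ^ (d (\<gamma> j) (\<gamma> i) - N))"
    using j by (metis (no_types, lifting) lessThan_atLeast0 sum.atLeastLessThan_concat zero_le)
  also have "(\<Sum>i<j. \<rho> ^ (d (\<gamma> j) (\<gamma> i) - N)) = (\<Sum>i<j. \<rho> ^ (Suc i - N))"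
    by (rule sum.reindex_bij_witness[of _ "\<lambda>i. j - Suc i" "\<lambda>i. j - Suc i"])
      (use geodesicD(4)[OF g] j in \<open>auto simp: Suc_diff_Suc\<close>)
  also have "(\<Sum>i<j. \<rho> ^ (Suc i - N)) \<le> (\<Sum>i<j. \<rho> ^ (i - N))"
    using \<rho> by (intro sum_mono power_decreasing) auto
  also have "\<dots> \<le> real N + 1 / (1 - \<rho>)" by (rule truncated_geometric_sum[OF \<rho>])
  also have "(\<Sum>i=j..<n. \<rho> ^ (d (\<gamma> j) (\<gamma> i) - N)) = (\<Sum>i<n - j. \<rho> ^ (i - N))"
    by (rule sum.reindex_bij_witness[of _ "\<lambda>i. i + j" "\<lambda>i. i - j"])
      (use geodesicD(3)[OF g] in auto)
  also have "\<dots> \<le> real N + 1 / (1 - \<rho>)" by (rule truncated_geometric_sum[OF \<rho>])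
  finally show ?thesis by simp
qed

text \<open>Injectivity makes a sum along the path a sum over a set of group elements.\<close>

lemma joined_simple_path:
  assumes "joined B x y" "B \<subseteq> carrier G"
  obtains \<delta> m where "is_path \<delta> m" "\<delta> 0 = x" "\<delta> m = y" "\<And>i. i \<le> m \<Longrightarrow> \<delta> i \<in> B" "inj_on \<delta> {..m}"
proof -
  let ?R = "\<lambda>u v. u \<in> B \<and> v \<in> B \<and> d u v \<le> 1"
  obtain xs' where "rtrancl_path ?R x xs' y"
    using assms(1) unfolding joined_def rtranclp_eq_rtrancl_path by blast
  then obtain xs where xs: "rtrancl_path ?R x xs y" "distinct (x # xs)" by (rule rtrancl_path_distinct)
  define \<delta> where "\<delta> i = (x # xs) ! i" for i
  have step: "?R (\<delta> i) (\<delta> (Suc i))" if "i < length xs" for i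
    using rtrancl_path_nth[OF xs(1) that] by (simp add: \<delta>_def)
  have mem: "\<delta> i \<in> B" if "i \<le> length xs" for i
    using step[of "i - 1"] that joined_mem(1)[OF assms(1)] by (cases i) (auto simp: \<delta>_def)
  show ?thesis
  proof (rule that)
    show "is_path \<delta> (length xs)" using step mem assms(2) by (auto simp: is_path_def)
    show "\<delta> 0 = x" by (simp add: \<delta>_def)
    show "\<delta> (length xs) = y"
    proof (cases "xs = []")
      case True
      then show ?thesis using xs(1) by (auto simp: \<delta>_def elim: rtrancl_path.cases)
    next
      case False
      then show ?thesis using rtrancl_path_last[OF xs(1)] by (simp add: \<delta>_def last_conv_nth nth_Cons')
    qed
    show "\<delta> i \<in> B" if "i \<le> length xs" for i using mem that .
    show "inj_on \<delta> {..length xs}" using xs(2) by (auto simp: inj_on_def \<delta>_def nth_eq_iff_index_eq less_Suc_eq_le)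
  qed
qed

text \<open>On a geodesic from \<open>x\<close> the distance from \<open>x\<close> increases by 1 in every step, and the bump is at least \<open>M\<close>
  on the first \<open>M\<close> steps after \<open>p\<close>.\<close>

lemma bump_geodesic_integral:
  assumes g: "geodesic \<gamma> n" and j: "j + M \<le> n" and p: "\<gamma> j = p" and x: "\<gamma> 0 = x"
  shows "(real M)\<^sup>2 \<le> pairing (path_chain \<gamma> n) (stieltjes (bump (2 * M) p) (\<lambda>v. real (d x v)))"
proof -
  let ?a = "bump (2 * M) p"
  have path: "is_path \<gamma> n" using g by (rule geodesic_path)
  have pos: "?a v \<ge> 0" for v by (simp add: bump_def)
  have "pairing (path_chain \<gamma> n) (stieltjes ?a (\<lambda>v. real (d x v))) = (\<Sum>i<n. (?a (\<gamma> i) + ?a (\<gamma> (Suc i))) / 2)"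
    unfolding pairing_path_chain[OF path]
  proof (rule sum.cong[OF refl])
    fix i assume "i \<in> {..<n}"
    then have i: "i < n" by simp
    have "d x (\<gamma> i) = i" "d x (\<gamma> (Suc i)) = Suc i"
      using geodesicD(3)[OF g, of 0 i] geodesicD(3)[OF g, of 0 "Suc i"] i x by auto
    then show "pairing (seg (\<gamma> i) (\<gamma> (Suc i))) (stieltjes ?a (\<lambda>v. real (d x v))) = (?a (\<gamma> i) + ?a (\<gamma> (Suc i))) / 2"
      using pairing_seg(2)[of "\<gamma> i" "\<gamma> (Suc i)"] path i by (simp add: is_path_def)
  qed
  also have "\<dots> \<ge> (\<Sum>i=j..<j + M. (?a (\<gamma> i) + ?a (\<gamma> (Suc i))) / 2)"
    using pos j by (intro sum_mono2) auto
  also have "(\<Sum>i=j..<j + M. (?a (\<gamma> i) + ?a (\<gamma> (Suc i))) / 2) \<ge> (\<Sum>i=j..<j + M. real M)"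
  proof (rule sum_mono)
    fix i assume i: "i \<in> {j..<j + M}"
    have "d p (\<gamma> i) \<le> M" "d p (\<gamma> (Suc i)) \<le> M"
      using geodesicD(3)[OF g, of j i] geodesicD(3)[OF g, of j "Suc i"] i j p by auto
    then have "?a (\<gamma> i) \<ge> real M" "?a (\<gamma> (Suc i)) \<ge> real M" by (auto simp: bump_def)
    then show "real M \<le> (?a (\<gamma> i) + ?a (\<gamma> (Suc i))) / 2" by simp
  qed
  finally show ?thesis by (simp add: power2_eq_square)
qed

lemma bump_avoiding_integral:
  assumes \<delta>: "is_path \<delta> m" and far: "\<And>i. i \<le> m \<Longrightarrow> N \<le> d p (\<delta> i)"
  shows "pairing (path_chain \<delta> m) (stieltjes (bump N p) b) = 0"
  unfolding pairing_path_chain[OF \<delta>]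
proof (rule sum.neutral, rule ballI)
  fix i assume "i \<in> {..<m}"
  then have i: "i < m" by simp
  have "bump N p (\<delta> i) = 0" "bump N p (\<delta> (Suc i)) = 0" using far[of i] far[of "Suc i"] i by (auto simp: bump_def)
  then show "pairing (seg (\<delta> i) (\<delta> (Suc i))) (stieltjes (bump N p) b) = 0"
    using pairing_seg(2)[of "\<delta> i" "\<delta> (Suc i)" "bump N p" b] \<delta> i by (simp add: is_path_def)
qed

lemma bump_path_weight:
  assumes \<gamma>: "is_path \<gamma> n" and A: "finite A" "A \<subseteq> E" and p: "p \<in> carrier G"
    and K: "0 \<le> K" and \<rho>: "0 < \<rho>" "(\<rho> :: real) < 1"
    and w: "\<And>e. e \<in> E \<Longrightarrow> 0 \<le> w e" "\<And>e. e \<in> E \<Longrightarrow> w e \<le> K * \<rho> ^ (d p (fst e) - L)"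
  shows "(\<Sum>e\<in>A. \<bar>path_chain \<gamma> n e\<bar> * w e) \<le> K * (\<Sum>i<n. \<rho> ^ (d p (\<gamma> i) - (L + 1)))"
proof -
  have "(\<Sum>e\<in>A. \<bar>path_chain \<gamma> n e\<bar> * w e) \<le> (\<Sum>i<n. K * \<rho> ^ (d p (\<gamma> i) - (L + 1)))"
  proof (rule path_chain_weight[OF \<gamma> A w(1)])
    fix i e assume i: "i < n" and e: "e \<in> E" "fst e \<in> {\<gamma> i, \<gamma> (Suc i)}"
    have c: "\<gamma> i \<in> carrier G" "\<gamma> (Suc i) \<in> carrier G" "d (\<gamma> i) (\<gamma> (Suc i)) \<le> 1"
      using \<gamma> i by (auto simp: is_path_def)
    then have "d p (\<gamma> i) \<le> d p (fst e) + 1"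
      using e(2) dist_triangle[OF p c(2,1)] dist_sym[OF c(1,2)] by auto
    then have "\<rho> ^ (d p (fst e) - L) \<le> \<rho> ^ (d p (\<gamma> i) - (L + 1))" using \<rho> by (intro power_decreasing) auto
    then show "w e \<le> K * \<rho> ^ (d p (\<gamma> i) - (L + 1))" using w(2)[OF e(1)] K by (meson mult_left_mono order_trans)
  qed (use K \<rho> in auto)
  then show ?thesis by (simp add: sum_distrib_left)
qed

text \<open>The loop consists of a geodesic through \<open>p\<close> and a simple path that avoids the ball of radius \<open>n0\<close>
  about \<open>p\<close>. The radius \<open>n0\<close> is chosen after \<open>M\<close>, so large that the avoiding path contributes at most 1 to
  the filling bound.\<close>

theorem gap_bottleneck:
  assumes gap: "has_spectral_gap E (ell2_0c (carrier G) E) (laplacian1 (carrier G) E F)"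
    and sub: "\<not> exponential_growth G S"
  shows "\<exists>n. bottleneck n"
proof -
  obtain C r :: real where C: "C \<ge> 0" and r: "0 < r" "r < 1"
    and fill: "\<And>f \<phi>. f \<in> cycles \<Longrightarrow> finite (supp \<phi>) \<Longrightarrow> supp \<phi> \<subseteq> E \<Longrightarrow>
      \<bar>pairing f \<phi>\<bar> \<le> C * (\<Sum>e\<in>supp f. \<bar>f e\<bar> *
        (\<Sum>c\<in>supp (coboundary1 F \<phi>). \<bar>coboundary1 F \<phi> c\<bar> * r ^ d (base c) (fst e)))"
    by (rule local_filling[OF gap]) blast
  obtain K \<rho> :: real where K: "K \<ge> 0" and \<rho>: "0 < \<rho>" "\<rho> < 1"
    and weight: "\<And>N p b e. p \<in> carrier G \<Longrightarrow> e \<in> E \<Longrightarrow>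
      (\<And>u v. u \<in> carrier G \<Longrightarrow> v \<in> carrier G \<Longrightarrow> \<bar>b u - b v\<bar> \<le> real (d u v)) \<Longrightarrow>
      (\<Sum>c\<in>supp (coboundary1 F (stieltjes (bump N p) b)).
        \<bar>coboundary1 F (stieltjes (bump N p) b) c\<bar> * r ^ d (base c) (fst e)) \<le> K * \<rho> ^ (d p (fst e) - (N + D))"
    by (rule bump_weight[OF sub r]) blast
  define \<tau> where "\<tau> = sqrt \<rho>"
  have \<tau>: "0 < \<tau>" "\<tau> < 1" "\<rho> = \<tau> * \<tau>" using \<rho> by (auto simp: \<tau>_def)
  obtain T where T: "T \<ge> 0"
    "\<And>p A. p \<in> carrier G \<Longrightarrow> finite A \<Longrightarrow> A \<subseteq> carrier G \<Longrightarrow> (\<Sum>v\<in>A. \<tau> ^ d p v) \<le> T"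
    using exponential_weight_sum_bounded[OF sub \<tau>(1,2)] by blast
  \<comment> \<open>The integral over the geodesic grows like \<open>M\<^sup>2\<close> and its filling bound only linearly in \<open>M\<close>.\<close>
  define a b where "a = 4 * (C * K)" and "b = 2 * (C * K) * (real D + 1 + 1 / (1 - \<rho>)) + 1"
  have ab: "a \<ge> 0" "b \<ge> 1" using C K \<rho> by (auto simp: a_def b_def)
  obtain M :: nat where M: "a + b < real M" using reals_Archimedean2 by blast
  define L where "L = 2 * M + D + 1"
  have "\<exists>n. \<tau> ^ n < \<rho> ^ L / (C * K * T + 1)"
    using C K T \<rho> \<tau> by (intro real_arch_pow_inv divide_pos_pos add_nonneg_pos mult_nonneg_nonneg) auto
  then obtain n1 where n1: "\<tau> ^ n1 < \<rho> ^ L / (C * K * T + 1)" by blast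
  define n0 where "n0 = n1 + L"
  have small: "C * (K * (\<tau> ^ n0 / \<rho> ^ L * T)) \<le> 1"
  proof -
    have "\<tau> ^ n0 \<le> \<tau> ^ n1" using \<tau> by (intro power_decreasing) (auto simp: n0_def)
    then have "\<tau> ^ n0 / \<rho> ^ L \<le> \<tau> ^ n1 / \<rho> ^ L" using \<rho> by (intro divide_right_mono) auto
    also have "\<dots> \<le> 1 / (C * K * T + 1)"
    proof -
      have "\<tau> ^ n1 / \<rho> ^ L \<le> (\<rho> ^ L / (C * K * T + 1)) / \<rho> ^ L" using n1 \<rho> by (intro divide_right_mono) auto
      then show ?thesis using \<rho> by simp
    qed
    finally have "C * K * T * (\<tau> ^ n0 / \<rho> ^ L) \<le> C * K * T * (1 / (C * K * T + 1))"
      using C K T by (intro mult_left_mono) auto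
    also have "\<dots> \<le> 1" using C K T by (simp add: divide_le_eq add_nonneg_pos)
    finally show ?thesis by (simp add: ac_simps)
  qed
  have "bottleneck n0"
    unfolding bottleneck_def
  proof (intro ballI impI notI)
    fix x y p
    assume xyp: "x \<in> carrier G" "y \<in> carrier G" "p \<in> carrier G" and btw: "d x p + d p y = d x y"
      and joined: "joined (off p n0) x y"
    obtain \<delta> m where \<delta>: "is_path \<delta> m" "\<delta> 0 = x" "\<delta> m = y"
      "\<And>i. i \<le> m \<Longrightarrow> \<delta> i \<in> off p n0" "inj_on \<delta> {..m}"
      using joined_simple_path[OF joined off_sub] by blast
    define n j where "n = d x y" and "j = d x p"
    obtain \<gamma> where \<gamma>: "geodesic \<gamma> n" "\<gamma> 0 = x" "\<gamma> j = p" "\<gamma> n = y"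
      unfolding n_def j_def using geodesic_through[OF xyp(1,3,2) btw] .
    have path: "is_path \<gamma> n" using \<gamma>(1) by (rule geodesic_path)
    have "n0 < d p y" using joined_mem(2)[OF joined] unfolding in_off by blast
    then have jM: "j + M \<le> n" and jn: "j \<le> n" using btw by (auto simp: n0_def L_def n_def j_def)
    define \<phi> where "\<phi> = stieltjes (bump (2 * M) p) (\<lambda>v. real (d x v))"
    define f where "f = (\<lambda>e. path_chain \<gamma> n e - 1 * path_chain \<delta> m e)"
    have f: "f \<in> cycles"
      unfolding f_def by (rule path_difference_cycle[OF path \<delta>(1)]) (use \<gamma> \<delta> in auto)
    have far: "n0 < d p (\<delta> i)" if "i \<le> m" for i using \<delta>(4)[OF that] unfolding in_off by blast
    have "pairing (path_chain \<delta> m) \<phi> = 0"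
      unfolding \<phi>_def by (rule bump_avoiding_integral[OF \<delta>(1)]) (use far in \<open>force simp: n0_def L_def\<close>)
    then have "pairing f \<phi> = pairing (path_chain \<gamma> n) \<phi>"
      unfolding f_def using pairing_diff_left[OF path_chain_support(1)[OF path] path_chain_support(1)[OF \<delta>(1)], of 1 \<phi>]
      by simp
    then have lower: "(real M)\<^sup>2 \<le> pairing f \<phi>"
      using bump_geodesic_integral[OF \<gamma>(1) jM \<gamma>(3,2)] by (simp add: \<phi>_def)
    define w where "w e = (\<Sum>c\<in>supp (coboundary1 F \<phi>). \<bar>coboundary1 F \<phi> c\<bar> * r ^ d (base c) (fst e))" for e :: "'a edge"
    have w0: "0 \<le> w e" for e unfolding w_def using r by (intro sum_nonneg) auto
    have w: "w e \<le> K * \<rho> ^ (d p (fst e) - (2 * M + D))" if "e \<in> E" for e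
      unfolding w_def \<phi>_def using weight[OF xyp(3) that dist_real_Lipschitz[OF xyp(1)]] .
    have A: "finite (supp f)" "supp f \<subseteq> E" using cyclesD f by blast+
    have "(\<Sum>e\<in>supp f. \<bar>f e\<bar> * w e) \<le> (\<Sum>e\<in>supp f. \<bar>path_chain \<gamma> n e\<bar> * w e + \<bar>path_chain \<delta> m e\<bar> * w e)"
    proof (rule sum_mono)
      fix e
      have "\<bar>f e\<bar> \<le> \<bar>path_chain \<gamma> n e\<bar> + \<bar>path_chain \<delta> m e\<bar>" unfolding f_def by linarith
      then have "\<bar>f e\<bar> * w e \<le> (\<bar>path_chain \<gamma> n e\<bar> + \<bar>path_chain \<delta> m e\<bar>) * w e" using w0 by (intro mult_right_mono)
      then show "\<bar>f e\<bar> * w e \<le> \<bar>path_chain \<gamma> n e\<bar> * w e + \<bar>path_chain \<delta> m e\<bar> * w e" by (simp add: distrib_right)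
    qed
    also have "\<dots> = (\<Sum>e\<in>supp f. \<bar>path_chain \<gamma> n e\<bar> * w e) + (\<Sum>e\<in>supp f. \<bar>path_chain \<delta> m e\<bar> * w e)"
      by (rule sum.distrib)
    also have "\<dots> \<le> K * (\<Sum>i<n. \<rho> ^ (d p (\<gamma> i) - L)) + K * (\<Sum>i<m. \<rho> ^ (d p (\<delta> i) - L))"
      unfolding L_def
      using bump_path_weight[OF path A xyp(3) K \<rho> w0 w] bump_path_weight[OF \<delta>(1) A xyp(3) K \<rho> w0 w]
      by (rule add_mono)
    also have "\<dots> \<le> K * (2 * (real L + 1 / (1 - \<rho>))) + K * (\<tau> ^ n0 / \<rho> ^ L * T)"
    proof (intro add_mono mult_left_mono K)
      show "(\<Sum>i<n. \<rho> ^ (d p (\<gamma> i) - L)) \<le> 2 * (real L + 1 / (1 - \<rho>))"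
        using geodesic_weight_sum[OF \<gamma>(1) jn \<rho>] by (simp add: \<gamma>(3))
      have "(\<Sum>i<m. \<rho> ^ (d p (\<delta> i) - L)) \<le> (\<Sum>i<m. \<tau> ^ n0 / \<rho> ^ L * \<tau> ^ d p (\<delta> i))"
      proof (rule sum_mono)
        fix i assume "i \<in> {..<m}"
        then have i: "n0 \<le> d p (\<delta> i)" using far[of i] by simp
        then have "L \<le> d p (\<delta> i)" by (simp add: n0_def)
        then have "\<rho> ^ (d p (\<delta> i) - L) = \<rho> ^ d p (\<delta> i) / \<rho> ^ L" using \<rho> by (simp add: power_diff)
        also have "\<rho> ^ d p (\<delta> i) = \<tau> ^ d p (\<delta> i) * \<tau> ^ d p (\<delta> i)" by (simp add: \<tau>(3) power_mult_distrib)
        also have "\<dots> \<le> \<tau> ^ n0 * \<tau> ^ d p (\<delta> i)" using i \<tau> by (intro mult_right_mono power_decreasing) auto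
        finally show "\<rho> ^ (d p (\<delta> i) - L) \<le> \<tau> ^ n0 / \<rho> ^ L * \<tau> ^ d p (\<delta> i)" using \<rho> by (simp add: divide_right_mono)
      qed
      also have "\<dots> = \<tau> ^ n0 / \<rho> ^ L * (\<Sum>v\<in>\<delta> ` {..<m}. \<tau> ^ d p v)"
        unfolding sum_distrib_left[symmetric] by (subst sum.reindex) (auto intro: inj_on_subset[OF \<delta>(5)])
      also have "\<dots> \<le> \<tau> ^ n0 / \<rho> ^ L * T"
      proof (rule mult_left_mono)
        have "\<delta> ` {..<m} \<subseteq> carrier G" using \<delta>(1) by (auto simp: is_path_def)
        then show "(\<Sum>v\<in>\<delta> ` {..<m}. \<tau> ^ d p v) \<le> T" by (intro T(2) xyp(3)) auto
      qed (use \<tau> \<rho> in auto)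
      finally show "(\<Sum>i<m. \<rho> ^ (d p (\<delta> i) - L)) \<le> \<tau> ^ n0 / \<rho> ^ L * T" .
    qed
    finally have "C * (\<Sum>e\<in>supp f. \<bar>f e\<bar> * w e) \<le> C * (K * (2 * (real L + 1 / (1 - \<rho>))) + K * (\<tau> ^ n0 / \<rho> ^ L * T))"
      using C by (intro mult_left_mono)
    also have "\<dots> \<le> C * (K * (2 * (real L + 1 / (1 - \<rho>)))) + 1" using small by (simp add: distrib_left)
    also have "\<dots> = a * real M + b" by (simp add: a_def b_def L_def algebra_simps)
    finally have upper: "C * (\<Sum>e\<in>supp f. \<bar>f e\<bar> * w e) \<le> a * real M + b" .
    have "\<bar>pairing f \<phi>\<bar> \<le> C * (\<Sum>e\<in>supp f. \<bar>f e\<bar> * w e)"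
      unfolding w_def by (rule fill[OF f]) (use bump_stieltjes_support[OF xyp(3)] in \<open>auto simp: \<phi>_def\<close>)
    then have "(real M)\<^sup>2 \<le> a * real M + b" using lower upper by linarith
    moreover have "b \<le> b * real M" using ab M by (simp add: mult_le_cancel_left1)
    moreover have "(a + b) * real M < real M * real M" using ab M by (intro mult_strict_right_mono) auto
    ultimately show False by (simp add: power2_eq_square distrib_right)
  qed
  then show ?thesis ..
qed

end

section \<open>The dichotomy\<close>

theorem theorem1p5:
  fixes G :: "('a, 'b) monoid_scheme"
    and S :: "'a set"
    and R :: "'a word set"
    and D :: nat
    and F :: "'a step list set"
  assumes "group G"
    and "countable (carrier G)"
    and "infinite (carrier G)"
    and "finite S"
    and "S \<subseteq> carrier G"
    and "generate G S = carrier G"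
    and "finite R"
    and "is_presentation G S R"
    and "\<forall>r \<in> R. length r \<le> D"
    and "is_face_set (cayley_edges G S) D F"
    and "simply_connected_space (complex_space (carrier G) (cayley_edges G S) F)"
    and "has_spectral_gap (cayley_edges G S) (ell2_0c (carrier G) (cayley_edges G S))
           (laplacian1 (carrier G) (cayley_edges G S) F)"
  shows "exponential_growth G S \<or> virtually_infinite_cyclic G"
proof -
  interpret group G by (rule assms(1))
  interpret cayley_complex G S D F
  proof unfold_locales
    show "word_value G ` words S = carrier G"
      using assms(8) by (simp add: is_presentation_def)
  qed (use assms(4,5,10) in auto)
  show ?thesis
  proof (cases "exponential_growth G S")
    case False
    then obtain n where "bottleneck n" using gap_bottleneck[OF assms(12)] by blast
    then show ?thesis using bottleneck_dichotomy[OF assms(3)] by blast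
  qed simp
qed

end
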